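(* Let $G$ be a Lie group that is a closed subgroup of $GL_N(\mathbb{C})$ for some $N$. Then there is a homotopy equivalence $$\Sigma(\mathrm{Comm}(G))\to\bigvee_{n\ge1}\Sigma\big(\widehat{\mathrm{Hom}}(\mathbb{Z}^n,G)\big).$$
   Context: $\Sigma$ denotes the suspension of a pointed space. $\mathrm{Hom}(\mathbb{Z}^k,G)\subseteq G^k$ is the space of pairwise commuting $k$-tuples with the subspace topology ($\mathrm{Hom}(\mathbb{Z}^0,G)$ is the point $\{1_G\}$). $\mathrm{Assoc}(G)=\big(\bigsqcup_{k\ge0}G^k\big)/\sim$ with the quotient topology, where $\sim$ is generated by $(g_1,\dots,g_n)\sim(g_1,\dots,\widehat{g_i},\dots,g_n)$ whenever $g_i=1_G$; $\mathrm{Comm}(G)=\big(\bigsqcup_{k\ge0}\mathrm{Hom}(\mathbb{Z}^k,G)\big)/\sim$ (same relation), topologized as a subspace of $\mathrm{Assoc}(G)$, with base-point the class of $1_G$. $S_k(G)\subset\mathrm{Hom}(\mathbb{Z}^k,G)$ is the subspace of commuting $k$-tuples with at least one coordinate equal to $1_G$, and $\widehat{\mathrm{Hom}}(\mathbb{Z}^k,G)=\mathrm{Hom}(\mathbb{Z}^k,G)/S_k(G)$. *)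

theory Defs
  imports "HOL-Analysis.Analysis" "HOL-Algebra.Group"
begin

section \<open>Quotient spaces\<close>

definition quotient_topology :: "'a topology \<Rightarrow> ('a \<times> 'a) set \<Rightarrow> 'a set topology" where
  "quotient_topology X r = topology (\<lambda>U. U \<subseteq> topspace X // r \<and> openin X (\<Union>U))"

lemma Union_classes_inter:
  assumes "equiv A r" "S \<subseteq> A // r" "T \<subseteq> A // r"
  shows "\<Union>(S \<inter> T) = \<Union>S \<inter> \<Union>T"
proof -
  have "P = Q" if "P \<in> S" "Q \<in> T" "x \<in> P" "x \<in> Q" for P Q x
    using quotient_disj[OF assms(1), of P Q] that assms(2,3) by blast
  then show ?thesis by blast
qed

lemma openin_quotient_topology:
  assumes "equiv (topspace X) r"
  shows "openin (quotient_topology X r) U \<longleftrightarrow> U \<subseteq> topspace X // r \<and> openin X (\<Union>U)"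
proof -
  have "istopology (\<lambda>U. U \<subseteq> topspace X // r \<and> openin X (\<Union>U))"
    unfolding istopology_def
  proof (intro conjI allI impI)
    fix S T assume "S \<subseteq> topspace X // r \<and> openin X (\<Union>S)" "T \<subseteq> topspace X // r \<and> openin X (\<Union>T)"
    then show "S \<inter> T \<subseteq> topspace X // r" "openin X (\<Union>(S \<inter> T))"
      by (auto simp: Union_classes_inter[OF assms])
  next
    fix \<K> assume "\<forall>K\<in>\<K>. K \<subseteq> topspace X // r \<and> openin X (\<Union>K)"
    moreover have "\<Union>(\<Union>\<K>) = (\<Union>K\<in>\<K>. \<Union>K)" by blast
    ultimately show "\<Union>\<K> \<subseteq> topspace X // r" "openin X (\<Union>(\<Union>\<K>))" by auto
  qed
  then show ?thesis by (simp add: quotient_topology_def)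
qed

lemma topspace_quotient_topology:
  assumes "equiv (topspace X) r"
  shows "topspace (quotient_topology X r) = topspace X // r"
proof -
  have "openin (quotient_topology X r) (topspace X // r)"
    by (simp add: openin_quotient_topology[OF assms] Union_quotient[OF assms])
  then show ?thesis
    using openin_quotient_topology[OF assms] openin_subset openin_topspace by blast
qed

lemma quotient_map_quotient_topology:
  assumes "equiv (topspace X) r"
  shows "quotient_map X (quotient_topology X r) (\<lambda>x. r `` {x})"
proof -
  have img: "(\<lambda>x. r `` {x}) ` topspace X = topspace X // r"
    by (auto simp: quotient_def)
  have "{x \<in> topspace X. r `` {x} \<in> U} = \<Union>U" if U: "U \<subseteq> topspace X // r" for U
  proof (intro equalityI subsetI)
    fix x assume "x \<in> {x \<in> topspace X. r `` {x} \<in> U}"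
    then show "x \<in> \<Union>U" using equiv_class_self[OF assms, of x] by blast
  next
    fix x assume "x \<in> \<Union>U"
    then obtain C where C: "C \<in> U" "x \<in> C" by blast
    with U have "C \<in> topspace X // r" by blast
    then obtain y where y: "y \<in> topspace X" "C = r `` {y}" by (rule quotientE)
    then have "(y, x) \<in> r" using C by simp
    then have "r `` {y} = r `` {x}" "x \<in> topspace X"
      using equiv_class_eq_iff[OF assms] by blast+
    then show "x \<in> {x \<in> topspace X. r `` {x} \<in> U}" using C y by simp
  qed
  then show ?thesis
    by (simp add: quotient_map_def topspace_quotient_topology[OF assms] img
        openin_quotient_topology[OF assms])
qed

section \<open>Pointed spaces\<close>

type_synonym 'a pointed_space = "'a topology \<times> 'a"

text \<open>The quotient \<open>X/A\<close>, for nonempty \<open>A \<subseteq> topspace X\<close>; its base point is the class \<open>A\<close>.\<close>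

definition collapse :: "'a topology \<Rightarrow> 'a set \<Rightarrow> 'a set pointed_space" where
  "collapse X A =
    (quotient_topology X {(x, y) \<in> topspace X \<times> topspace X. x = y \<or> x \<in> A \<and> y \<in> A}, A)"

lemma equiv_collapse:
  "equiv (topspace X) {(x, y) \<in> topspace X \<times> topspace X. x = y \<or> x \<in> A \<and> y \<in> A}"
  by (intro equivI refl_onI symI transI) auto

lemma collapse_base_point:
  assumes "A \<subseteq> topspace X" "A \<noteq> {}"
  shows "snd (collapse X A) \<in> topspace (fst (collapse X A))"
proof -
  obtain a where "a \<in> A" using assms(2) by blast
  then have "{(x, y) \<in> topspace X \<times> topspace X. x = y \<or> x \<in> A \<and> y \<in> A} `` {a} = A" "a \<in> topspace X"
    using assms(1) by auto
  then show ?thesis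
    using quotientI[of a "topspace X" "{(x, y) \<in> topspace X \<times> topspace X. x = y \<or> x \<in> A \<and> y \<in> A}"]
    unfolding collapse_def fst_conv snd_conv topspace_quotient_topology[OF equiv_collapse] by metis
qed

text \<open>Reduced suspension: the segment over the base point is collapsed as well.\<close>

definition suspension :: "'a pointed_space \<Rightarrow> ('a \<times> real) set pointed_space" where
  "suspension = (\<lambda>(X, x0).
    collapse (prod_topology X (top_of_set {0..1})) (topspace X \<times> {0, 1} \<union> {x0} \<times> {0..1}))"

definition wedge :: "'i set \<Rightarrow> ('i \<Rightarrow> 'a pointed_space) \<Rightarrow> ('i \<times> 'a) set pointed_space" where
  "wedge I X = collapse (sum_topology (\<lambda>i. fst (X i)) I) ((\<lambda>i. (i, snd (X i))) ` I)"

section \<open>Commuting tuples\<close>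

text \<open>
  A topological group is a group record whose carrier is a subset of a topological space, with the
  subspace topology. A \<open>k\<close>-tuple is an extensional function on \<open>{..<k}\<close>.
\<close>

definition tuple_space :: "('a::topological_space, 'b) monoid_scheme \<Rightarrow> nat \<Rightarrow> (nat \<Rightarrow> 'a) topology" where
  "tuple_space G k = product_topology (\<lambda>_. top_of_set (carrier G)) {..<k}"

definition Hom :: "('a::topological_space, 'b) monoid_scheme \<Rightarrow> nat \<Rightarrow> (nat \<Rightarrow> 'a) topology" where
  "Hom G k = subtopology (tuple_space G k)
    {g. \<forall>i<k. \<forall>j<k. g i \<otimes>\<^bsub>G\<^esub> g j = g j \<otimes>\<^bsub>G\<^esub> g i}"

definition Hom_degenerate :: "('a::topological_space, 'b) monoid_scheme \<Rightarrow> nat \<Rightarrow> (nat \<Rightarrow> 'a) set" where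
  "Hom_degenerate G k = {g \<in> topspace (Hom G k). \<exists>i<k. g i = \<one>\<^bsub>G\<^esub>}"

definition hat_Hom :: "('a::topological_space, 'b) monoid_scheme \<Rightarrow> nat \<Rightarrow> (nat \<Rightarrow> 'a) set pointed_space" where
  "hat_Hom G k = collapse (Hom G k) (Hom_degenerate G k)"

section \<open>The spaces \<open>Assoc(G)\<close> and \<open>Comm(G)\<close>\<close>

inductive drop_unit :: "('a::topological_space, 'b) monoid_scheme \<Rightarrow> nat \<times> (nat \<Rightarrow> 'a) \<Rightarrow> nat \<times> (nat \<Rightarrow> 'a) \<Rightarrow> bool"
  for G where
  "\<lbrakk>g \<in> topspace (tuple_space G (Suc n)); i < Suc n; g i = \<one>\<^bsub>G\<^esub>\<rbrakk> \<Longrightarrow>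
    drop_unit G (Suc n, g) (n, \<lambda>j\<in>{..<n}. if j < i then g j else g (Suc j))"

definition all_tuples :: "('a::topological_space, 'b) monoid_scheme \<Rightarrow> (nat \<times> (nat \<Rightarrow> 'a)) topology" where
  "all_tuples G = sum_topology (tuple_space G) UNIV"

definition all_commuting_tuples :: "('a::topological_space, 'b) monoid_scheme \<Rightarrow> (nat \<times> (nat \<Rightarrow> 'a)) set" where
  "all_commuting_tuples G = (SIGMA k:UNIV. topspace (Hom G k))"

definition Assoc_rel :: "('a::topological_space, 'b) monoid_scheme \<Rightarrow> ((nat \<times> (nat \<Rightarrow> 'a)) \<times> (nat \<times> (nat \<Rightarrow> 'a))) set" where
  "Assoc_rel G = {(p, q) \<in> topspace (all_tuples G) \<times> topspace (all_tuples G). equivclp (drop_unit G) p q}"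

definition Assoc :: "('a::topological_space, 'b) monoid_scheme \<Rightarrow> (nat \<times> (nat \<Rightarrow> 'a)) set topology" where
  "Assoc G = quotient_topology (all_tuples G) (Assoc_rel G)"

text \<open>
  The points of \<open>Comm(G)\<close> are taken to be \<open>Assoc_rel\<close>-classes of commuting tuples. These are also
  the classes of the equivalence relation generated on commuting tuples alone, see
  \<open>Assoc_rel_commuting\<close> below.
\<close>

definition Comm :: "('a::topological_space, 'b) monoid_scheme \<Rightarrow> (nat \<times> (nat \<Rightarrow> 'a)) set pointed_space" where
  "Comm G = (subtopology (Assoc G) (all_commuting_tuples G // Assoc_rel G),
    Assoc_rel G `` {(1, \<lambda>j\<in>{..<1}. \<one>\<^bsub>G\<^esub>)})"

lemma equiv_Assoc_rel: "equiv (topspace (all_tuples G)) (Assoc_rel G)"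
proof (intro equivI refl_onI symI transI)
  show "(p, p) \<in> Assoc_rel G" if "p \<in> topspace (all_tuples G)" for p
    using that by (simp add: Assoc_rel_def)
  show "(q, p) \<in> Assoc_rel G" if "(p, q) \<in> Assoc_rel G" for p q
    using that by (auto simp: Assoc_rel_def intro: equivclp_sym)
  show "(p, s) \<in> Assoc_rel G" if "(p, q) \<in> Assoc_rel G" "(q, s) \<in> Assoc_rel G" for p q s
    using that by (auto simp: Assoc_rel_def intro: equivclp_trans)
qed (auto simp: Assoc_rel_def)

lemma drop_unit_commuting:
  assumes "monoid G" "drop_unit G p q"
  shows "p \<in> all_commuting_tuples G \<longleftrightarrow> q \<in> all_commuting_tuples G"
  using assms(2)
proof cases
  case (1 g n i)
  interpret monoid G by fact
  let ?h = "\<lambda>j\<in>{..<n}. if j < i then g j else g (Suc j)"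
  have g: "g j \<in> carrier G" if "j < Suc n" for j
    using 1(3) that by (auto simp: tuple_space_def)
  have h: "?h \<in> topspace (tuple_space G n)"
    using g by (auto simp: tuple_space_def)
  have "(\<forall>a<Suc n. \<forall>b<Suc n. g a \<otimes>\<^bsub>G\<^esub> g b = g b \<otimes>\<^bsub>G\<^esub> g a) \<longleftrightarrow>
      (\<forall>a<n. \<forall>b<n. ?h a \<otimes>\<^bsub>G\<^esub> ?h b = ?h b \<otimes>\<^bsub>G\<^esub> ?h a)" (is "?L \<longleftrightarrow> ?R")
  proof
    show ?R if ?L using that by auto
    assume R: ?R
    have *: "\<exists>a'<n. g a = ?h a'" if "a < Suc n" "a \<noteq> i" for a
    proof (cases "a < i")
      case True then show ?thesis using 1(4) by (intro exI[of _ a]) auto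
    next
      case False then show ?thesis using that by (intro exI[of _ "a - 1"]) auto
    qed
    show ?L
    proof (intro allI impI)
      fix a b assume ab: "a < Suc n" "b < Suc n"
      show "g a \<otimes>\<^bsub>G\<^esub> g b = g b \<otimes>\<^bsub>G\<^esub> g a"
      proof (cases "a = i \<or> b = i")
        case True then show ?thesis using g 1(5) ab by auto
      next
        case False
        then obtain a' b' where "a' < n" "g a = ?h a'" "b' < n" "g b = ?h b'"
          using * ab by meson
        then show ?thesis using R by presburger
      qed
    qed
  qed
  then show ?thesis
    using h 1(3) unfolding 1(1) 1(2) all_commuting_tuples_def Hom_def
    by (simp del: restrict_apply)
qed

lemma Assoc_rel_commuting:
  assumes "monoid G" "p \<in> all_commuting_tuples G"
  shows "Assoc_rel G `` {p} =
    {q. equivclp (\<lambda>x y. x \<in> all_commuting_tuples G \<and> y \<in> all_commuting_tuples G \<and> drop_unit G x y) p q}"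
    (is "_ = {q. equivclp ?R p q}")
proof -
  have sub: "all_commuting_tuples G \<subseteq> topspace (all_tuples G)"
    by (auto simp: all_commuting_tuples_def all_tuples_def Hom_def)
  have 1: "equivclp ?R p q \<and> q \<in> all_commuting_tuples G" if "equivclp (drop_unit G) p q" for q
    using that
  proof (induction rule: equivclp_induct)
    case base then show ?case using assms(2) by simp
  next
    case (step y z)
    then have z: "z \<in> all_commuting_tuples G" and yz: "?R y z \<or> ?R z y"
      using drop_unit_commuting[OF assms(1)] by blast+
    from yz have "equivclp ?R p z"
      using step.IH by (intro equivclp_into_equivclp[of ?R p y z]) simp_all
    then show ?case using z by simp
  qed
  have 2: "equivclp (drop_unit G) p q" if "equivclp ?R p q" for q
    using that by (induction rule: equivclp_induct) (auto intro: equivclp_into_equivclp)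
  have 3: "q \<in> all_commuting_tuples G" if "equivclp ?R p q" for q
    using 1[OF 2[OF that]] by simp
  show ?thesis
  proof (intro equalityI subsetI)
    show "q \<in> {q. equivclp ?R p q}" if "q \<in> Assoc_rel G `` {p}" for q
      using that 1[of q] by (simp add: Assoc_rel_def)
    show "q \<in> Assoc_rel G `` {p}" if "q \<in> {q. equivclp ?R p q}" for q
    proof -
      have "equivclp (drop_unit G) p q" "p \<in> topspace (all_tuples G)" "q \<in> topspace (all_tuples G)"
        using that 2[of q] 3[of q] sub assms(2) by auto
      then show ?thesis by (simp add: Assoc_rel_def)
    qed
  qed
qed

section \<open>The general linear group\<close>

definition GL :: "(complex^'n^'n) monoid" where
  "GL = \<lparr>carrier = {A. invertible A}, monoid.mult = (**), one = mat 1\<rparr>"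

lemma group_GL: "group (GL :: (complex^'n^'n) monoid)"
proof (rule groupI)
  fix A :: "complex^'n^'n" assume "A \<in> carrier GL"
  then obtain B where "A ** B = mat 1" "B ** A = mat 1"
    by (auto simp: GL_def invertible_def)
  then show "\<exists>B\<in>carrier GL. B \<otimes>\<^bsub>GL\<^esub> A = \<one>\<^bsub>GL\<^esub>"
    by (auto simp: GL_def invertible_def)
qed (auto simp: GL_def invertible_mult matrix_mul_assoc, auto simp: invertible_def)

end

theory Submission
  imports Defs
begin

text \<open>
  Call a family of loops, indexed by commuting tuples, normalised if it is constant on tuples with a
  unit coordinate. A normalised family \<open>f\<close> gives loops \<open>\<Prod> f(g\<^sub>I)\<close>, the product taken over all
  subtuples \<open>g\<^sub>I\<close> of \<open>g\<close>, which do not change when a unit is dropped from \<open>g\<close>. Thus maps from the wedge to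
  \<open>Y\<close> induce maps \<open>\<Sigma> Comm(G) \<rightarrow> Y\<close>. For strict topological groups in place of loops this would be a
  bijection, since one can solve for \<open>f\<close> by induction on the length of the tuples. For Moore loops the
  same induction works up to homotopy, provided that the degenerate tuples sit in \<open>Hom(Z\<^sup>n, G)\<close>
  as a neighbourhood deformation retract: this controls the quotient of two loops near the tuples where
  they agree. Applying this to the tautological family on \<open>\<Sigma> Comm(G)\<close> and, relative to its end
  points, to a homotopy shows that the map \<open>\<Sigma> Comm(G) \<rightarrow> \<Or> \<Sigma> Hom(Z\<^sup>n, G)/S\<^sub>n(G)\<close> given by the
  universal normalised family has a two-sided homotopy inverse.

  The deformation is \<open>g \<mapsto> exp(s log g)\<close> near the unit. It preserves commutation since \<open>log g\<close> lies in
  the double commutant of \<open>g\<close>, and it stays in \<open>G\<close> by Cartan's closed subgroup theorem.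
\<close>

section \<open>Continuous families of Moore loops\<close>

text \<open>Moore loops compose strictly associatively and with a strict unit, so the products over
  subtuples agree on the nose when a unit is dropped. Loops over a fixed interval would agree only
  up to reparametrisation and would not descend to \<open>Comm(G)\<close>. The price is twofold.
  First, lengths may vanish: a map on a suspension runs a loop of length \<open>w\<close> over
  \<open>[0,1]\<close>, and the converse passage is continuous where \<open>w\<close> tends to 0
  only because \<open>[0,1]\<close> is compact. The lengths are therefore chosen to vanish only
  where the family is trivial. Secondly, there are no inverses: a quotient exists only up to a
  detour along the divisor, and this detour has to shrink to nothing where the quotient is already
  prescribed, so that the solution extends the given one strictly. The induction never ends, and
  each further length costs more time for the homotopy. Time therefore runs over
  \<open>[0,\<infinity>)\<close> and is compressed to \<open>[0,1]\<close> at the end, which is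
  continuous because the homotopy becomes stationary on tuples of each fixed length. The only
  parameter space is \<open>[0,1]\<close>; being locally compact Hausdorff, it keeps the quotient
  presentations of both suspensions intact under products.\<close>

type_synonym 'y moore_loop = "real \<times> (real \<Rightarrow> 'y)"

text \<open>The path is total on the reals and rests at the base point outside
  \<open>[0, length]\<close>, so loops of different lengths share one domain.\<close>

definition loops_at :: "'y \<Rightarrow> 'y moore_loop set" where
  "loops_at y0 = {c. 0 \<le> fst c \<and> (\<forall>t. t \<le> 0 \<or> fst c \<le> t \<longrightarrow> snd c t = y0)}"

definition loop_unit :: "'y \<Rightarrow> 'y moore_loop" where
  "loop_unit y0 = (0, \<lambda>_. y0)"

definition loop_mult :: "'y moore_loop \<Rightarrow> 'y moore_loop \<Rightarrow> 'y moore_loop" where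
  "loop_mult c d = (fst c + fst d, \<lambda>t. if t \<le> fst c then snd c t else snd d (t - fst c))"

definition loop_map :: "('y \<Rightarrow> 'z) \<Rightarrow> 'y moore_loop \<Rightarrow> 'z moore_loop" where
  "loop_map f c = (fst c, \<lambda>t. f (snd c t))"

text \<open>Joint continuity of length and evaluation replaces continuity into a space of Moore
  loops, so that no topology on loops is needed.\<close>

definition loop_family :: "'z topology \<Rightarrow> 'y topology \<Rightarrow> 'y \<Rightarrow> ('z \<Rightarrow> 'y moore_loop) \<Rightarrow> bool" where
  "loop_family Z Y y0 F \<longleftrightarrow>
    continuous_map Z euclideanreal (\<lambda>z. fst (F z)) \<and>
    continuous_map (prod_topology Z euclideanreal) Y (\<lambda>w. snd (F (fst w)) (snd w)) \<and>
    (\<forall>z\<in>topspace Z. F z \<in> loops_at y0)"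

lemma loops_atD:
  assumes "c \<in> loops_at y0"
  shows "0 \<le> fst c" "t \<le> 0 \<Longrightarrow> snd c t = y0" "fst c \<le> t \<Longrightarrow> snd c t = y0"
  using assms by (auto simp: loops_at_def)

lemma loop_unit_at [simp]: "loop_unit y0 \<in> loops_at y0"
  by (simp add: loops_at_def loop_unit_def)

lemma loop_mult_at:
  assumes "c \<in> loops_at y0" "d \<in> loops_at y0"
  shows "loop_mult c d \<in> loops_at y0"
  using assms by (auto simp: loops_at_def loop_mult_def)

lemma loop_mult_unit_left: "c \<in> loops_at y0 \<Longrightarrow> loop_mult (loop_unit y0) c = c"
  by (cases c) (auto simp: loops_at_def loop_mult_def loop_unit_def)

text \<open>Lengths add, so both bracketings run through the three paths at the same times; the
  middle length being nonnegative keeps the case distinctions in order.\<close>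

lemma loop_mult_assoc:
  assumes "d \<in> loops_at y0"
  shows "loop_mult (loop_mult c d) e = loop_mult c (loop_mult d e)"
  using loops_atD(1)[OF assms] by (auto simp: loop_mult_def fun_eq_iff algebra_simps)

lemma loop_map_at: "c \<in> loops_at y0 \<Longrightarrow> f y0 = z0 \<Longrightarrow> loop_map f c \<in> loops_at z0"
  by (auto simp: loops_at_def loop_map_def)

lemma loop_map_mult: "loop_map f (loop_mult c d) = loop_mult (loop_map f c) (loop_map f d)"
  by (auto simp: loop_map_def loop_mult_def)

lemma loop_map_unit: "f y0 = z0 \<Longrightarrow> loop_map f (loop_unit y0) = loop_unit z0"
  by (auto simp: loop_map_def loop_unit_def)

lemma loop_familyD:
  assumes "loop_family Z Y y0 F"
  shows "continuous_map Z euclideanreal (\<lambda>z. fst (F z))"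
    and "continuous_map (prod_topology Z euclideanreal) Y (\<lambda>w. snd (F (fst w)) (snd w))"
    and "z \<in> topspace Z \<Longrightarrow> F z \<in> loops_at y0"
  using assms by (auto simp: loop_family_def)

lemma continuous_map_fstI:
  "continuous_map Z (prod_topology X Y) f \<Longrightarrow> continuous_map Z X (\<lambda>z. fst (f z))"
  using continuous_map_compose[OF _ continuous_map_fst] by (fastforce simp: o_def)

lemma continuous_map_sndI:
  "continuous_map Z (prod_topology X Y) f \<Longrightarrow> continuous_map Z Y (\<lambda>z. snd (f z))"
  using continuous_map_compose[OF _ continuous_map_snd] by (fastforce simp: o_def)

lemma continuous_map_ident: "continuous_map X X (\<lambda>x. x)"
  using continuous_map_id[of X] by (simp add: id_def)

lemma continuous_map_subtopology_ident: "continuous_map (subtopology X S) X (\<lambda>x. x)"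
  by (rule continuous_map_from_subtopology[OF continuous_map_ident])

lemma continuous_map_apply:
  "continuous_map X Y f \<Longrightarrow> continuous_map W X g \<Longrightarrow> continuous_map W Y (\<lambda>w. f (g w))"
  using continuous_map_compose[of W X g Y f] by (simp add: o_def)

lemma continuous_map_projections:
  "continuous_map (prod_topology X Y) X (\<lambda>x. fst x)"
  "continuous_map (prod_topology X Y) Y (\<lambda>x. snd x)"
  "continuous_map (prod_topology (prod_topology X Y) W) X (\<lambda>x. fst (fst x))"
  "continuous_map (prod_topology (prod_topology X Y) W) Y (\<lambda>x. snd (fst x))"
  by (auto intro: continuous_map_fst continuous_map_snd
      continuous_map_apply[OF continuous_map_fst] continuous_map_apply[OF continuous_map_snd])

lemmas cm_intros = continuous_map_projections
  continuous_map_projections[THEN continuous_map_from_subtopology]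
  continuous_map_ident continuous_map_subtopology_ident continuous_map_pairedI continuous_map_canonical_const
  continuous_map_add continuous_map_diff continuous_map_real_mult continuous_map_minus
  continuous_map_real_abs continuous_map_real_max continuous_map_real_min

lemma loop_family_len:
  assumes "loop_family Z Y y0 F" "continuous_map W Z g"
  shows "continuous_map W euclideanreal (\<lambda>w. fst (F (g w)))"
  by (rule continuous_map_apply[OF loop_familyD(1)[OF assms(1)] assms(2)])

lemma loop_family_path:
  assumes "loop_family Z Y y0 F" "continuous_map W Z g" "continuous_map W euclideanreal t"
  shows "continuous_map W Y (\<lambda>w. snd (F (g w)) (t w))"
proof -
  have "continuous_map W (prod_topology Z euclideanreal) (\<lambda>w. (g w, t w))"
    using assms(2,3) by (intro continuous_map_pairedI)
  from continuous_map_apply[OF loop_familyD(2)[OF assms(1)] this] show ?thesis by simp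
qed

lemma loop_family_compose:
  assumes "loop_family Z Y y0 F" "continuous_map W Z g"
  shows "loop_family W Y y0 (\<lambda>w. F (g w))"
  unfolding loop_family_def
proof (intro conjI ballI)
  show "continuous_map W euclideanreal (\<lambda>w. fst (F (g w)))"
    by (rule loop_family_len[OF assms])
  show "continuous_map (prod_topology W euclideanreal) Y (\<lambda>w. snd (F (g (fst w))) (snd w))"
    by (intro loop_family_path[OF assms(1)] continuous_map_apply[OF assms(2)] cm_intros)
  show "F (g w) \<in> loops_at y0" if "w \<in> topspace W" for w
    using continuous_map_funspace[OF assms(2)] that
    by (intro loop_familyD(3)[OF assms(1)]) auto
qed

lemma loop_family_subtopology:
  "loop_family Z Y y0 F \<Longrightarrow> loop_family (subtopology Z S) Y y0 F"
  by (erule loop_family_compose[OF _ continuous_map_subtopology_ident])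

lemma loop_family_eq:
  assumes "loop_family Z Y y0 F" "\<And>z. z \<in> topspace Z \<Longrightarrow> F z = G z"
  shows "loop_family Z Y y0 G"
  unfolding loop_family_def
proof (intro conjI ballI)
  show "continuous_map Z euclideanreal (\<lambda>z. fst (G z))"
    using loop_familyD(1)[OF assms(1)] by (rule continuous_map_eq) (simp add: assms(2))
  show "continuous_map (prod_topology Z euclideanreal) Y (\<lambda>w. snd (G (fst w)) (snd w))"
    using loop_familyD(2)[OF assms(1)] by (rule continuous_map_eq) (auto simp: assms(2))
  show "G z \<in> loops_at y0" if "z \<in> topspace Z" for z
    using loop_familyD(3)[OF assms(1) that] assms(2)[OF that] by simp
qed

lemma loop_family_unit: "y0 \<in> topspace Y \<Longrightarrow> loop_family Z Y y0 (\<lambda>_. loop_unit y0)"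
  by (simp add: loop_family_def) (simp add: loop_unit_def)

lemma continuous_map_cases_le':
  assumes "continuous_map X euclideanreal p" "continuous_map X euclideanreal q"
    and "continuous_map (subtopology X {x. p x \<le> q x}) Y f"
    and "continuous_map (subtopology X {x. q x \<le> p x}) Y g"
    and "\<And>x. \<lbrakk>x \<in> topspace X; p x = q x\<rbrakk> \<Longrightarrow> f x = g x"
  shows "continuous_map X Y (\<lambda>x. if p x \<le> q x then f x else g x)"
proof (rule continuous_map_cases_le[OF assms(1,2) _ _ assms(5)])
  have *: "subtopology X {x \<in> topspace X. P x} = subtopology X {x. P x}" for P
    by (metis Collect_conj_eq Collect_mem_eq subtopology_restrict)
  show "continuous_map (subtopology X {x \<in> topspace X. p x \<le> q x}) Y f"
    "continuous_map (subtopology X {x \<in> topspace X. q x \<le> p x}) Y g"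
    using assms(3,4) unfolding * by auto
qed

lemma loop_family_mult:
  assumes F: "loop_family Z Y y0 F" and G: "loop_family Z Y y0 G"
  shows "loop_family Z Y y0 (\<lambda>z. loop_mult (F z) (G z))"
  unfolding loop_family_def
proof (intro conjI ballI)
  show "continuous_map Z euclideanreal (\<lambda>z. fst (loop_mult (F z) (G z)))"
    unfolding loop_mult_def fst_conv by (intro cm_intros loop_family_len[OF F] loop_family_len[OF G])
  show "continuous_map (prod_topology Z euclideanreal) Y
      (\<lambda>w. snd (loop_mult (F (fst w)) (G (fst w))) (snd w))"
    unfolding loop_mult_def snd_conv
  proof (intro continuous_map_cases_le' cm_intros loop_family_path[OF F] loop_family_path[OF G]
      loop_family_len[OF F])
    fix x assume x: "x \<in> topspace (prod_topology Z euclideanreal)" "snd x = fst (F (fst x))"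
    then show "snd (F (fst x)) (snd x) = snd (G (fst x)) (snd x - fst (F (fst x)))"
      using loops_atD(2,3)[OF loop_familyD(3)[OF F, of "fst x"]] loops_atD(2)[OF loop_familyD(3)[OF G, of "fst x"]]
      by auto
  qed
  show "loop_mult (F z) (G z) \<in> loops_at y0" if "z \<in> topspace Z" for z
    by (intro loop_mult_at loop_familyD(3)[OF F that] loop_familyD(3)[OF G that])
qed

lemma loop_family_map:
  assumes F: "loop_family Z Y y0 F" and f: "continuous_map Y Y' f" "f y0 = y1"
  shows "loop_family Z Y' y1 (\<lambda>z. loop_map f (F z))"
  unfolding loop_family_def
proof (intro conjI ballI)
  show "continuous_map Z euclideanreal (\<lambda>z. fst (loop_map f (F z)))"
    unfolding loop_map_def fst_conv by (rule loop_familyD(1)[OF F])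
  show "continuous_map (prod_topology Z euclideanreal) Y' (\<lambda>w. snd (loop_map f (F (fst w))) (snd w))"
    unfolding loop_map_def snd_conv by (rule continuous_map_apply[OF f(1) loop_familyD(2)[OF F]])
  show "loop_map f (F z) \<in> loops_at y1" if "z \<in> topspace Z" for z
    by (rule loop_map_at[of _ y0, OF loop_familyD(3)[OF F that]]) (rule f(2))
qed

lemma loop_family_cases_le:
  assumes p: "continuous_map Z euclideanreal p" and q: "continuous_map Z euclideanreal q"
    and F: "loop_family (subtopology Z {z. p z \<le> q z}) Y y0 F"
    and G: "loop_family (subtopology Z {z. q z \<le> p z}) Y y0 G"
    and eq: "\<And>z. \<lbrakk>z \<in> topspace Z; p z = q z\<rbrakk> \<Longrightarrow> F z = G z"
  shows "loop_family Z Y y0 (\<lambda>z. if p z \<le> q z then F z else G z)"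
  unfolding loop_family_def
proof (intro conjI ballI)
  have "continuous_map Z euclideanreal (\<lambda>z. if p z \<le> q z then fst (F z) else fst (G z))"
    using loop_familyD(1)[OF F] loop_familyD(1)[OF G]
    by (intro continuous_map_cases_le' p q) (simp_all add: eq)
  then show "continuous_map Z euclideanreal (\<lambda>z. fst (if p z \<le> q z then F z else G z))"
    by (simp add: if_distrib)
  have sub: "subtopology (prod_topology Z euclideanreal) {w. P (fst w)}
      = prod_topology (subtopology Z {z. P z}) euclideanreal" for P
    unfolding prod_topology_subtopology by (rule arg_cong) auto
  have "continuous_map (prod_topology Z euclideanreal) Y
      (\<lambda>w. if p (fst w) \<le> q (fst w) then snd (F (fst w)) (snd w) else snd (G (fst w)) (snd w))"
    using loop_familyD(2)[OF F, folded sub] loop_familyD(2)[OF G, folded sub]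
    by (intro continuous_map_cases_le' continuous_map_apply[OF p] continuous_map_apply[OF q] cm_intros)
      (auto simp: eq)
  then show "continuous_map (prod_topology Z euclideanreal) Y
      (\<lambda>w. snd (if p (fst w) \<le> q (fst w) then F (fst w) else G (fst w)) (snd w))"
    by (rule continuous_map_eq) auto
  show "(if p z \<le> q z then F z else G z) \<in> loops_at y0" if "z \<in> topspace Z" for z
    using loop_familyD(3)[OF F, of z] loop_familyD(3)[OF G, of z] that by auto
qed

lemma loop_family_pasting:
  assumes fin: "finite I" and cl: "\<And>i. i \<in> I \<Longrightarrow> closedin Z (S i)"
    and F: "\<And>i. i \<in> I \<Longrightarrow> loop_family (subtopology Z (S i)) Y y0 F"
    and cov: "topspace Z \<subseteq> (\<Union>i\<in>I. S i)"
  shows "loop_family Z Y y0 F"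
  unfolding loop_family_def
proof (intro conjI ballI)
  show "continuous_map Z euclideanreal (\<lambda>z. fst (F z))"
    using loop_familyD(1)[OF F] cov by (intro pasting_lemma_closed[OF fin cl]) auto
  show "continuous_map (prod_topology Z euclideanreal) Y (\<lambda>w. snd (F (fst w)) (snd w))"
  proof (rule pasting_lemma_closed[OF fin, where T = "\<lambda>i. S i \<times> UNIV" and f = "\<lambda>_ w. snd (F (fst w)) (snd w)"])
    show "closedin (prod_topology Z euclideanreal) (S i \<times> UNIV)" if "i \<in> I" for i
      using cl[OF that] by (simp add: closedin_prod_Times_iff)
    show "continuous_map (subtopology (prod_topology Z euclideanreal) (S i \<times> UNIV)) Y
        (\<lambda>w. snd (F (fst w)) (snd w))" if "i \<in> I" for i
      using loop_familyD(2)[OF F[OF that]] by (simp add: prod_topology_subtopology)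
  qed (use cov in auto)
  show "F z \<in> loops_at y0" if "z \<in> topspace Z" for z
    using that cov loop_familyD(3)[OF F] by auto
qed

text \<open>The tube lemma over \<open>[0,1]\<close> gives continuity where the length \<open>w\<close> vanishes.\<close>

lemma loop_family_rescale:
  assumes w: "continuous_map Z euclideanreal w" "\<And>z. z \<in> topspace Z \<Longrightarrow> 0 \<le> w z"
    and q: "continuous_map (prod_topology Z (top_of_set {0..1})) Y (\<lambda>x. q (fst x) (snd x))"
    and q0: "\<And>z. z \<in> topspace Z \<Longrightarrow> q z 0 = y0" "\<And>z. z \<in> topspace Z \<Longrightarrow> q z 1 = y0"
    and qw: "\<And>z t. \<lbrakk>z \<in> topspace Z; w z = 0; t \<in> {0..1}\<rbrakk> \<Longrightarrow> q z t = y0"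
  shows "loop_family Z Y y0 (\<lambda>z. (w z, \<lambda>t. if 0 < t \<and> t < w z then q z (t / w z) else y0))"
  unfolding loop_family_def
proof (intro conjI ballI)
  show "continuous_map Z euclideanreal (\<lambda>z. fst (w z, \<lambda>t. if 0 < t \<and> t < w z then q z (t / w z) else y0))"
    using w by simp
  show "(w z, \<lambda>t. if 0 < t \<and> t < w z then q z (t / w z) else y0) \<in> loops_at y0" if "z \<in> topspace Z" for z
    using w(2)[OF that] by (simp add: loops_at_def)
  let ?ZR = "prod_topology Z euclideanreal"
  let ?g = "\<lambda>x. if 0 < snd x \<and> snd x < w (fst x) then q (fst x) (snd x / w (fst x)) else y0"
  let ?P = "{x \<in> topspace ?ZR. 0 < w (fst x)}"
  have P: "openin ?ZR ?P"
    using openin_continuous_map_preimage[OF continuous_map_apply[OF w(1) continuous_map_projections(1)],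
        of "{0<..}" euclideanreal]
    by simp
  have gP: "continuous_map (subtopology ?ZR ?P) Y ?g"
  proof -
    \<comment> \<open>For positive length the relative time may be formed; clamping it to the unit
      interval changes nothing because \<open>q\<close> is at the base point at both ends.\<close>
    let ?c = "\<lambda>x. max 0 (min 1 (snd x / w (fst x)))"
    have c: "continuous_map (subtopology ?ZR ?P) (top_of_set {0..1}) ?c"
      unfolding continuous_map_in_subtopology
    proof (intro conjI continuous_map_real_max continuous_map_real_min continuous_map_real_divide
        continuous_map_apply[OF w(1)] cm_intros)
      show "w (fst x) \<noteq> 0" if "x \<in> topspace (subtopology ?ZR ?P)" for x using that by auto
      show "?c \<in> topspace (subtopology ?ZR ?P) \<rightarrow> {0..1}" by auto
    qed
    have "continuous_map (subtopology ?ZR ?P) (prod_topology Z (top_of_set {0..1})) (\<lambda>x. (fst x, ?c x))"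
      by (intro continuous_map_pairedI c cm_intros)
    from continuous_map_apply[OF q this]
    have "continuous_map (subtopology ?ZR ?P) Y (\<lambda>x. q (fst x) (?c x))" by simp
    then show ?thesis
    proof (rule continuous_map_eq)
      fix x assume "x \<in> topspace (subtopology ?ZR ?P)"
      then have x: "fst x \<in> topspace Z" "0 < w (fst x)" by auto
      consider "snd x \<le> 0" | "w (fst x) \<le> snd x" | "0 < snd x" "snd x < w (fst x)" by linarith
      then show "q (fst x) (?c x) = ?g x"
      proof cases
        case 1
        then have "snd x / w (fst x) \<le> 0" using x by (simp add: divide_nonpos_pos)
        then show ?thesis using 1 q0[OF x(1)] by simp
      next
        case 2
        then have "snd x / w (fst x) \<ge> 1" using x by simp
        then show ?thesis using 2 q0[OF x(1)] by simp
      next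
        case 3
        then show ?thesis using x by simp
      qed
    qed
  qed
  show "continuous_map ?ZR Y (\<lambda>x. snd (w (fst x), \<lambda>t. if 0 < t \<and> t < w (fst x) then q (fst x) (t / w (fst x)) else y0) (snd x))"
    unfolding snd_conv continuous_map_def
  proof (intro conjI allI impI)
    show "?g \<in> topspace ?ZR \<rightarrow> topspace Y"
    proof
      fix x assume x: "x \<in> topspace ?ZR"
      have *: "q (fst x) t \<in> topspace Y" if "t \<in> {0..1}" for t
        using continuous_map_funspace[OF q] x that by (auto simp: Pi_iff)
      have "y0 \<in> topspace Y" using *[of 0] q0(1)[of "fst x"] x by auto
      then show "?g x \<in> topspace Y"
        using * by (auto simp: divide_le_eq)
    qed
    fix V assume V: "openin Y V"
    let ?A = "{x \<in> topspace (subtopology ?ZR ?P). ?g x \<in> V}"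
    have A: "openin ?ZR ?A"
      using openin_continuous_map_preimage[OF gP V] P openin_trans_full by blast
    show "openin ?ZR {x \<in> topspace ?ZR. ?g x \<in> V}"
    proof (cases "y0 \<in> V")
      case False
      \<comment> \<open>Where the length is 0 the value is \<open>y0\<close>, so a set
        \<open>V\<close> without \<open>y0\<close> only sees positive lengths.\<close>
      have "{x \<in> topspace ?ZR. ?g x \<in> V} = ?A"
        using False w(2) by (fastforce split: if_splits)
      then show ?thesis using A by simp
    next
      case True
      let ?C = "{x \<in> topspace (prod_topology Z (top_of_set {0..1::real})). q (fst x) (snd x) \<in> topspace Y - V}"
      have "closedin (prod_topology Z (top_of_set {0..1::real})) ?C"
        by (rule closedin_continuous_map_preimage[OF q]) (use V in auto)
      moreover have "closed_map (prod_topology Z (top_of_set {0..1::real})) Z fst"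
        by (rule closed_map_fst) (simp add: compact_space_subtopology)
      ultimately have "closedin Z (fst ` ?C)" by (simp add: closed_map_def)
      then have D: "openin Z (topspace Z - fst ` ?C)" by blast
      \<comment> \<open>The parameters whose whole path stays in \<open>V\<close>: an open set
        containing all zeros of \<open>w\<close>.\<close>
      let ?B = "(topspace Z - fst ` ?C) \<times> (UNIV :: real set)"
      have B: "openin ?ZR ?B"
        using D by (simp add: openin_prod_Times_iff)
      have inV: "q z t \<in> V" if "z \<in> topspace Z" "z \<notin> fst ` ?C" "t \<in> {0..1}" for z t
      proof (rule ccontr)
        assume "q z t \<notin> V"
        moreover have "q z t \<in> topspace Y"
          using continuous_map_funspace[OF q] that by (auto simp: Pi_iff)
        ultimately have "(z, t) \<in> ?C" using that by auto
        then show False using that(2) by force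
      qed
      have zero: "z \<notin> fst ` ?C" if "w z = 0" "z \<in> topspace Z" for z
        using qw[OF that(2,1)] True by auto
      have "{x \<in> topspace ?ZR. ?g x \<in> V} = ?A \<union> ?B"
      proof (intro equalityI subsetI)
        fix x assume x: "x \<in> {x \<in> topspace ?ZR. ?g x \<in> V}"
        show "x \<in> ?A \<union> ?B"
        proof (cases "w (fst x) = 0")
          case True
          have "x \<in> ?B" using zero[OF True] x by (auto simp: mem_Times_iff simp del: snd_conv fst_conv)
          then show ?thesis ..
        next
          case False
          then have "x \<in> ?A" using w(2)[of "fst x"] x by (auto simp: less_le)
          then show ?thesis ..
        qed
      next
        fix x assume "x \<in> ?A \<union> ?B"
        then show "x \<in> {x \<in> topspace ?ZR. ?g x \<in> V}"
        proof
          assume "x \<in> ?A" then show ?thesis by auto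
        next
          assume x: "x \<in> ?B"
          then have x': "fst x \<in> topspace Z" "fst x \<notin> fst ` ?C" by (auto simp: mem_Times_iff)
          have "?g x \<in> V"
          proof (cases "0 < snd x \<and> snd x < w (fst x)")
            case True
            then show ?thesis using inV[OF x', of "snd x / w (fst x)"] by simp
          next
            case False
            then show ?thesis using \<open>y0 \<in> V\<close> by auto
          qed
          then show ?thesis using x' by (simp add: mem_Times_iff)
        qed
      qed
      then show ?thesis using A B by (simp add: openin_Un)
    qed
  qed
qed

section \<open>Dividing one family of loops by another\<close>

text \<open>
  Suppose \<open>c = e \<cdot> d\<close> whenever \<open>u < 1\<close>. The loop \<open>loop_div c d u\<close> follows \<open>c\<close>, turns back inside
  the factor \<open>d\<close> at relative position \<open>u\<close> and returns along \<open>d\<close>; it interpolates between \<open>e\<close> at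
  \<open>u = 0\<close> and \<open>c \<cdot> d\<inverse>\<close> at \<open>u = 1\<close>. The loop \<open>loop_zigzag c d u a\<close> runs forward along \<open>d\<close> again
  from the relative position \<open>a u\<close>.
\<close>

definition turn_time :: "'y moore_loop \<Rightarrow> 'y moore_loop \<Rightarrow> real \<Rightarrow> real" where
  "turn_time c d u = fst c - (1 - u) * fst d"

definition loop_div :: "'y moore_loop \<Rightarrow> 'y moore_loop \<Rightarrow> real \<Rightarrow> 'y moore_loop" where
  "loop_div c d u = (turn_time c d u + u * fst d,
    \<lambda>t. if t \<le> turn_time c d u then snd c t else snd d (turn_time c d u + u * fst d - t))"

definition loop_zigzag :: "'y moore_loop \<Rightarrow> 'y moore_loop \<Rightarrow> real \<Rightarrow> real \<Rightarrow> 'y moore_loop" where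
  "loop_zigzag c d u a = (turn_time c d u + u * fst d + fst d - 2 * (a * (u * fst d)),
    \<lambda>t. if t \<le> turn_time c d u then snd c t
        else snd d (a * (u * fst d) + \<bar>t - turn_time c d u - u * fst d + a * (u * fst d)\<bar>))"

definition divisible_up_to :: "'y \<Rightarrow> 'y moore_loop \<Rightarrow> 'y moore_loop \<Rightarrow> real \<Rightarrow> bool" where
  "divisible_up_to y0 c d u \<longleftrightarrow> c \<in> loops_at y0 \<and> d \<in> loops_at y0 \<and> u \<in> {0..1} \<and>
    (u < 1 \<longrightarrow> (\<exists>e\<in>loops_at y0. c = loop_mult e d))"

text \<open>For \<open>u < 1\<close> the turning time is \<open>fst e + u * fst d\<close>, relative
  position \<open>u\<close> in the factor \<open>d\<close>; for \<open>u = 1\<close> it is the end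
  of \<open>c\<close>, where both loops rest at the base point.\<close>

lemma turn_time_props:
  assumes "divisible_up_to y0 c d u"
  shows "0 \<le> turn_time c d u" "snd c (turn_time c d u) = snd d (u * fst d)"
    "turn_time c d u < t \<Longrightarrow> snd c t = snd d (u * fst d + t - turn_time c d u)"
proof -
  have c: "c \<in> loops_at y0" and d: "d \<in> loops_at y0" and u: "0 \<le> u" "u \<le> 1"
    using assms by (auto simp: divisible_up_to_def)
  have "0 \<le> turn_time c d u \<and> snd c (turn_time c d u) = snd d (u * fst d) \<and>
    (turn_time c d u < t \<longrightarrow> snd c t = snd d (u * fst d + t - turn_time c d u))"
  proof (cases "u < 1")
    case True
    then obtain e where e: "e \<in> loops_at y0" "c = loop_mult e d"
      using assms by (auto simp: divisible_up_to_def)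
    have tt: "turn_time c d u = fst e + u * fst d"
      by (simp add: e(2) loop_mult_def turn_time_def algebra_simps)
    have ud: "0 \<le> u * fst d" using u loops_atD(1)[OF d] by simp
    show ?thesis
    proof (intro conjI impI)
      show "0 \<le> turn_time c d u" using tt ud loops_atD(1)[OF e(1)] by simp
      show "snd c (turn_time c d u) = snd d (u * fst d)"
        using loops_atD(3)[OF e(1), of "fst e"] loops_atD(2)[OF d, of 0] ud
        unfolding tt by (cases "u * fst d = 0") (auto simp: e(2) loop_mult_def)
      assume "turn_time c d u < t"
      then have "\<not> t \<le> fst e" using tt ud by simp
      then show "snd c t = snd d (u * fst d + t - turn_time c d u)"
        unfolding tt by (simp add: e(2) loop_mult_def)
    qed
  next
    case False
    then have "u = 1" using u by simp
    then show ?thesis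
      using loops_atD[OF c] loops_atD[OF d] by (simp add: turn_time_def)
  qed
  then show "0 \<le> turn_time c d u" "snd c (turn_time c d u) = snd d (u * fst d)"
    "turn_time c d u < t \<Longrightarrow> snd c t = snd d (u * fst d + t - turn_time c d u)" by auto
qed

lemma loop_div_at:
  assumes "divisible_up_to y0 c d u"
  shows "loop_div c d u \<in> loops_at y0"
proof -
  have c: "c \<in> loops_at y0" and d: "d \<in> loops_at y0" and u: "0 \<le> u" "u \<le> 1"
    using assms by (auto simp: divisible_up_to_def)
  have ud: "0 \<le> u * fst d" using u loops_atD(1)[OF d] by simp
  show ?thesis
    unfolding loops_at_def mem_Collect_eq
  proof (intro conjI allI impI)
    show "0 \<le> fst (loop_div c d u)"
      using turn_time_props(1)[OF assms] ud by (simp add: loop_div_def)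
    fix t assume "t \<le> 0 \<or> fst (loop_div c d u) \<le> t"
    then show "snd (loop_div c d u) t = y0"
    proof
      assume "t \<le> 0"
      then show ?thesis
        using turn_time_props(1)[OF assms] loops_atD(2)[OF c] by (simp add: loop_div_def)
    next
      assume t: "fst (loop_div c d u) \<le> t"
      show ?thesis
      proof (cases "t \<le> turn_time c d u")
        case True
        then have "t = turn_time c d u" "u * fst d = 0"
          using t ud unfolding loop_div_def fst_conv by linarith+
        then show ?thesis
          using turn_time_props(2)[OF assms] loops_atD(2)[OF d, of 0] by (auto simp: loop_div_def)
      next
        case False
        then show ?thesis using t loops_atD(2)[OF d] by (simp add: loop_div_def)
      qed
    qed
  qed
qed

text \<open>At \<open>a = 0\<close> the backward run reaches the start of \<open>d\<close>, so
  \<open>loop_div\<close> is completed before \<open>d\<close> is run from its beginning.\<close>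

lemma loop_zigzag_0:
  assumes "divisible_up_to y0 c d u"
  shows "loop_zigzag c d u 0 = loop_mult (loop_div c d u) d"
proof -
  have "0 \<le> u * fst d"
    using assms loops_atD(1)[of d y0] by (auto simp: divisible_up_to_def)
  then show ?thesis
    by (auto simp: loop_zigzag_def loop_mult_def loop_div_def fun_eq_iff abs_if algebra_simps)
qed

text \<open>At \<open>a = 1\<close> there is no backward run: the loop continues along
  \<open>d\<close> from the turning point, exactly as \<open>c\<close> does.\<close>

lemma loop_zigzag_1:
  assumes "divisible_up_to y0 c d u"
  shows "loop_zigzag c d u 1 = c"
proof -
  have "snd (loop_zigzag c d u 1) t = snd c t" for t
    using turn_time_props(3)[OF assms, of t] by (auto simp: loop_zigzag_def abs_if algebra_simps)
  moreover have "fst (loop_zigzag c d u 1) = fst c"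
    by (simp add: loop_zigzag_def turn_time_def algebra_simps)
  ultimately show ?thesis by (auto intro!: prod_eqI)
qed

text \<open>For \<open>u = 0\<close> the turning point is the start of \<open>d\<close> and there is
  nothing to backtrack. A homotopy in \<open>a\<close> is thus constant where \<open>u\<close>
  vanishes.\<close>

lemma loop_zigzag_at_0:
  assumes "divisible_up_to y0 c d 0"
  shows "loop_zigzag c d 0 a = c"
  using loop_zigzag_1[OF assms] by (simp only: loop_zigzag_def mult_zero_left mult_zero_right)

text \<open>Division is exact for \<open>u = 0\<close>; this makes the extended quotient agree
  strictly with a prescribed one.\<close>

lemma loop_div_at_0:
  assumes "e \<in> loops_at y0" "d \<in> loops_at y0"
  shows "loop_div (loop_mult e d) d 0 = e"
  using loops_atD[OF assms(1)] loops_atD(2)[OF assms(2)]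
  by (auto intro!: prod_eqI simp: loop_div_def turn_time_def loop_mult_def)

lemma loop_zigzag_at:
  assumes "divisible_up_to y0 c d u" "a \<in> {0..1}"
  shows "loop_zigzag c d u a \<in> loops_at y0"
proof -
  have c: "c \<in> loops_at y0" and d: "d \<in> loops_at y0" and u: "0 \<le> u" "u \<le> 1"
    using assms by (auto simp: divisible_up_to_def)
  define m where "m = a * (u * fst d)"
  have ud: "0 \<le> u * fst d" "u * fst d \<le> fst d"
    using u loops_atD(1)[OF d] by (auto simp: mult_left_le_one_le)
  then have m: "0 \<le> m" "m \<le> u * fst d"
    using assms(2) unfolding m_def by (auto simp: mult_left_le_one_le)
  show ?thesis
    unfolding loops_at_def mem_Collect_eq
  proof (intro conjI allI impI)
    show "0 \<le> fst (loop_zigzag c d u a)"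
      using turn_time_props(1)[OF assms(1)] ud m by (simp add: loop_zigzag_def flip: m_def)
    fix t assume "t \<le> 0 \<or> fst (loop_zigzag c d u a) \<le> t"
    then show "snd (loop_zigzag c d u a) t = y0"
    proof
      assume "t \<le> 0"
      then show ?thesis
        using turn_time_props(1)[OF assms(1)] loops_atD(2)[OF c] by (simp add: loop_zigzag_def)
    next
      assume t: "fst (loop_zigzag c d u a) \<le> t"
      show ?thesis
      proof (cases "t \<le> turn_time c d u")
        case True
        then have "t = turn_time c d u" "u * fst d = fst d"
          using t ud m unfolding loop_zigzag_def fst_conv m_def[symmetric] by linarith+
        then show ?thesis
          using turn_time_props(2)[OF assms(1)] loops_atD(3)[OF d, of "fst d"]
          by (auto simp: loop_zigzag_def)
      next
        case False
        then have "fst d \<le> m + \<bar>t - turn_time c d u - u * fst d + m\<bar>"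
          using t by (simp add: loop_zigzag_def flip: m_def)
        then show ?thesis using False loops_atD(3)[OF d] by (simp add: loop_zigzag_def flip: m_def)
      qed
    qed
  qed
qed

lemma continuous_turn_time:
  assumes "loop_family Z Y y0 c" "loop_family Z Y y0 d" "continuous_map Z euclideanreal u"
    and "continuous_map W Z g"
  shows "continuous_map W euclideanreal (\<lambda>w. turn_time (c (g w)) (d (g w)) (u (g w)))"
  unfolding turn_time_def
  by (intro cm_intros loop_family_len[OF assms(1)] loop_family_len[OF assms(2)]
      continuous_map_apply[OF assms(3)] assms(4))

lemma loop_family_zigzag:
  assumes c: "loop_family Z Y y0 c" and d: "loop_family Z Y y0 d"
    and u: "continuous_map Z euclideanreal u" and a: "continuous_map Z euclideanreal a"
    and div: "\<And>z. z \<in> topspace Z \<Longrightarrow> divisible_up_to y0 (c z) (d z) (u z)"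
    and a01: "\<And>z. z \<in> topspace Z \<Longrightarrow> a z \<in> {0..1}"
  shows "loop_family Z Y y0 (\<lambda>z. loop_zigzag (c z) (d z) (u z) (a z))"
  unfolding loop_family_def
proof (intro conjI ballI)
  show "continuous_map Z euclideanreal (\<lambda>z. fst (loop_zigzag (c z) (d z) (u z) (a z)))"
    unfolding loop_zigzag_def fst_conv
    by (intro cm_intros continuous_turn_time[OF c d u] loop_family_len[OF d]
      continuous_map_apply[OF u] continuous_map_apply[OF a])
  show "continuous_map (prod_topology Z euclideanreal) Y
     (\<lambda>w. snd (loop_zigzag (c (fst w)) (d (fst w)) (u (fst w)) (a (fst w))) (snd w))"
    unfolding loop_zigzag_def snd_conv
  proof (intro continuous_map_cases_le' cm_intros continuous_turn_time[OF c d u] loop_family_len[OF d]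
      continuous_map_apply[OF u] continuous_map_apply[OF a] loop_family_path[OF c] loop_family_path[OF d])
    fix x assume x: "x \<in> topspace (prod_topology Z euclideanreal)"
      and eq: "snd x = turn_time (c (fst x)) (d (fst x)) (u (fst x))"
    let ?v = "u (fst x) * fst (d (fst x))"
    have z: "fst x \<in> topspace Z" using x by auto
    have "0 \<le> ?v" using div[OF z] loops_atD(1)[of "d (fst x)" y0] by (auto simp: divisible_up_to_def)
    then have "a (fst x) * ?v \<le> ?v" using a01[OF z] by (simp add: mult_left_le_one_le)
    then have "a (fst x) * ?v + \<bar>snd x - turn_time (c (fst x)) (d (fst x)) (u (fst x)) - ?v + a (fst x) * ?v\<bar> = ?v"
      using eq by simp
    then show "snd (c (fst x)) (snd x) = snd (d (fst x)) (a (fst x) * ?v +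
        \<bar>snd x - turn_time (c (fst x)) (d (fst x)) (u (fst x)) - ?v + a (fst x) * ?v\<bar>)"
      using turn_time_props(2)[OF div[OF z]] eq by simp
  qed
  show "loop_zigzag (c z) (d z) (u z) (a z) \<in> loops_at y0" if "z \<in> topspace Z" for z
    by (rule loop_zigzag_at[OF div[OF that] a01[OF that]])
qed

lemma loop_family_div:
  assumes c: "loop_family Z Y y0 c" and d: "loop_family Z Y y0 d"
    and u: "continuous_map Z euclideanreal u"
    and div: "\<And>z. z \<in> topspace Z \<Longrightarrow> divisible_up_to y0 (c z) (d z) (u z)"
  shows "loop_family Z Y y0 (\<lambda>z. loop_div (c z) (d z) (u z))"
  unfolding loop_family_def
proof (intro conjI ballI)
  show "continuous_map Z euclideanreal (\<lambda>z. fst (loop_div (c z) (d z) (u z)))"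
    unfolding loop_div_def fst_conv
    by (intro cm_intros continuous_turn_time[OF c d u] loop_family_len[OF d] continuous_map_apply[OF u])
  show "continuous_map (prod_topology Z euclideanreal) Y
     (\<lambda>w. snd (loop_div (c (fst w)) (d (fst w)) (u (fst w))) (snd w))"
    unfolding loop_div_def snd_conv
  proof (intro continuous_map_cases_le' cm_intros continuous_turn_time[OF c d u] loop_family_len[OF d]
      continuous_map_apply[OF u] loop_family_path[OF c] loop_family_path[OF d])
    fix x assume x: "x \<in> topspace (prod_topology Z euclideanreal)"
      and eq: "snd x = turn_time (c (fst x)) (d (fst x)) (u (fst x))"
    have z: "fst x \<in> topspace Z" using x by auto
    show "snd (c (fst x)) (snd x) = snd (d (fst x))
        (turn_time (c (fst x)) (d (fst x)) (u (fst x)) + u (fst x) * fst (d (fst x)) - snd x)"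
      using turn_time_props(2)[OF div[OF z]] eq by simp
  qed
  show "loop_div (c z) (d z) (u z) \<in> loops_at y0" if "z \<in> topspace Z" for z
    by (rule loop_div_at[OF div[OF that]])
qed

section \<open>The extension step\<close>

lemma continuous_map_apply2:
  assumes "continuous_map (prod_topology X (top_of_set S)) Y (\<lambda>x. k (fst x) (snd x))"
    and "continuous_map W X g" "continuous_map W euclidean t"
    and "\<And>w. w \<in> topspace W \<Longrightarrow> t w \<in> S"
  shows "continuous_map W Y (\<lambda>w. k (g w) (t w))"
proof -
  have "continuous_map W (prod_topology X (top_of_set S)) (\<lambda>w. (g w, t w))"
    using assms(2-4) by (intro continuous_map_pairedI) (auto simp: continuous_map_in_subtopology)
  from continuous_map_apply[OF assms(1) this] show ?thesis by simp
qed

text \<open>Appends a further stage of duration 1 to a homotopy at time \<open>N\<close>; afterwards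
  the clamped time keeps it stationary.\<close>

lemma loop_family_concat_homotopy:
  fixes N :: real
  assumes A: "loop_family (prod_topology Z (top_of_set {0..})) Y y0 A"
    and B: "loop_family (prod_topology Z (top_of_set {0..1})) Y y0 B"
    and N: "0 \<le> N" and eq: "\<And>z. z \<in> topspace Z \<Longrightarrow> B (z, 0) = A (z, N)"
  shows "loop_family (prod_topology Z (top_of_set {0..})) Y y0
    (\<lambda>w. if snd w \<le> N then A w else B (fst w, min 1 (snd w - N)))"
proof (rule loop_family_cases_le)
  let ?ZT = "prod_topology Z (top_of_set {0::real..})"
  show s: "continuous_map ?ZT euclideanreal snd"
    using continuous_map_projections(2)[of Z "top_of_set {0::real..}"]
    by (simp add: continuous_map_in_subtopology)
  show "continuous_map ?ZT euclideanreal (\<lambda>_. N)" by (intro cm_intros)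
  show "loop_family (subtopology ?ZT {w. snd w \<le> N}) Y y0 A" by (rule loop_family_subtopology[OF A])
  show "loop_family (subtopology ?ZT {w. N \<le> snd w}) Y y0 (\<lambda>w. B (fst w, min 1 (snd w - N)))"
  proof (rule loop_family_compose[OF B])
    show "continuous_map (subtopology ?ZT {w. N \<le> snd w}) (prod_topology Z (top_of_set {0..1}))
      (\<lambda>w. (fst w, min 1 (snd w - N)))"
      by (intro continuous_map_pairedI cm_intros)
        (auto simp: continuous_map_in_subtopology intro!: cm_intros continuous_map_from_subtopology[OF s])
  qed
  show "A w = B (fst w, min 1 (snd w - N))" if "w \<in> topspace ?ZT" "snd w = N" for w
    using eq[of "fst w"] that by (cases w) auto
qed

lemma loop_family_div_homotopy:
  assumes c: "loop_family Z Y y0 c" and d: "loop_family Z Y y0 d"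
    and u: "continuous_map Z euclideanreal u"
    and div: "\<And>z. z \<in> topspace Z \<Longrightarrow> divisible_up_to y0 (c z) (d z) (u z)"
  shows "loop_family (prod_topology Z (top_of_set {0..1})) Y y0
    (\<lambda>w. loop_zigzag (c (fst w)) (d (fst w)) (u (fst w)) (1 - snd w))"
proof (rule loop_family_zigzag)
  let ?ZI = "prod_topology Z (top_of_set {0..1::real})"
  show "continuous_map ?ZI euclideanreal (\<lambda>w. 1 - snd w)"
    using continuous_map_projections(2)[of Z "top_of_set {0..1::real}"]
    by (intro cm_intros) (simp add: continuous_map_in_subtopology)
qed (use div in \<open>auto intro!: loop_family_compose[OF c] loop_family_compose[OF d] continuous_map_apply[OF u] cm_intros\<close>)

text \<open>
  The homotopy \<open>H0\<close> over \<open>T\<close> is first extended by the homotopy extension property, ending in a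
  family \<open>F\<close> that is divisible by \<open>R\<close> over \<open>T\<close>. Then \<open>F\<close> is pushed into \<open>T\<close> as far as possible and
  divided by \<open>R\<close>. Each stage of this is constant over \<open>T\<close>.
\<close>

proposition loop_family_factor_extension:
  fixes Z :: "'z topology" and k :: "'z \<Rightarrow> real \<Rightarrow> 'z" and u :: "'z \<Rightarrow> real" and N :: real
  assumes T: "closedin Z T"
    and k: "continuous_map (prod_topology Z (top_of_set {0..1})) Z (\<lambda>x. k (fst x) (snd x))"
    and k0: "\<And>z. z \<in> topspace Z \<Longrightarrow> k z 0 = z"
    and kT: "\<And>z s. \<lbrakk>z \<in> T; s \<in> {0..1}\<rbrakk> \<Longrightarrow> k z s = z"
    and u: "continuous_map Z euclideanreal u" and u01: "\<And>z. z \<in> topspace Z \<Longrightarrow> u z \<in> {0..1}"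
    and uT: "\<And>z. z \<in> T \<Longrightarrow> u z = 0"
    and ku: "\<And>z s. \<lbrakk>z \<in> topspace Z; u z < 1; s \<in> {u z..1}\<rbrakk> \<Longrightarrow> k z s \<in> T"
    and N: "1 \<le> N"
    and K: "loop_family Z Y y0 K" and R: "loop_family Z Y y0 R"
    and f0: "loop_family (subtopology Z T) Y y0 f0"
    and H0: "loop_family (prod_topology (subtopology Z T) (top_of_set {0..})) Y y0 H0"
    and H00: "\<And>z. z \<in> T \<Longrightarrow> H0 (z, 0) = K z"
    and H0N: "\<And>z s. \<lbrakk>z \<in> T; N \<le> s\<rbrakk> \<Longrightarrow> H0 (z, s) = loop_mult (f0 z) (R z)"
  obtains f H where "loop_family Z Y y0 f" "\<And>z. z \<in> T \<Longrightarrow> f z = f0 z"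
    "loop_family (prod_topology Z (top_of_set {0..})) Y y0 H"
    "\<And>z. z \<in> topspace Z \<Longrightarrow> H (z, 0) = K z"
    "\<And>z s. \<lbrakk>z \<in> T; 0 \<le> s\<rbrakk> \<Longrightarrow> H (z, s) = H0 (z, s)"
    "\<And>z s. \<lbrakk>z \<in> topspace Z; N + 3 \<le> s\<rbrakk> \<Longrightarrow> H (z, s) = loop_mult (f z) (R z)"
proof -
  let ?ZT = "prod_topology Z (top_of_set {0::real..})" and ?ZI = "prod_topology Z (top_of_set {0..1::real})"
  have TZ: "T \<subseteq> topspace Z" using T by (rule closedin_subset)
  have kc: "continuous_map W Z (\<lambda>w. k (g w) (t w))"
    if "continuous_map W Z g" "continuous_map W euclideanreal t" "\<And>w. w \<in> topspace W \<Longrightarrow> t w \<in> {0..1}"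
    for W :: "'w topology" and g t
    using continuous_map_apply2[OF k that] .
  have kZ: "k z s \<in> topspace Z" if "z \<in> topspace Z" "s \<in> {0..1}" for z s
    using continuous_map_funspace[OF k] that by (auto simp: Pi_iff)
  have sndT: "continuous_map ?ZT euclideanreal snd" and sndI: "continuous_map ?ZI euclideanreal snd"
    using continuous_map_projections(2)[of Z "top_of_set {0::real..}"]
      continuous_map_projections(2)[of Z "top_of_set {0..1::real}"]
    by (auto simp: continuous_map_in_subtopology)
  define E where "E = topspace Z \<times> {0} \<union> T \<times> {0::real..}"
  define Ht where "Ht w = (if fst w \<in> T then H0 w else K (fst w))" for w
  \<comment> \<open>A retraction of the cylinder to \<open>E\<close>, up to truncating time at
    \<open>N\<close>, from where on \<open>H0\<close> is constant. The slope \<open>N\<close> makes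
    a positive height imply both \<open>u < 1\<close> and that at least time \<open>u\<close> has
    passed, so that \<open>k\<close> has reached \<open>T\<close>.\<close>
  define r where "r w = (k (fst w) (min 1 (min (snd w) N)), max 0 (min (snd w) N - N * u (fst w)))" for w
  have Ht: "loop_family (subtopology ?ZT E) Y y0 Ht"
  proof (rule loop_family_pasting[where I = UNIV and S = "\<lambda>b. if b then T \<times> {0::real..} else topspace Z \<times> {0::real}"])
    fix b :: bool
    have "closedin ?ZT (if b then T \<times> {0::real..} else topspace Z \<times> {0::real})"
      using T by (auto simp: closedin_prod_Times_iff closedin_subtopology intro: exI[of _ "{0}"])
    moreover have "(if b then T \<times> {0::real..} else topspace Z \<times> {0::real}) \<subseteq> E"
      by (auto simp: E_def)
    ultimately show "closedin (subtopology ?ZT E) (if b then T \<times> {0::real..} else topspace Z \<times> {0::real})"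
      by (rule closedin_subset_topspace)
    show "loop_family (subtopology (subtopology ?ZT E) (if b then T \<times> {0..} else topspace Z \<times> {0})) Y y0 Ht"
    proof (cases b)
      case True
      have "E \<inter> T \<times> {0..} = T \<times> {0..}" by (auto simp: E_def)
      then have eq: "subtopology (subtopology ?ZT E) (T \<times> {0..}) = prod_topology (subtopology Z T) (top_of_set {0..})"
        by (simp add: subtopology_subtopology subtopology_Times)
      have "loop_family (prod_topology (subtopology Z T) (top_of_set {0..})) Y y0 Ht"
        by (rule loop_family_eq[OF H0]) (auto simp: Ht_def)
      with True show ?thesis by (simp only: eq if_True)
    next
      case False
      have "loop_family (subtopology (subtopology ?ZT E) (topspace Z \<times> {0})) Y y0 Ht"
      proof (rule loop_family_eq[OF loop_family_compose[OF K]])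
        show "continuous_map (subtopology (subtopology ?ZT E) (topspace Z \<times> {0})) Z fst"
          unfolding subtopology_subtopology by (intro cm_intros)
      qed (auto simp: Ht_def H00)
      with False show ?thesis by simp
    qed
  next
    show "topspace (subtopology ?ZT E) \<subseteq> (\<Union>b\<in>UNIV. if b then T \<times> {0..} else topspace Z \<times> {0})"
      by (auto simp: E_def split: if_splits)
  qed simp
  have r: "continuous_map ?ZT (subtopology ?ZT E) r"
    unfolding continuous_map_in_subtopology
  proof
    have "continuous_map ?ZT (top_of_set {0::real..}) (\<lambda>w. max 0 (min (snd w) N - N * u (fst w)))"
      by (auto simp: continuous_map_in_subtopology intro!: cm_intros sndT continuous_map_apply[OF u])
    then show "continuous_map ?ZT ?ZT r"
      unfolding r_def using N by (intro continuous_map_pairedI kc cm_intros sndT) auto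
    show "r \<in> topspace ?ZT \<rightarrow> E"
    proof
      fix w assume "w \<in> topspace ?ZT"
      then have w: "fst w \<in> topspace Z" "0 \<le> snd w" by auto
      show "r w \<in> E"
      proof (cases "min (snd w) N \<le> N * u (fst w)")
        case True
        then show ?thesis using w N kZ[of "fst w" "min 1 (min (snd w) N)"] by (simp add: r_def E_def)
      next
        case False
        then have u1: "u (fst w) < 1"
          using N u01[OF w(1)] by (cases "u (fst w) = 1") auto
        have "u (fst w) \<le> N * u (fst w)" using N u01[OF w(1)] by (simp add: mult_le_cancel_right1)
        then have "k (fst w) (min 1 (min (snd w) N)) \<in> T"
          using False u1 by (intro ku[OF w(1)]) auto
        then show ?thesis by (simp add: r_def E_def)
      qed
    qed
  qed
  define H1 where "H1 w = Ht (r w)" for w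
  have H1: "loop_family ?ZT Y y0 H1"
    unfolding H1_def by (rule loop_family_compose[OF Ht r])
  have H1_0: "H1 (z, 0) = K z" if "z \<in> topspace Z" for z
    using that k0[OF that] N u01[OF that] H00 uT[of z]
    by (cases "z \<in> T") (auto simp: H1_def Ht_def r_def max_def)
  have H1_T: "H1 (z, s) = H0 (z, s)" if "z \<in> T" "0 \<le> s" for z s
    using that kT[OF that(1)] uT[OF that(1)] N H0N[OF that(1)] by (auto simp: H1_def Ht_def r_def min_def)
  define F where "F z = H1 (z, N)" for z
  have F: "loop_family Z Y y0 F"
    unfolding F_def using N
    by (intro loop_family_compose[OF H1] continuous_map_pairedI cm_intros)
      (auto simp: continuous_map_in_subtopology)
  have F_T: "F z = loop_mult (f0 z) (R z)" if "z \<in> T" for z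
    using H1_T[OF that] H0N[OF that] N by (simp add: F_def)
  define \<kappa> where "\<kappa> z = k z 1" for z
  have \<kappa>: "continuous_map Z Z \<kappa>"
    unfolding \<kappa>_def by (intro kc cm_intros) auto
  have \<kappa>Z: "\<kappa> z \<in> topspace Z" if "z \<in> topspace Z" for z using kZ[OF that] by (simp add: \<kappa>_def)
  have \<kappa>T: "\<kappa> z = z" if "z \<in> T" for z using kT[OF that] by (simp add: \<kappa>_def)
  have F\<kappa>: "loop_family Z Y y0 (\<lambda>z. F (\<kappa> z))" and R\<kappa>: "loop_family Z Y y0 (\<lambda>z. R (\<kappa> z))"
    using loop_family_compose[OF F \<kappa>] loop_family_compose[OF R \<kappa>] by auto
  have f0_at: "f0 z \<in> loops_at y0" if "z \<in> T" for z
    using loop_familyD(3)[OF f0] that TZ by auto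
  \<comment> \<open>Where \<open>u < 1\<close>, the end \<open>\<kappa> z\<close> of the deformation
    lies in \<open>T\<close>, and there \<open>F\<close> is the product of \<open>f0\<close> and
    \<open>R\<close>.\<close>
  have div: "divisible_up_to y0 (F (\<kappa> z)) (R (\<kappa> z)) (u z)" if z: "z \<in> topspace Z" for z
    unfolding divisible_up_to_def
  proof (intro conjI impI u01 z)
    show "F (\<kappa> z) \<in> loops_at y0" "R (\<kappa> z) \<in> loops_at y0"
      using loop_familyD(3)[OF F\<kappa> z] loop_familyD(3)[OF R\<kappa> z] by auto
    assume "u z < 1"
    then have "\<kappa> z \<in> T" using ku[OF z, of 1] u01[OF z] by (auto simp: \<kappa>_def)
    then show "\<exists>e\<in>loops_at y0. F (\<kappa> z) = loop_mult e (R (\<kappa> z))"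
      using F_T f0_at by blast
  qed
  define f where "f z = loop_div (F (\<kappa> z)) (R (\<kappa> z)) (u z)" for z
  have f: "loop_family Z Y y0 f"
    unfolding f_def by (rule loop_family_div[OF F\<kappa> R\<kappa> u div])
  have f_T: "f z = f0 z" if "z \<in> T" for z
    using loop_div_at_0[OF f0_at[OF that] loop_familyD(3)[OF R], of z] that TZ
    by (auto simp: f_def \<kappa>T F_T uT)
  \<comment> \<open>Three stages of duration 1, which account for \<open>N + 3\<close>:
    \<open>F z\<close> is carried to \<open>F (\<kappa> z)\<close>, the detour along
    \<open>R (\<kappa> z)\<close> is inserted, and \<open>R (\<kappa> z)\<close> is carried back to
    \<open>R z\<close>. All three are constant over \<open>T\<close>.\<close>
  define B1 where "B1 w = F (k (fst w) (snd w))" for w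
  define B2 where "B2 w = loop_zigzag (F (\<kappa> (fst w))) (R (\<kappa> (fst w))) (u (fst w)) (1 - snd w)" for w
  define B3 where "B3 w = loop_mult (f (fst w)) (R (k (fst w) (1 - snd w)))" for w
  have B1: "loop_family ?ZI Y y0 B1"
    unfolding B1_def by (intro loop_family_compose[OF F] kc cm_intros sndI) auto
  have B2: "loop_family ?ZI Y y0 B2"
    unfolding B2_def by (rule loop_family_div_homotopy[OF F\<kappa> R\<kappa> u div])
  have B3: "loop_family ?ZI Y y0 B3"
    unfolding B3_def
    by (intro loop_family_mult loop_family_compose[OF f] loop_family_compose[OF R] kc cm_intros sndI) auto
  define H2 where "H2 w = (if snd w \<le> N then H1 w else B1 (fst w, min 1 (snd w - N)))" for w
  define H3 where "H3 w = (if snd w \<le> N + 1 then H2 w else B2 (fst w, min 1 (snd w - (N + 1))))" for w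
  define H4 where "H4 w = (if snd w \<le> N + 2 then H3 w else B3 (fst w, min 1 (snd w - (N + 2))))" for w
  have H2: "loop_family ?ZT Y y0 H2"
    unfolding H2_def using N
    by (intro loop_family_concat_homotopy H1 B1) (auto simp: B1_def k0 F_def)
  have H3: "loop_family ?ZT Y y0 H3"
    unfolding H3_def
  proof (intro loop_family_concat_homotopy H2 B2)
    fix z assume z: "z \<in> topspace Z"
    show "B2 (z, 0) = H2 (z, N + 1)"
      using loop_zigzag_1[OF div[OF z]] by (simp add: B2_def H2_def B1_def \<kappa>_def)
  qed (use N in auto)
  have H4: "loop_family ?ZT Y y0 H4"
    unfolding H4_def
  proof (intro loop_family_concat_homotopy H3 B3)
    fix z assume z: "z \<in> topspace Z"
    show "B3 (z, 0) = H3 (z, N + 2)"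
      using loop_zigzag_0[OF div[OF z]] by (simp add: B3_def H3_def B2_def f_def \<kappa>_def)
  qed (use N in auto)
  show thesis
  proof (rule that[OF f f_T H4])
    show "H4 (z, 0) = K z" if "z \<in> topspace Z" for z
      using N H1_0[OF that] by (simp add: H4_def H3_def H2_def)
    show "H4 (z, s) = H0 (z, s)" if z: "z \<in> T" and s: "0 \<le> s" for z s
    proof -
      have zZ: "z \<in> topspace Z" using z TZ by blast
      have late: "H0 (z, s) = F z" if "N \<le> s" using H0N[OF z that] F_T[OF z] by simp
      have "B1 (z, a) = F z" "B3 (z, a) = F z" if "a \<in> {0..1}" for a
        using kT[OF z, of a] kT[OF z, of "1 - a"] that by (auto simp: B1_def B3_def F_T[OF z] f_T[OF z])
      moreover have "B2 (z, a) = F z" for a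
        using loop_zigzag_at_0 div[OF zZ] by (simp add: B2_def \<kappa>T[OF z] uT[OF z])
      ultimately show ?thesis
        using late H1_T[OF z s] N by (simp add: H4_def H3_def H2_def)
    qed
    show "H4 (z, s) = loop_mult (f z) (R z)" if "z \<in> topspace Z" "N + 3 \<le> s" for z s
      using that k0 by (simp add: H4_def B3_def)
  qed
qed

section \<open>Products over subsequences\<close>

definition loop_prod :: "'y \<Rightarrow> 'y moore_loop list \<Rightarrow> 'y moore_loop" where
  "loop_prod y0 cs = foldr loop_mult cs (loop_unit y0)"

definition subseq_prod :: "'y \<Rightarrow> ('a list \<Rightarrow> 'y moore_loop) \<Rightarrow> 'a list \<Rightarrow> 'y moore_loop" where
  "subseq_prod y0 F xs = loop_prod y0 (map F (subseqs xs))"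

definition proper_subseq_prod :: "'y \<Rightarrow> ('a list \<Rightarrow> 'y moore_loop) \<Rightarrow> 'a list \<Rightarrow> 'y moore_loop" where
  "proper_subseq_prod y0 F xs = loop_prod y0 (map F (tl (subseqs xs)))"

lemma loop_prod_at: "set cs \<subseteq> loops_at y0 \<Longrightarrow> loop_prod y0 cs \<in> loops_at y0"
  by (induction cs) (auto simp: loop_prod_def intro: loop_mult_at)

lemma loop_prod_append:
  assumes "set cs \<subseteq> loops_at y0" "set ds \<subseteq> loops_at y0"
  shows "loop_prod y0 (cs @ ds) = loop_mult (loop_prod y0 cs) (loop_prod y0 ds)"
  using assms(1)
proof (induction cs)
  case Nil
  then show ?case
    using loop_mult_unit_left[OF loop_prod_at[OF assms(2)]] by (simp add: loop_prod_def)
next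
  case (Cons c cs)
  then show ?case
    using loop_mult_assoc[OF loop_prod_at[of cs y0]] by (simp add: loop_prod_def)
qed

lemma loop_prod_units: "(\<And>c. c \<in> set cs \<Longrightarrow> c = loop_unit y0) \<Longrightarrow> loop_prod y0 cs = loop_unit y0"
proof (induction cs)
  case (Cons c cs)
  then have "c = loop_unit y0" "loop_prod y0 cs = loop_unit y0" by simp_all
  then show ?case by (simp add: loop_prod_def loop_mult_unit_left)
qed (simp add: loop_prod_def)

lemma loop_family_prod:
  assumes "\<And>i. i \<in> set is \<Longrightarrow> loop_family Z Y y0 (F i)" "y0 \<in> topspace Y"
  shows "loop_family Z Y y0 (\<lambda>z. loop_prod y0 (map (\<lambda>i. F i z) is))"
  using assms(1)
proof (induction "is")
  case Nil
  then show ?case using loop_family_unit[OF assms(2)] by (simp add: loop_prod_def)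
next
  case (Cons i "is")
  then show ?case
    using loop_family_mult[of Z Y y0 "F i" "\<lambda>z. loop_prod y0 (map (\<lambda>i. F i z) is)"]
    by (simp add: loop_prod_def)
qed

lemma loop_map_prod:
  "f y0 = z0 \<Longrightarrow> loop_map f (loop_prod y0 cs) = loop_prod z0 (map (loop_map f) cs)"
  by (induction cs) (auto simp: loop_prod_def loop_map_unit loop_map_mult)

lemma loop_map_subseq_prod:
  assumes "f y0 = z0"
  shows "loop_map f (subseq_prod y0 F xs) = subseq_prod z0 (\<lambda>ys. loop_map f (F ys)) xs"
  using loop_map_prod[of f y0 z0, OF assms] by (simp add: subseq_prod_def o_def)

lemma subseqs_map: "subseqs (map f xs) = map (map f) (subseqs xs)"
  by (induction xs) (auto simp: Let_def)

lemma subseqs_eq_Cons: "subseqs xs = xs # tl (subseqs xs)"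
proof -
  have "\<exists>zs. subseqs xs = xs # zs" by (induction xs) (auto simp: Let_def)
  then show ?thesis by auto
qed

lemma tl_subseqs_subset: "set (tl (subseqs xs)) \<subseteq> set (subseqs xs)"
  by (metis list.set_intros(2) subseqs_eq_Cons subsetI)

lemma set_subseqs_subset: "ys \<in> set (subseqs xs) \<Longrightarrow> set ys \<subseteq> set xs"
  using subseqs_powset[of xs] by (metis PowD image_eqI)

lemma length_proper_subseqs: "ys \<in> set (tl (subseqs xs)) \<Longrightarrow> length ys < length xs"
proof (induction xs arbitrary: ys)
  case (Cons x xs)
  obtain zs where zs: "subseqs xs = xs # zs" using subseqs_eq_Cons by blast
  then have "length ws \<le> length xs" if "ws \<in> set (subseqs xs)" for ws
    using Cons.IH[of ws] that by (auto intro: less_imp_le)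
  with zs Cons.IH Cons.prems show ?case by (auto simp: less_Suc_eq_le Suc_le_eq)
qed simp

text \<open>\<open>subseqs\<close> puts the whole list first, so the factor to be solved for stands
  at the left and the shorter ones form a single right-hand factor.\<close>

lemma subseq_prod_eq_mult: "subseq_prod y0 F xs = loop_mult (F xs) (proper_subseq_prod y0 F xs)"
  unfolding subseq_prod_def proper_subseq_prod_def
  by (subst subseqs_eq_Cons) (simp add: loop_prod_def)

text \<open>\<open>subseqs\<close> lists the sublists through the head before those that omit
  it.\<close>

lemma subseq_prod_Cons:
  assumes "\<And>ys. ys \<in> set (subseqs (x # xs)) \<Longrightarrow> F ys \<in> loops_at y0"
  shows "subseq_prod y0 F (x # xs) = loop_mult (subseq_prod y0 (\<lambda>ys. F (x # ys)) xs) (subseq_prod y0 F xs)"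
proof -
  have "set (map (\<lambda>ys. F (x # ys)) (subseqs xs)) \<subseteq> loops_at y0" "set (map F (subseqs xs)) \<subseteq> loops_at y0"
    using assms by (auto simp: Let_def)
  from loop_prod_append[OF this] show ?thesis
    by (simp add: subseq_prod_def Let_def o_def)
qed

lemma subseq_prod_cong:
  "(\<And>ys. ys \<in> set (subseqs xs) \<Longrightarrow> F ys = G ys) \<Longrightarrow> subseq_prod y0 F xs = subseq_prod y0 G xs"
  by (simp add: subseq_prod_def cong: map_cong)

lemma proper_subseq_prod_cong:
  "(\<And>ys. ys \<in> set (tl (subseqs xs)) \<Longrightarrow> F ys = G ys) \<Longrightarrow>
    proper_subseq_prod y0 F xs = proper_subseq_prod y0 G xs"
  by (simp add: proper_subseq_prod_def cong: map_cong)

lemma subseq_prod_at: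
  "(\<And>ys. ys \<in> set (subseqs xs) \<Longrightarrow> F ys \<in> loops_at y0) \<Longrightarrow> subseq_prod y0 F xs \<in> loops_at y0"
  unfolding subseq_prod_def by (rule loop_prod_at) auto

text \<open>If the head is \<open>a\<close>, the factors of all sublists through it are units, and
  the product over the tail remains. Products of a normalised family therefore depend only on the
  reduced list.\<close>

lemma subseq_prod_filter:
  assumes "\<And>ys. ys \<in> set (subseqs xs) \<Longrightarrow> F ys \<in> loops_at y0"
    and "\<And>ys. \<lbrakk>ys \<in> set (subseqs xs); a \<in> set ys\<rbrakk> \<Longrightarrow> F ys = loop_unit y0"
  shows "subseq_prod y0 F (filter (\<lambda>x. x \<noteq> a) xs) = subseq_prod y0 F xs"
  using assms
proof (induction xs arbitrary: F)
  case (Cons x xs)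
  have IH: "subseq_prod y0 F (filter (\<lambda>x. x \<noteq> a) xs) = subseq_prod y0 F xs"
    using Cons.prems by (intro Cons.IH) (auto simp: Let_def)
  show ?case
  proof (cases "x = a")
    case True
    have "subseq_prod y0 (\<lambda>ys. F (x # ys)) xs = loop_unit y0"
      unfolding subseq_prod_def using Cons.prems(2) True
      by (intro loop_prod_units) (auto simp: Let_def)
    moreover have "subseq_prod y0 F xs \<in> loops_at y0"
      using Cons.prems(1) by (intro subseq_prod_at) (auto simp: Let_def)
    ultimately show ?thesis
      using IH True subseq_prod_Cons[of x xs F, OF Cons.prems(1)] by (simp add: loop_mult_unit_left)
  next
    case False
    have IH2: "subseq_prod y0 (\<lambda>ys. F (x # ys)) (filter (\<lambda>x. x \<noteq> a) xs) = subseq_prod y0 (\<lambda>ys. F (x # ys)) xs"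
      using Cons.prems by (intro Cons.IH) (auto simp: Let_def)
    have sub: "set (subseqs (filter (\<lambda>x. x \<noteq> a) xs)) \<subseteq> set (subseqs xs)"
    proof (induction xs)
      case (Cons y ys) then show ?case by (auto simp: Let_def)
    qed simp
    have "subseq_prod y0 F (x # filter (\<lambda>x. x \<noteq> a) xs)
        = loop_mult (subseq_prod y0 (\<lambda>ys. F (x # ys)) xs) (subseq_prod y0 F xs)"
      using sub Cons.prems(1) by (subst subseq_prod_Cons) (auto simp: Let_def IH IH2)
    then show ?thesis using False subseq_prod_Cons[of x xs F, OF Cons.prems(1)] by simp
  qed
qed simp

lemma fst_loop_prod: "fst (loop_prod y0 cs) = (\<Sum>c\<leftarrow>cs. fst c)"
  by (induction cs) (auto simp: loop_prod_def loop_unit_def loop_mult_def)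

section \<open>Tuples as lists\<close>

definition lst :: "nat \<Rightarrow> (nat \<Rightarrow> 'a) \<Rightarrow> 'a list" where
  "lst n g = map g [0..<n]"

definition tup :: "'a list \<Rightarrow> nat \<Rightarrow> 'a" where
  "tup xs = (\<lambda>j\<in>{..<length xs}. xs ! j)"

definition commuting_lists :: "('a, 'b) monoid_scheme \<Rightarrow> 'a list set" where
  "commuting_lists G = {xs. set xs \<subseteq> carrier G \<and> (\<forall>x\<in>set xs. \<forall>y\<in>set xs. x \<otimes>\<^bsub>G\<^esub> y = y \<otimes>\<^bsub>G\<^esub> x)}"

lemma length_lst [simp]: "length (lst n g) = n"
  by (simp add: lst_def)

lemma set_lst: "set (lst n g) = g ` {..<n}"
  by (auto simp: lst_def atLeast0LessThan)

lemma lst_tup [simp]: "lst (length xs) (tup xs) = xs"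
  by (rule nth_equalityI) (auto simp: lst_def tup_def)

lemma tup_lst: "g \<in> extensional {..<n} \<Longrightarrow> tup (lst n g) = g"
  by (rule ext) (simp add: tup_def lst_def extensional_def)

lemma commuting_lists_subset:
  "xs \<in> commuting_lists G \<Longrightarrow> set ys \<subseteq> set xs \<Longrightarrow> ys \<in> commuting_lists G"
  unfolding commuting_lists_def by blast

lemma commuting_lists_subseqs:
  "xs \<in> commuting_lists G \<Longrightarrow> ys \<in> set (subseqs xs) \<Longrightarrow> ys \<in> commuting_lists G"
  by (erule commuting_lists_subset) (rule set_subseqs_subset)

lemma topspace_tuple_space: "topspace (tuple_space G n) = {..<n} \<rightarrow>\<^sub>E carrier G"
  by (simp add: tuple_space_def)

lemma topspace_Hom: "topspace (Hom G n) = {g \<in> extensional {..<n}. lst n g \<in> commuting_lists G}"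
  by (auto simp: Hom_def topspace_tuple_space commuting_lists_def set_lst PiE_def)

lemma topspace_Hom_lst: "g \<in> topspace (Hom G n) \<Longrightarrow> lst n g \<in> commuting_lists G"
  by (simp add: topspace_Hom)

lemma tup_topspace_Hom: "xs \<in> commuting_lists G \<Longrightarrow> tup xs \<in> topspace (Hom G (length xs))"
  by (simp add: topspace_Hom) (simp add: tup_def)

lemma lst_imp_tup: "g \<in> topspace (Hom G n) \<Longrightarrow> tup (lst n g) = g"
  by (simp add: topspace_Hom tup_lst)

lemma continuous_map_Hom_component:
  assumes "j < n"
  shows "continuous_map (Hom G n) (top_of_set (carrier G)) (\<lambda>g. g j)"
  unfolding Hom_def tuple_space_def using assms
  by (intro continuous_map_from_subtopology continuous_map_product_projection) simp

lemma continuous_map_into_Hom: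
  assumes "\<And>j. j < n \<Longrightarrow> continuous_map W (top_of_set (carrier G)) (\<lambda>w. f w j)"
    and "\<And>w. w \<in> topspace W \<Longrightarrow> f w \<in> topspace (Hom G n)"
  shows "continuous_map W (Hom G n) f"
proof -
  have "continuous_map W (tuple_space G n) f"
    unfolding tuple_space_def continuous_map_componentwise
  proof (intro conjI ballI)
    show "f ` topspace W \<subseteq> extensional {..<n}"
      using assms(2) by (auto simp: topspace_Hom)
    show "continuous_map W (top_of_set (carrier G)) (\<lambda>w. f w k)" if "k \<in> {..<n}" for k
      using that by (intro assms(1)) simp
  qed
  then show ?thesis
    using assms(2) by (auto simp: Hom_def continuous_map_in_subtopology)
qed

lemma continuous_map_subtuple:
  assumes "set is \<subseteq> {..<n}"
  shows "continuous_map (Hom G n) (Hom G (length is)) (\<lambda>g. tup (map g is))"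
proof (rule continuous_map_into_Hom)
  fix j assume j: "j < length is"
  then have "is ! j < n" using assms nth_mem by blast
  from continuous_map_Hom_component[OF this]
  show "continuous_map (Hom G n) (top_of_set (carrier G)) (\<lambda>g. tup (map g is) j)"
    using j by (simp add: tup_def)
next
  fix g assume "g \<in> topspace (Hom G n)"
  then have "map g is \<in> commuting_lists G"
    using assms by (intro commuting_lists_subset[OF topspace_Hom_lst]) (auto simp: set_lst)
  then show "tup (map g is) \<in> topspace (Hom G (length is))"
    using tup_topspace_Hom[of "map g is" G] by simp
qed

text \<open>Lists make sublists and reduction easy to express; continuity is tested on each space of
  tuples of fixed length.\<close>

definition tuple_family ::
    "('a::topological_space, 'b) monoid_scheme \<Rightarrow> 'p topology \<Rightarrow> 'y topology \<Rightarrow> 'y \<Rightarrow> nat \<Rightarrow>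
      ('p \<Rightarrow> 'a list \<Rightarrow> 'y moore_loop) \<Rightarrow> bool" where
  "tuple_family G P Y y0 n F \<longleftrightarrow>
    loop_family (prod_topology P (Hom G n)) Y y0 (\<lambda>w. F (fst w) (lst n (snd w)))"

lemma tuple_family_at:
  assumes "tuple_family G P Y y0 (length xs) F" "p \<in> topspace P" "xs \<in> commuting_lists G"
  shows "F p xs \<in> loops_at y0"
  using loop_familyD(3)[OF assms(1)[unfolded tuple_family_def], of "(p, tup xs)"]
    tup_topspace_Hom[OF assms(3)] assms(2) by simp

lemma tuple_family_subtuple:
  assumes "tuple_family G P Y y0 (length is) F" "set is \<subseteq> {..<n}"
  shows "loop_family (prod_topology P (Hom G n)) Y y0 (\<lambda>w. F (fst w) (map (snd w) is))"
proof -
  have "continuous_map (prod_topology P (Hom G n)) (prod_topology P (Hom G (length is)))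
      (\<lambda>w. (fst w, tup (map (snd w) is)))"
    by (intro cm_intros continuous_map_apply[OF continuous_map_subtuple[OF assms(2)]])
  from loop_family_compose[OF assms(1)[unfolded tuple_family_def] this]
  have "loop_family (prod_topology P (Hom G n)) Y y0
    (\<lambda>w. F (fst w) (lst (length is) (tup (map (snd w) is))))" by simp
  moreover have "lst (length is) (tup (map g is)) = map g is" for g :: "nat \<Rightarrow> 'a"
    using lst_tup[of "map g is"] by simp
  ultimately show ?thesis by simp
qed

text \<open>The sublists of \<open>lst n g\<close> are the images of the fixed index lists in
  \<open>subseqs [0..<n]\<close>. The product is thus a finite product of families pulled back along
  continuous subtuple maps.\<close>

lemma tuple_family_proper_subseq_prod:
  assumes "\<And>m. m < n \<Longrightarrow> tuple_family G P Y y0 m F" "y0 \<in> topspace Y"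
  shows "tuple_family G P Y y0 n (\<lambda>p. proper_subseq_prod y0 (F p))"
proof -
  have "loop_family (prod_topology P (Hom G n)) Y y0
      (\<lambda>w. loop_prod y0 (map (\<lambda>is. F (fst w) (map (snd w) is)) (tl (subseqs [0..<n]))))"
  proof (rule loop_family_prod[OF _ assms(2)])
    fix "is" assume i: "is \<in> set (tl (subseqs [0..<n]))"
    then have "length is < n" using length_proper_subseqs[of "is" "[0..<n]"] by simp
    moreover have "set is \<subseteq> {..<n}"
      using i set_subseqs_subset[of "is" "[0..<n]"] tl_subseqs_subset[of "[0..<n]"]
      by (auto simp: atLeast0LessThan)
    ultimately show "loop_family (prod_topology P (Hom G n)) Y y0 (\<lambda>w. F (fst w) (map (snd w) is))"
      by (intro tuple_family_subtuple assms(1))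
  qed
  moreover have "map (F p) (tl (subseqs (lst n g))) = map (\<lambda>is. F p (map g is)) (tl (subseqs [0..<n]))"
    for p and g :: "nat \<Rightarrow> 'a"
    unfolding lst_def subseqs_map map_tl[symmetric] by simp
  ultimately show ?thesis
    by (simp only: tuple_family_def proper_subseq_prod_def)
qed

lemma tuple_family_subseq_prod:
  assumes "\<And>m. m \<le> n \<Longrightarrow> tuple_family G P Y y0 m F" "y0 \<in> topspace Y"
  shows "tuple_family G P Y y0 n (\<lambda>p. subseq_prod y0 (F p))"
proof -
  have "tuple_family G P Y y0 n (\<lambda>p. proper_subseq_prod y0 (F p))"
    using assms by (intro tuple_family_proper_subseq_prod) auto
  with assms(1)[of n] show ?thesis
    by (auto simp: tuple_family_def subseq_prod_eq_mult intro!: loop_family_mult)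
qed

section \<open>Factorisation of compatible families\<close>

lemma length_subseqs_le: "ys \<in> set (subseqs xs) \<Longrightarrow> length ys \<le> length xs"
  by (induction xs arbitrary: ys) (auto simp: Let_def intro: le_SucI)

text \<open>The start value 1 stands for no arrival, so a value below 1 is always attained by an
  entry.\<close>

primrec min_upto :: "(nat \<Rightarrow> real) \<Rightarrow> nat \<Rightarrow> real" where
  "min_upto f 0 = 1"
| "min_upto f (Suc n) = min (min_upto f n) (f n)"

lemma min_upto_range: "(\<And>j. j < n \<Longrightarrow> f j \<in> {0..1}) \<Longrightarrow> min_upto f n \<in> {0..1}"
  by (induction n) (auto simp: min_def)

lemma min_upto_attained: "min_upto f n < 1 \<Longrightarrow> \<exists>j<n. f j = min_upto f n"
  by (induction n) (auto simp: min_def less_Suc_eq split: if_splits)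

lemma min_upto_le: "j < n \<Longrightarrow> min_upto f n \<le> f j"
  by (induction n) (auto simp: less_Suc_eq min_le_iff_disj)

lemma continuous_map_min_upto:
  "(\<And>j. j < n \<Longrightarrow> continuous_map W euclideanreal (\<lambda>w. f w j)) \<Longrightarrow>
    continuous_map W euclideanreal (\<lambda>w. min_upto (f w) n)"
  by (induction n) (auto intro!: cm_intros)

text \<open>
  \<open>h\<close> contracts a neighbourhood of the unit in \<open>G\<close> in such a way that commuting elements stay
  commuting, and \<open>e x\<close> is the time at which \<open>x\<close> arrives (if it does before time \<open>1\<close>).
\<close>

locale commuting_deformation = monoid G
  for G :: "('a::topological_space, 'b) monoid_scheme" (structure) +
  fixes e :: "'a \<Rightarrow> real" and h :: "'a \<Rightarrow> real \<Rightarrow> 'a"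
  assumes e_cont: "continuous_map (top_of_set (carrier G)) euclideanreal e"
    and e_range: "x \<in> carrier G \<Longrightarrow> e x \<in> {0..1}"
    and e_eq_0: "x \<in> carrier G \<Longrightarrow> e x = 0 \<longleftrightarrow> x = \<one>"
    and h_cont: "continuous_map (prod_topology (top_of_set (carrier G)) (top_of_set {0..1}))
      (top_of_set (carrier G)) (\<lambda>x. h (fst x) (snd x))"
    and h_0: "x \<in> carrier G \<Longrightarrow> h x 0 = x"
    and h_end: "\<lbrakk>x \<in> carrier G; e x < 1; s \<in> {e x..1}\<rbrakk> \<Longrightarrow> h x s = \<one>"
    and h_commute: "\<lbrakk>x \<in> carrier G; y \<in> carrier G; s \<in> {0..1}; x \<otimes> y = y \<otimes> x\<rbrakk> \<Longrightarrow>
      x \<otimes> h y s = h y s \<otimes> x"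
    and closedin_Hom: "closedin (tuple_space G n) (topspace (Hom G n))"
begin

definition nf :: "'a list \<Rightarrow> 'a list" where
  "nf xs = filter (\<lambda>x. x \<noteq> \<one>) xs"

lemma nf_nf [simp]: "nf (nf xs) = nf xs"
  by (simp add: nf_def)

lemma nf_Nil [simp]: "nf [] = []"
  by (simp add: nf_def)

lemma nf_eq_self: "\<one> \<notin> set xs \<Longrightarrow> nf xs = xs"
  unfolding nf_def by (rule filter_True) auto

lemma length_nf_less: "\<one> \<in> set xs \<Longrightarrow> length (nf xs) < length xs"
  unfolding nf_def by (rule length_filter_less) auto

lemma length_nf_le: "length (nf xs) \<le> length xs"
  unfolding nf_def by (rule length_filter_le)

lemma nf_commuting: "xs \<in> commuting_lists G \<Longrightarrow> nf xs \<in> commuting_lists G"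
  by (erule commuting_lists_subset) (auto simp: nf_def)

lemma h_closed: "x \<in> carrier G \<Longrightarrow> s \<in> {0..1} \<Longrightarrow> h x s \<in> carrier G"
  using continuous_map_funspace[OF h_cont] by (auto simp: Pi_iff)

lemma commuting_lists_components:
  assumes "g \<in> topspace (Hom G n)" "i < n" "j < n"
  shows "g i \<in> carrier G" "g i \<otimes> g j = g j \<otimes> g i"
  using topspace_Hom_lst[OF assms(1)] assms(2,3) by (auto simp: commuting_lists_def set_lst)

definition deform :: "nat \<Rightarrow> (nat \<Rightarrow> 'a) \<Rightarrow> real \<Rightarrow> nat \<Rightarrow> 'a" where
  "deform n g s = (\<lambda>j\<in>{..<n}. h (g j) s)"

definition arrival :: "nat \<Rightarrow> (nat \<Rightarrow> 'a) \<Rightarrow> real" where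
  "arrival n g = min_upto (\<lambda>j. e (g j)) n"

text \<open>\<open>h_commute\<close> moves one of two commuting elements at a time, so it is applied
  twice: first to \<open>g i\<close>, then to \<open>g j\<close> against the element already
  moved.\<close>

lemma deform_in_Hom:
  assumes g: "g \<in> topspace (Hom G n)" and s: "s \<in> {0..1}"
  shows "deform n g s \<in> topspace (Hom G n)"
proof -
  have "h (g i) s \<otimes> h (g j) s = h (g j) s \<otimes> h (g i) s" if "i < n" "j < n" for i j
  proof -
    note ij = commuting_lists_components[OF g that] commuting_lists_components(1)[OF g that(2,1)]
    have "g j \<otimes> h (g i) s = h (g i) s \<otimes> g j"
      using ij s by (intro h_commute) auto
    then show ?thesis using ij s by (intro h_commute) (auto simp: h_closed)
  qed
  then show ?thesis
    using commuting_lists_components(1)[OF g] s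
    by (auto simp: topspace_Hom commuting_lists_def set_lst deform_def h_closed)
qed

lemma continuous_deform:
  "continuous_map (prod_topology (Hom G n) (top_of_set {0..1})) (Hom G n) (\<lambda>x. deform n (fst x) (snd x))"
proof (rule continuous_map_into_Hom)
  let ?W = "prod_topology (Hom G n) (top_of_set {0..1::real})"
  fix j assume j: "j < n"
  have "continuous_map ?W euclideanreal snd"
    using continuous_map_projections(2)[of "Hom G n" "top_of_set {0..1::real}"]
    by (simp add: continuous_map_in_subtopology)
  then have "continuous_map ?W (top_of_set (carrier G)) (\<lambda>x. h (fst x j) (snd x))"
    by (intro continuous_map_apply2[OF h_cont] continuous_map_apply[OF continuous_map_Hom_component[OF j]]
        cm_intros) auto
  then show "continuous_map ?W (top_of_set (carrier G)) (\<lambda>x. deform n (fst x) (snd x) j)"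
    using j by (simp add: deform_def)
qed (auto intro: deform_in_Hom)

lemma continuous_e_component:
  "j < n \<Longrightarrow> continuous_map (Hom G n) euclideanreal (\<lambda>g. e (g j))"
  by (rule continuous_map_apply[OF e_cont continuous_map_Hom_component])

lemma continuous_arrival: "continuous_map (Hom G n) euclideanreal (arrival n)"
  unfolding arrival_def using continuous_map_min_upto[of n "Hom G n" "\<lambda>g j. e (g j)"] continuous_e_component
  by (simp add: fun_eq_iff)

lemma arrival_range: "g \<in> topspace (Hom G n) \<Longrightarrow> arrival n g \<in> {0..1}"
  unfolding arrival_def by (intro min_upto_range e_range commuting_lists_components)

lemma arrival_unit:
  assumes "g \<in> topspace (Hom G n)" "j < n" "g j = \<one>"
  shows "arrival n g = 0"
  using min_upto_le[of j n "\<lambda>j. e (g j)"] arrival_range[OF assms(1)] assms(2,3) e_eq_0[of \<one>]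
  by (simp add: arrival_def)

text \<open>A minimum below 1 is attained, and the coordinate attaining it has reached the unit by
  that time.\<close>

lemma deform_arrives:
  assumes g: "g \<in> topspace (Hom G n)" and s: "arrival n g < 1" "s \<in> {arrival n g..1}"
  shows "\<exists>j<n. deform n g s j = \<one>"
proof -
  obtain j where j: "j < n" "e (g j) = arrival n g"
    using min_upto_attained[of "\<lambda>j. e (g j)" n] s(1) by (auto simp: arrival_def)
  then have "h (g j) s = \<one>"
    using commuting_lists_components(1)[OF g j(1) j(1)] s by (intro h_end) auto
  then show ?thesis using j(1) by (auto simp: deform_def)
qed

lemma closedin_unit_component:
  assumes "j < n"
  shows "closedin (Hom G n) {g \<in> topspace (Hom G n). g j = \<one>}"
proof -
  have "closedin (Hom G n) {g \<in> topspace (Hom G n). e (g j) \<in> {0}}"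
    by (rule closedin_continuous_map_preimage[OF continuous_e_component[OF assms]]) simp
  moreover have "{g \<in> topspace (Hom G n). e (g j) \<in> {0}} = {g \<in> topspace (Hom G n). g j = \<one>}"
    using e_eq_0 commuting_lists_components(1) assms by auto
  ultimately show ?thesis by simp
qed

end

text \<open>
  Given a compatible family \<open>K\<close> of loops on all commuting tuples that over \<open>P0\<close> is a product of
  normalised families \<open>\<phi>\<close>, we look for such a factorisation over all of \<open>P\<close>, up to homotopy.
\<close>

locale factor_problem = commuting_deformation G e h
  for G :: "('a::topological_space, 'b) monoid_scheme" (structure) and e h +
  fixes P :: "'p topology" and P0 :: "'p set" and q :: "'p \<Rightarrow> real \<Rightarrow> 'p" and eP :: "'p \<Rightarrow> real"
    and Y :: "'y topology" and y0 :: 'y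
    and K \<phi> :: "'p \<Rightarrow> 'a list \<Rightarrow> 'y moore_loop"
  assumes P0_closed: "closedin P P0"
    and eP_cont: "continuous_map P euclideanreal eP"
    and eP_range: "p \<in> topspace P \<Longrightarrow> eP p \<in> {0..1}"
    and eP_P0: "p \<in> P0 \<Longrightarrow> eP p = 0"
    and q_cont: "continuous_map (prod_topology P (top_of_set {0..1})) P (\<lambda>x. q (fst x) (snd x))"
    and q_0: "p \<in> topspace P \<Longrightarrow> q p 0 = p"
    and q_end: "\<lbrakk>p \<in> topspace P; eP p < 1; s \<in> {eP p..1}\<rbrakk> \<Longrightarrow> q p s \<in> P0"
    and y0: "y0 \<in> topspace Y"
    and K_family: "tuple_family G P Y y0 n K"
    and K_nf: "\<lbrakk>p \<in> topspace P; xs \<in> commuting_lists G\<rbrakk> \<Longrightarrow> K p (nf xs) = K p xs"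
    and K_Nil: "p \<in> topspace P \<Longrightarrow> K p [] = loop_unit y0"
    and \<phi>_family: "tuple_family G (subtopology P P0) Y y0 n \<phi>"
    and \<phi>_unit: "\<lbrakk>p \<in> P0; xs \<in> commuting_lists G; xs = [] \<or> \<one> \<in> set xs\<rbrakk> \<Longrightarrow> \<phi> p xs = loop_unit y0"
    and K_eq_prod: "\<lbrakk>p \<in> P0; xs \<in> commuting_lists G\<rbrakk> \<Longrightarrow> K p xs = subseq_prod y0 (\<phi> p) xs"
begin

definition homotopy_family :: "nat \<Rightarrow> ('p \<Rightarrow> 'a list \<Rightarrow> real \<Rightarrow> 'y moore_loop) \<Rightarrow> bool" where
  "homotopy_family n H \<longleftrightarrow>
    loop_family (prod_topology (prod_topology P (Hom G n)) (top_of_set {0..})) Y y0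
      (\<lambda>w. H (fst (fst w)) (lst n (snd (fst w))) (snd w))"

text \<open>In the time bound, each increase of the length costs the three stages of the extension
  step, and the summand 1 provides the initial duration of at least 1 that this step
  requires.\<close>

definition solves_at where
  "solves_at f H p xs \<longleftrightarrow>
    (xs = [] \<or> \<one> \<in> set xs \<longrightarrow> f p xs = loop_unit y0) \<and> (p \<in> P0 \<longrightarrow> f p xs = \<phi> p xs) \<and>
    (\<forall>s\<ge>0. H p (nf xs) s = H p xs s) \<and> H p xs 0 = K p xs \<and> (p \<in> P0 \<longrightarrow> (\<forall>s\<ge>0. H p xs s = K p xs)) \<and>
    (xs = [] \<longrightarrow> (\<forall>s\<ge>0. H p xs s = loop_unit y0)) \<and>
    (\<forall>s. 3 * real (length xs) + 1 \<le> s \<longrightarrow> H p xs s = subseq_prod y0 (f p) xs)"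

definition partial_solution where
  "partial_solution n f H \<longleftrightarrow>
    (\<forall>m\<le>n. tuple_family G P Y y0 m f) \<and> (\<forall>m\<le>n. homotopy_family m H) \<and>
    (\<forall>p\<in>topspace P. \<forall>xs\<in>commuting_lists G. length xs \<le> n \<longrightarrow> solves_at f H p xs)"

lemma partial_solution_0: "\<exists>f H. partial_solution 0 f H"
proof (intro exI)
  let ?f = "\<lambda>_ _. loop_unit y0" and ?H = "\<lambda>_ _ _. loop_unit y0"
  have "loop_unit y0 = subseq_prod y0 (\<lambda>_. loop_unit y0) []"
    by (simp add: subseq_prod_def loop_prod_def loop_mult_unit_left)
  then show "partial_solution 0 ?f ?H"
    using K_Nil \<phi>_unit
    by (auto simp: partial_solution_def tuple_family_def homotopy_family_def solves_at_def
        intro!: loop_family_unit[OF y0])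
qed

text \<open>Over tuples with a unit, and over \<open>P0\<close>, the new factor and the homotopy are
  forced: by normalisation and reduction, respectively by \<open>\<phi>\<close> and
  \<open>K\<close>. The extension step then solves for the factor of the new length, with all
  shorter factors collected in \<open>R\<close>.\<close>

lemma partial_solution_Suc:
  assumes sol: "partial_solution n f H"
  shows "\<exists>f' H'. partial_solution (Suc n) f' H' \<and>
    (\<forall>p xs. length xs \<le> n \<longrightarrow> f' p xs = f p xs \<and> H' p xs = H p xs)"
proof -
  let ?Z = "prod_topology P (Hom G (Suc n))" and ?T0 = "top_of_set {0::real..}"
  let ?l = "\<lambda>w::'p \<times> (nat \<Rightarrow> 'a). lst (Suc n) (snd w)"
  \<comment> \<open>Time function for the union of two deformable subspaces: the part over
    \<open>P0\<close> and the degenerate tuples.\<close>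
  define u where "u w = min (eP (fst w)) (arrival (Suc n) (snd w))" for w
  \<comment> \<open>Both motions stop at time \<open>u\<close>. This fixes \<open>T\<close>
    pointwise, although \<open>deform\<close> could move the remaining coordinates of a degenerate
    tuple.\<close>
  define k where "k w s = (q (fst w) (min s (u w)), deform (Suc n) (snd w) (min s (u w)))" for w s
  define S where "S j = {w \<in> topspace ?Z. snd w j = \<one>}" for j
  define T0 where "T0 = {w \<in> topspace ?Z. fst w \<in> P0}"
  define T where "T = T0 \<union> (\<Union>j<Suc n. S j)"
  define K1 where "K1 w = K (fst w) (?l w)" for w
  define R where "R w = proper_subseq_prod y0 (f (fst w)) (?l w)" for w
  define f0 where "f0 w = (if fst w \<in> P0 then \<phi> (fst w) (?l w) else loop_unit y0)" for w
  define H0 where "H0 ws = (if fst (fst ws) \<in> P0 then K1 (fst ws) else H (fst (fst ws)) (nf (?l (fst ws))) (snd ws))"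
    for ws :: "('p \<times> (nat \<Rightarrow> 'a)) \<times> real"
  have f_fam: "tuple_family G P Y y0 m f" and H_fam: "homotopy_family m H" if "m \<le> n" for m
    using sol that by (auto simp: partial_solution_def)
  have at: "solves_at f H p xs" if "p \<in> topspace P" "xs \<in> commuting_lists G" "length xs \<le> n" for p xs
    using sol that by (auto simp: partial_solution_def)
  have Z: "fst w \<in> topspace P" "snd w \<in> topspace (Hom G (Suc n))" "?l w \<in> commuting_lists G"
    if "w \<in> topspace ?Z" for w
    using that by (auto simp: topspace_Hom_lst)

  \<comment> \<open>The closed set \<open>T\<close> and the deformation of its neighbourhood\<close>
  have one_iff: "\<one> \<in> set (?l w) \<longleftrightarrow> (\<exists>j<Suc n. snd w j = \<one>)" for w
    unfolding set_lst by force
  have T_iff: "w \<in> T \<longleftrightarrow> w \<in> topspace ?Z \<and> (fst w \<in> P0 \<or> \<one> \<in> set (?l w))" for w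
    unfolding one_iff by (auto simp: T_def T0_def S_def)
  have S_closed: "closedin ?Z (S j)" if "j < Suc n" for j
  proof -
    have "S j = topspace P \<times> {g \<in> topspace (Hom G (Suc n)). g j = \<one>}" by (auto simp: S_def)
    then show ?thesis using closedin_unit_component[OF that] by (simp add: closedin_prod_Times_iff)
  qed
  have T0_closed: "closedin ?Z T0"
  proof -
    have "T0 = P0 \<times> topspace (Hom G (Suc n))"
      using closedin_subset[OF P0_closed] by (auto simp: T0_def)
    then show ?thesis using P0_closed by (simp add: closedin_prod_Times_iff)
  qed
  have T_closed: "closedin ?Z T"
    unfolding T_def using S_closed T0_closed by (intro closedin_Un closedin_Union) auto
  have u_cont: "continuous_map ?Z euclideanreal u"
    unfolding u_def
    by (intro cm_intros continuous_map_apply[OF eP_cont] continuous_map_apply[OF continuous_arrival])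
  have u01: "u w \<in> {0..1}" if "w \<in> topspace ?Z" for w
    using eP_range[of "fst w"] arrival_range[of "snd w" "Suc n"] that by (auto simp: u_def)
  have uT: "u w = 0" if "w \<in> T" for w
  proof -
    have w: "w \<in> topspace ?Z" using that by (simp add: T_iff)
    show ?thesis
    proof (cases "fst w \<in> P0")
      case True
      then show ?thesis using eP_P0 arrival_range[OF Z(2)[OF w]] by (simp add: u_def)
    next
      case False
      then have "\<exists>j<Suc n. snd w j = \<one>" using that unfolding T_iff one_iff by blast
      then obtain j where "j < Suc n" "snd w j = \<one>" by blast
      then have "arrival (Suc n) (snd w) = 0" using arrival_unit[OF Z(2)[OF w]] by blast
      then show ?thesis using eP_range[OF Z(1)[OF w]] by (simp add: u_def)
    qed
  qed
  have k_cont: "continuous_map (prod_topology ?Z (top_of_set {0..1})) ?Z (\<lambda>x. k (fst x) (snd x))"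
  proof -
    let ?W = "prod_topology ?Z (top_of_set {0..1::real})"
    have s: "continuous_map ?W euclideanreal snd"
      using continuous_map_projections(2)[of ?Z "top_of_set {0..1::real}"]
      by (simp add: continuous_map_in_subtopology)
    have \<sigma>: "continuous_map ?W euclideanreal (\<lambda>x. min (snd x) (u (fst x)))"
      by (intro cm_intros s continuous_map_apply[OF u_cont])
    have \<sigma>01: "min (snd x) (u (fst x)) \<in> {0..1}" if "x \<in> topspace ?W" for x
      using u01[of "fst x"] that by auto
    have f1: "continuous_map ?W ?Z fst" by (intro cm_intros)
    show ?thesis
      unfolding k_def
      by (intro continuous_map_pairedI continuous_map_apply2[OF q_cont] continuous_map_apply2[OF continuous_deform]
          \<sigma> \<sigma>01 continuous_map_fstI[OF f1] continuous_map_sndI[OF f1])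
  qed
  have k0: "k w 0 = w" if "w \<in> topspace ?Z" for w
  proof -
    have "deform (Suc n) (snd w) 0 = snd w"
      using Z(2)[OF that] commuting_lists_components(1)[OF Z(2)[OF that]] h_0
      by (auto simp: deform_def fun_eq_iff topspace_Hom extensional_def)
    moreover have "min 0 (u w) = 0" using u01[OF that] by simp
    ultimately show ?thesis using q_0[OF Z(1)[OF that]] by (simp add: k_def)
  qed
  have kT: "k w s = w" if "w \<in> T" "s \<in> {0..1}" for w s
  proof -
    have "min s (u w) = min 0 (u w)" using uT[OF that(1)] that(2) by simp
    then have "k w s = k w 0" by (simp add: k_def)
    then show ?thesis using k0 that(1) by (simp add: T_iff)
  qed
  have ku: "k w s \<in> T" if "w \<in> topspace ?Z" "u w < 1" "s \<in> {u w..1}" for w s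
  proof -
    have s: "min s (u w) = u w" using that(3) by simp
    have in_Z: "k w s \<in> topspace ?Z"
    proof -
      have "s \<in> {0..1}" using that(3) u01[OF that(1)] by auto
      then show ?thesis using continuous_map_funspace[OF k_cont] that(1) by (fastforce simp: Pi_iff)
    qed
    show ?thesis
    proof (cases "eP (fst w) \<le> arrival (Suc n) (snd w)")
      case True
      then have "q (fst w) (u w) \<in> P0"
        using that(2) by (intro q_end Z(1) that(1)) (auto simp: u_def)
      then show ?thesis using in_Z by (auto simp: T_iff k_def s)
    next
      case False
      then have "\<exists>j<Suc n. deform (Suc n) (snd w) (u w) j = \<one>"
        using that(2) by (intro deform_arrives Z(2) that(1)) (auto simp: u_def)
      then have "\<exists>j<Suc n. snd (k w s) j = \<one>" by (simp only: k_def snd_conv s)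
      then show ?thesis using in_Z unfolding T_iff one_iff by blast
    qed
  qed

  \<comment> \<open>The data prescribed over \<open>T\<close>\<close>
  have K1_fam: "loop_family ?Z Y y0 K1"
    using K_family[of "Suc n"] unfolding tuple_family_def K1_def .
  have R_fam: "loop_family ?Z Y y0 R"
    using tuple_family_proper_subseq_prod[OF f_fam y0, of "Suc n"] unfolding tuple_family_def R_def
    by simp
  have f0_fam: "loop_family (subtopology ?Z T) Y y0 f0"
  proof (rule loop_family_pasting[where I = UNIV and S = "\<lambda>b. if b then T0 else (\<Union>j<Suc n. S j)"])
    fix b :: bool
    show "closedin (subtopology ?Z T) (if b then T0 else (\<Union>j<Suc n. S j))"
      using S_closed T0_closed by (intro closedin_subset_topspace) (auto simp: T_def intro!: closedin_Union)
    show "loop_family (subtopology (subtopology ?Z T) (if b then T0 else (\<Union>j<Suc n. S j))) Y y0 f0"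
    proof (cases b)
      case True
      have "subtopology (subtopology ?Z T) T0 = subtopology ?Z T0"
        unfolding subtopology_subtopology by (rule arg_cong) (auto simp: T_def)
      moreover have "subtopology ?Z T0 = prod_topology (subtopology P P0) (Hom G (Suc n))"
        unfolding prod_topology_subtopology using closedin_subset[OF P0_closed]
        by (intro arg_cong[of _ _ "subtopology ?Z"]) (auto simp: T0_def)
      moreover have "loop_family (prod_topology (subtopology P P0) (Hom G (Suc n))) Y y0 f0"
        using \<phi>_family[of "Suc n"] unfolding tuple_family_def
        by (rule loop_family_eq) (auto simp: f0_def)
      ultimately show ?thesis using True by simp
    next
      case False
      have "loop_family (subtopology (subtopology ?Z T) (\<Union>j<Suc n. S j)) Y y0 f0"
      proof (rule loop_family_eq[OF loop_family_unit[OF y0]])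
        fix w assume "w \<in> topspace (subtopology (subtopology ?Z T) (\<Union>j<Suc n. S j))"
        then have "w \<in> topspace ?Z" "\<one> \<in> set (?l w)" unfolding one_iff by (auto simp: S_def)
        then show "loop_unit y0 = f0 w" using \<phi>_unit Z(3) by (simp add: f0_def)
      qed
      then show ?thesis using False by simp
    qed
  qed (auto simp: T_def split: if_splits)
  have nf_at: "solves_at f H (fst w) (nf (?l w))" "length (nf (?l w)) \<le> n"
    if "w \<in> topspace ?Z" "\<one> \<in> set (?l w)" for w
  proof -
    show "length (nf (?l w)) \<le> n" using length_nf_less[OF that(2)] by simp
    then show "solves_at f H (fst w) (nf (?l w))"
      using Z[OF that(1)] by (intro at nf_commuting) auto
  qed
  have R_eq: "subseq_prod y0 (f (fst w)) (nf (?l w)) = R w"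
    if w: "w \<in> topspace ?Z" "\<one> \<in> set (?l w)" for w
  proof -
    \<comment> \<open>Declaring the missing factor of full length to be the unit turns
      \<open>R w\<close> into the product over all sublists, which may then be reduced.\<close>
    define f1 where "f1 xs = (if length xs = Suc n then loop_unit y0 else f (fst w) xs)" for xs
    have f1: "f1 ys \<in> loops_at y0 \<and> (\<one> \<in> set ys \<longrightarrow> f1 ys = loop_unit y0)" if "ys \<in> set (subseqs (?l w))" for ys
    proof (cases "length ys = Suc n")
      case False
      have "length ys < Suc n"
        using length_subseqs_le[OF that] False by simp
      moreover have ys: "ys \<in> commuting_lists G"
        using commuting_lists_subseqs[OF Z(3)[OF w(1)] that] .
      ultimately have "solves_at f H (fst w) ys" "f (fst w) ys \<in> loops_at y0"
        using Z(1)[OF w(1)] by (auto intro!: at tuple_family_at[OF f_fam])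
      then show ?thesis using False by (simp add: f1_def solves_at_def)
    qed (simp add: f1_def)
    have proper: "proper_subseq_prod y0 f1 (?l w) = R w"
      unfolding R_def by (intro proper_subseq_prod_cong) (auto simp: f1_def dest: length_proper_subseqs)
    have R_at: "R w \<in> loops_at y0" by (rule loop_familyD(3)[OF R_fam w(1)])
    have "length ys \<le> n" if "ys \<in> set (subseqs (nf (?l w)))" for ys
      using length_subseqs_le[OF that] nf_at(2)[OF w] by linarith
    then have "f (fst w) ys = f1 ys" if "ys \<in> set (subseqs (nf (?l w)))" for ys
      using that by (force simp: f1_def)
    then have "subseq_prod y0 (f (fst w)) (nf (?l w)) = subseq_prod y0 f1 (nf (?l w))"
      by (rule subseq_prod_cong)
    also have "\<dots> = subseq_prod y0 f1 (?l w)"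
      unfolding nf_def using f1 by (intro subseq_prod_filter) auto
    also have "\<dots> = R w"
      unfolding subseq_prod_eq_mult proper using R_at by (simp add: f1_def loop_mult_unit_left)
    finally show ?thesis .
  qed
  have H0_P0: "H (fst w) (nf (?l w)) s = K1 w"
    if "w \<in> topspace ?Z" "\<one> \<in> set (?l w)" "fst w \<in> P0" "0 \<le> s" for w s
    using nf_at(1)[OF that(1,2)] that(3,4) K_nf[OF Z(1,3), OF that(1,1)]
    by (simp add: solves_at_def K1_def)
  have H0_fam: "loop_family (prod_topology (subtopology ?Z T) ?T0) Y y0 H0"
  \<comment> \<open>The index \<open>Suc n\<close> stands for the piece over \<open>P0\<close>, an
    index \<open>j < Suc n\<close> for the tuples with a unit at place \<open>j\<close>.\<close>
  proof (rule loop_family_pasting[where I = "{..Suc n}" and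
        S = "\<lambda>j. (if j = Suc n then T0 else S j) \<times> {0..}"])
    fix j assume j: "j \<in> {..Suc n}"
    let ?A = "if j = Suc n then T0 else S j"
    have A: "closedin ?Z ?A" "?A \<subseteq> T" "?A \<subseteq> topspace ?Z"
      using j S_closed[of j] T0_closed by (auto simp: T_def S_def T0_def le_less)
    show "closedin (prod_topology (subtopology ?Z T) ?T0) (?A \<times> {0..})"
      using closedin_subset_topspace[OF A(1,2)] closedin_topspace[of ?T0]
      by (auto simp: closedin_prod_Times_iff simp del: closedin_topspace)
    have eq: "subtopology (prod_topology (subtopology ?Z T) ?T0) (?A \<times> {0..}) = prod_topology (subtopology ?Z ?A) ?T0"
    proof -
      have "T \<inter> ?A = ?A" using A(2) by blast
      then show ?thesis by (simp add: subtopology_Times subtopology_subtopology)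
    qed
    show "loop_family (subtopology (prod_topology (subtopology ?Z T) ?T0) (?A \<times> {0..})) Y y0 H0"
      unfolding eq
    proof (cases "j = Suc n")
      case True
      have "continuous_map (prod_topology (subtopology ?Z T0) ?T0) ?Z fst"
        using continuous_map_apply[OF continuous_map_subtopology_ident continuous_map_projections(1)] .
      from loop_family_compose[OF K1_fam this]
      have "loop_family (prod_topology (subtopology ?Z T0) ?T0) Y y0 H0"
        by (rule loop_family_eq) (auto simp: H0_def T0_def)
      then show "loop_family (prod_topology (subtopology ?Z ?A) ?T0) Y y0 H0" using True by simp
    next
      case False
      then have jn: "j < Suc n" using j by auto
      \<comment> \<open>The length of the reduced list jumps within \<open>S j\<close>, so
        continuity cannot be read off from it. Deleting only coordinate \<open>j\<close> gives a
        list of constant length \<open>n\<close>, on which \<open>H\<close> takes the same value by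
        its invariance under \<open>nf\<close>.\<close>
      define js where "js = [0..<j] @ [Suc j..<Suc n]"
      have js: "length js = n" "set js \<subseteq> {..<Suc n}" using jn by (auto simp: js_def)
      have nf_js: "nf (map g js) = nf (lst (Suc n) g)" if "g j = \<one>" for g :: "nat \<Rightarrow> 'a"
      proof -
        have "[0..<j + (Suc n - j)] = [0..<j] @ [j..<j + (Suc n - j)]"
          by (rule upt_add_eq_append) simp
        then have "[0..<Suc n] = [0..<j] @ [j..<Suc n]"
          using jn by (simp del: upt_Suc)
        moreover have "[j..<Suc n] = j # [Suc j..<Suc n]"
          using jn by (rule upt_conv_Cons)
        ultimately show ?thesis
          using that by (simp add: nf_def lst_def js_def del: upt_Suc)
      qed
      let ?W = "prod_topology (subtopology ?Z (S j)) ?T0"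
      have f1: "continuous_map ?W ?Z fst"
        using continuous_map_apply[OF continuous_map_subtopology_ident continuous_map_projections(1)] .
      have sub: "continuous_map ?W (Hom G n) (\<lambda>w. tup (map (snd (fst w)) js))"
        using continuous_map_apply[OF continuous_map_subtuple[OF js(2)] continuous_map_sndI[OF f1]]
        by (simp add: js(1))
      have "continuous_map ?W (prod_topology (prod_topology P (Hom G n)) ?T0)
          (\<lambda>w. ((fst (fst w), tup (map (snd (fst w)) js)), snd w))"
        by (intro continuous_map_pairedI continuous_map_fstI[OF f1] sub cm_intros)
      from loop_family_compose[OF H_fam[OF order_refl, unfolded homotopy_family_def] this]
      have "loop_family ?W Y y0 (\<lambda>w. H (fst (fst w)) (lst n (tup (map (snd (fst w)) js))) (snd w))"
        by simp
      then have "loop_family ?W Y y0 H0"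
      proof (rule loop_family_eq)
        fix w assume w: "w \<in> topspace ?W"
        let ?xs = "map (snd (fst w)) js"
        have w': "fst w \<in> topspace ?Z" "snd (fst w) j = \<one>" "0 \<le> snd w" using w by (auto simp: S_def)
        have one: "\<one> \<in> set (?l (fst w))" unfolding one_iff using w'(2) jn by blast
        have lst: "lst n (tup ?xs) = ?xs" using lst_tup[of ?xs] js(1) by simp
        have "?xs \<in> commuting_lists G"
          using js(2) by (intro commuting_lists_subset[OF Z(3)[OF w'(1)]]) (auto simp: set_lst)
        then have "H (fst (fst w)) ?xs (snd w) = H (fst (fst w)) (nf ?xs) (snd w)"
          using at[OF Z(1)[OF w'(1)], of ?xs] js(1) w'(3) by (simp add: solves_at_def)
        also have "\<dots> = H (fst (fst w)) (nf (?l (fst w))) (snd w)"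
          unfolding nf_js[of "snd (fst w)", OF w'(2)] ..
        also have "\<dots> = H0 w"
          using H0_P0[OF w'(1) one _ w'(3)] by (simp add: H0_def)
        finally show "H (fst (fst w)) (lst n (tup ?xs)) (snd w) = H0 w" unfolding lst .
      qed
      then show "loop_family (prod_topology (subtopology ?Z ?A) ?T0) Y y0 H0" using False by simp
    qed
  next
    show "topspace (prod_topology (subtopology ?Z T) ?T0) \<subseteq> (\<Union>j\<in>{..Suc n}. (if j = Suc n then T0 else S j) \<times> {0..})"
    proof
      fix x assume "x \<in> topspace (prod_topology (subtopology ?Z T) ?T0)"
      then have x: "fst x \<in> T" "0 \<le> snd x" by auto
      show "x \<in> (\<Union>j\<in>{..Suc n}. (if j = Suc n then T0 else S j) \<times> {0..})"
      proof (cases "fst x \<in> T0")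
        case True
        then show ?thesis using x by (intro UN_I[of "Suc n"]) (auto simp: mem_Times_iff)
      next
        case False
        then obtain j where "j < Suc n" "fst x \<in> S j" using x(1) unfolding T_def by blast
        then show ?thesis using x by (intro UN_I[of j]) (auto simp: mem_Times_iff)
      qed
    qed
  qed simp
  have H0_init: "H0 (w, 0) = K1 w" if "w \<in> T" for w
  proof (cases "fst w \<in> P0")
    case False
    then have w: "w \<in> topspace ?Z" "\<one> \<in> set (?l w)" using that by (auto simp: T_iff)
    then show ?thesis
      using False nf_at(1)[OF w] K_nf[OF Z(1,3), OF w(1,1)] by (simp add: H0_def solves_at_def K1_def)
  qed (simp add: H0_def)
  have H0_late: "H0 (w, s) = loop_mult (f0 w) (R w)" if "w \<in> T" "3 * real n + 1 \<le> s" for w s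
  proof (cases "fst w \<in> P0")
    case True
    have w: "w \<in> topspace ?Z" using that by (simp add: T_iff)
    have "f (fst w) ys = \<phi> (fst w) ys" if "ys \<in> set (tl (subseqs (?l w)))" for ys
    proof -
      have "ys \<in> commuting_lists G"
        using that tl_subseqs_subset by (intro commuting_lists_subseqs[OF Z(3)[OF w]]) blast
      moreover have "length ys \<le> n" using length_proper_subseqs[OF that] by simp
      ultimately show ?thesis using at[OF Z(1)[OF w]] True by (simp add: solves_at_def)
    qed
    then have "R w = proper_subseq_prod y0 (\<phi> (fst w)) (?l w)"
      unfolding R_def by (intro proper_subseq_prod_cong)
    then show ?thesis
      using True K_eq_prod[OF True Z(3)[OF w]] by (simp add: H0_def f0_def K1_def subseq_prod_eq_mult)
  next
    case False
    then have w: "w \<in> topspace ?Z" "\<one> \<in> set (?l w)" using that by (auto simp: T_iff)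
    have "3 * real (length (nf (?l w))) + 1 \<le> s" using nf_at(2)[OF w] that(2) by linarith
    then have "H (fst w) (nf (?l w)) s = R w"
      using nf_at(1)[OF w] R_eq[OF w] by (simp add: solves_at_def)
    then show ?thesis
      using False loop_mult_unit_left[OF loop_familyD(3)[OF R_fam w(1)]] by (simp add: H0_def f0_def)
  qed

  \<comment> \<open>Extension from \<open>T\<close> and the new partial solution\<close>
  have N: "1 \<le> 3 * real n + 1" by simp
  obtain f1 H1 where f1: "loop_family ?Z Y y0 f1" "\<And>w. w \<in> T \<Longrightarrow> f1 w = f0 w"
    and H1: "loop_family (prod_topology ?Z ?T0) Y y0 H1" "\<And>w. w \<in> topspace ?Z \<Longrightarrow> H1 (w, 0) = K1 w"
      "\<And>w s. \<lbrakk>w \<in> T; 0 \<le> s\<rbrakk> \<Longrightarrow> H1 (w, s) = H0 (w, s)"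
      "\<And>w s. \<lbrakk>w \<in> topspace ?Z; 3 * real n + 1 + 3 \<le> s\<rbrakk> \<Longrightarrow> H1 (w, s) = loop_mult (f1 w) (R w)"
    using loop_family_factor_extension[OF T_closed k_cont k0 kT u_cont u01 uT ku N K1_fam R_fam f0_fam
        H0_fam H0_init H0_late] by blast
  define f' where "f' p xs = (if length xs = Suc n then f1 (p, tup xs) else f p xs)" for p xs
  define H' where "H' p xs s = (if length xs = Suc n then H1 ((p, tup xs), s) else H p xs s)" for p xs s
  have old: "f' p xs = f p xs" "H' p xs = H p xs" if "length xs \<le> n" for p xs
    using that by (auto simp: f'_def H'_def)
  have "partial_solution (Suc n) f' H'"
    unfolding partial_solution_def
  proof (intro conjI allI impI ballI)
    fix m assume m: "m \<le> Suc n"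
    show "tuple_family G P Y y0 m f'"
    proof (cases "m = Suc n")
      case True
      show ?thesis
        unfolding True tuple_family_def
        by (rule loop_family_eq[OF f1(1)]) (auto simp: f'_def lst_imp_tup)
    next
      case False
      then show ?thesis using m f_fam[of m] by (auto simp: tuple_family_def f'_def)
    qed
    show "homotopy_family m H'"
    proof (cases "m = Suc n")
      case True
      show ?thesis
        unfolding True homotopy_family_def
        by (rule loop_family_eq[OF H1(1)]) (auto simp: H'_def lst_imp_tup)
    next
      case False
      then show ?thesis using m H_fam[of m] by (auto simp: homotopy_family_def H'_def)
    qed
  next
    fix p xs assume p: "p \<in> topspace P" and xs: "xs \<in> commuting_lists G" and len: "length xs \<le> Suc n"
    show "solves_at f' H' p xs"
    proof (cases "length xs = Suc n")
      case False
      then have le: "length xs \<le> n" using len by simp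
      have "length ys \<le> n" if "ys \<in> set (subseqs xs)" for ys
        using length_subseqs_le[OF that] le by linarith
      then have "subseq_prod y0 (f' p) xs = subseq_prod y0 (f p) xs"
        by (intro subseq_prod_cong old)
      then show ?thesis
        using at[OF p xs le] old[OF le] old[OF le_trans[OF length_nf_le le]] old[of "[]"]
        by (simp add: solves_at_def)
    next
      case True
      define w where "w = (p, tup xs)"
      have w: "w \<in> topspace ?Z" using p tup_topspace_Hom[OF xs] True by (simp add: w_def)
      have lw: "?l w = xs" "fst w = p" using lst_tup[of xs] True by (auto simp: w_def)
      have f'w: "f' p xs = f1 w" and H'w: "H' p xs s = H1 (w, s)" for s
        using True by (auto simp: f'_def H'_def w_def)
      have "xs \<noteq> []" using True by auto
      moreover have unit: "f' p xs = loop_unit y0" if "\<one> \<in> set xs"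
        using f1(2)[of w] w lw that \<phi>_unit[of p xs] xs by (simp add: f'w T_iff f0_def)
      moreover have "f' p xs = \<phi> p xs" if "p \<in> P0"
        using f1(2)[of w] w lw that by (simp add: f'w T_iff f0_def)
      moreover have "H' p (nf xs) s = H' p xs s" if s: "0 \<le> s" for s
      proof (cases "\<one> \<in> set xs")
        case False
        then show ?thesis by (simp add: nf_eq_self)
      next
        case one: True
        have "H' p xs s = H0 (w, s)" using H1(3)[of w s] w lw one s by (simp add: H'w T_iff)
        also have "\<dots> = H p (nf xs) s" using H0_P0[of w s] w lw one s by (auto simp: H0_def)
        also have "\<dots> = H' p (nf xs) s" using old(2) nf_at(2)[OF w] one lw by simp
        finally show ?thesis ..
      qed
      moreover have "H' p xs 0 = K p xs" using H1(2)[OF w] lw by (simp add: H'w K1_def)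
      moreover have "H' p xs s = K p xs" if "p \<in> P0" "0 \<le> s" for s
        using H1(3)[of w s] w lw that by (simp add: H'w T_iff H0_def K1_def)
      moreover have "H' p xs s = subseq_prod y0 (f' p) xs" if s: "3 * real (length xs) + 1 \<le> s" for s
      proof -
        have "H' p xs s = loop_mult (f' p xs) (R w)"
          using H1(4)[OF w, of s] s True by (simp add: H'w f'w)
        moreover have "R w = proper_subseq_prod y0 (f' p) xs"
          unfolding R_def lw using True
          by (intro proper_subseq_prod_cong) (auto simp: f'_def dest: length_proper_subseqs)
        ultimately show ?thesis by (simp add: subseq_prod_eq_mult)
      qed
      ultimately show ?thesis by (simp add: solves_at_def)
    qed
  qed
  then show ?thesis using old by blast
qed

theorem solution_exists:
  obtains f H where "\<And>n. tuple_family G P Y y0 n f" "\<And>n. homotopy_family n H"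
    "\<And>p xs. \<lbrakk>p \<in> topspace P; xs \<in> commuting_lists G\<rbrakk> \<Longrightarrow> solves_at f H p xs"
proof -
  have "\<exists>F. \<forall>n. partial_solution n (fst (F n)) (snd (F n)) \<and>
    (\<forall>p xs. length xs \<le> n \<longrightarrow> fst (F (Suc n)) p xs = fst (F n) p xs \<and> snd (F (Suc n)) p xs = snd (F n) p xs)"
  proof (rule dependent_nat_choice)
    show "\<exists>x. partial_solution 0 (fst x) (snd x)" using partial_solution_0 by auto
    show "\<exists>y. partial_solution (Suc n) (fst y) (snd y) \<and>
        (\<forall>p xs. length xs \<le> n \<longrightarrow> fst y p xs = fst x p xs \<and> snd y p xs = snd x p xs)"
      if "partial_solution n (fst x) (snd x)" for x n
      using partial_solution_Suc[OF that] by auto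
  qed
  then obtain F where F: "\<And>n. partial_solution n (fst (F n)) (snd (F n))"
    and next_eq: "\<And>n p xs. length xs \<le> n \<Longrightarrow> fst (F (Suc n)) p xs = fst (F n) p xs \<and> snd (F (Suc n)) p xs = snd (F n) p xs"
    by blast
  \<comment> \<open>The value at a list is settled at the stage of its own length and never changes
    afterwards.\<close>
  define f where "f p xs = fst (F (length xs)) p xs" for p xs
  define H where "H p xs = snd (F (length xs)) p xs" for p xs
  have stable: "fst (F n) p xs = f p xs \<and> snd (F n) p xs = H p xs" if "length xs \<le> n" for n p xs
    using that
  proof (induction n rule: dec_induct)
    case (step n)
    then show ?case using next_eq[of xs n p] by simp
  qed (simp add: f_def H_def)
  show thesis
  proof (rule that)
    show "tuple_family G P Y y0 n f" for n
      using F[of n] by (simp add: partial_solution_def tuple_family_def f_def)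
    show "homotopy_family n H" for n
      using F[of n] by (simp add: partial_solution_def homotopy_family_def H_def)
    fix p xs assume p: "p \<in> topspace P" and xs: "xs \<in> commuting_lists G"
    let ?n = "length xs"
    have "solves_at (fst (F ?n)) (snd (F ?n)) p xs"
      using F[of ?n] p xs by (auto simp: partial_solution_def)
    moreover have "subseq_prod y0 (fst (F ?n) p) xs = subseq_prod y0 (f p) xs"
    proof (rule subseq_prod_cong)
      fix ys assume "ys \<in> set (subseqs xs)"
      then have "length ys \<le> ?n" by (rule length_subseqs_le)
      then show "fst (F ?n) p ys = f p ys" using stable by blast
    qed
    ultimately show "solves_at f H p xs"
      using stable[of xs ?n] stable[OF length_nf_le[of xs]] stable[of "[]" 0] by (simp add: solves_at_def)
  qed
qed

end

section \<open>Presenting the two suspensions by tuples\<close>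

abbreviation unit_interval :: "real topology" where
  "unit_interval \<equiv> top_of_set {0..1}"

lemma locally_compact_unit_interval: "locally_compact_space unit_interval"
  by (intro compact_imp_locally_compact_space disjI1 Hausdorff_space_subtopology)
    (auto simp: compact_space_subtopology)

lemma Hausdorff_unit_interval: "Hausdorff_space unit_interval"
  by (simp add: Hausdorff_space_subtopology)

text \<open>A product of a quotient map with the identity of a locally compact Hausdorff space is
  again a quotient map. The parameter is there so that homotopies can be lifted like maps.\<close>

lemma quotient_map_param_lift:
  assumes q: "quotient_map X Z q" and P: "locally_compact_space P" "Hausdorff_space P"
    and f: "continuous_map (prod_topology P X) Y f"
    and eq: "\<And>p x y. \<lbrakk>p \<in> topspace P; x \<in> topspace X; y \<in> topspace X; q x = q y\<rbrakk> \<Longrightarrow> f (p, x) = f (p, y)"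
  obtains g where "continuous_map (prod_topology P Z) Y g"
    "\<And>p x. \<lbrakk>p \<in> topspace P; x \<in> topspace X\<rbrakk> \<Longrightarrow> g (p, q x) = f (p, x)"
proof -
  have "quotient_map (prod_topology P X) (prod_topology P Z) (\<lambda>(p, x). (p, q x))"
    by (rule quotient_map_prod_right[OF P(1) _ q]) (simp add: P(2))
  then obtain g where g: "continuous_map (prod_topology P Z) Y g"
    "\<And>w. w \<in> topspace (prod_topology P X) \<Longrightarrow> g ((\<lambda>(p, x). (p, q x)) w) = f w"
    by (rule quotient_map_lift_exists[OF _ f]) (use eq in auto)
  then show thesis using that[OF g(1)] g(2) by auto
qed

text \<open>The slices over the summands are open and cover the product, so continuity may be tested
  on each.\<close>

lemma continuous_map_prod_sum_topology:
  assumes "\<And>i. i \<in> J \<Longrightarrow> continuous_map (prod_topology P (X i)) Y (\<lambda>w. f (fst w, i, snd w))"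
  shows "continuous_map (prod_topology P (sum_topology X J)) Y f"
proof (rule pasting_lemma[where I = J and T = "\<lambda>i. topspace P \<times> ({i} \<times> topspace (X i))" and f = "\<lambda>_. f"])
  fix i assume i: "i \<in> J"
  let ?S = "sum_topology X J"
  have slice: "openin ?S ({i} \<times> V)" if V: "openin (X i) V" for V
    using V openin_subset[OF V] i by (auto simp: openin_sum_topology Collect_conj_eq)
  then show "openin (prod_topology P ?S) (topspace P \<times> ({i} \<times> topspace (X i)))"
    by (simp add: openin_prod_Times_iff)
  let ?W = "subtopology (prod_topology P ?S) (topspace P \<times> ({i} \<times> topspace (X i)))"
  have "continuous_map (subtopology ?S ({i} \<times> topspace (X i))) (X i) snd"
    unfolding continuous_map_def
  proof (intro conjI allI impI)
    fix V assume V: "openin (X i) V"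
    have "openin ?S ({i} \<times> V)"
      by (rule slice[OF V])
    moreover have "{x \<in> topspace (subtopology ?S ({i} \<times> topspace (X i))). snd x \<in> V}
        = {i} \<times> V \<inter> {i} \<times> topspace (X i)"
      using i openin_subset[OF V] by auto
    ultimately show "openin (subtopology ?S ({i} \<times> topspace (X i)))
        {x \<in> topspace (subtopology ?S ({i} \<times> topspace (X i))). snd x \<in> V}"
      by (auto simp: openin_subtopology)
  qed auto
  then have "continuous_map (prod_topology P (subtopology ?S ({i} \<times> topspace (X i)))) (X i) (\<lambda>w. snd (snd w))"
    by (rule continuous_map_apply) (intro cm_intros)
  then have "continuous_map ?W (prod_topology P (X i)) (\<lambda>w. (fst w, snd (snd w)))"
    by (intro continuous_map_pairedI cm_intros) (simp add: prod_topology_subtopology)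
  from continuous_map_apply[OF assms[OF i] this]
  have "continuous_map ?W Y (\<lambda>w. f (fst w, i, snd (snd w)))" by simp
  then show "continuous_map ?W Y f"
    by (rule continuous_map_eq) auto
qed auto

definition collapse_class :: "'a topology \<Rightarrow> 'a set \<Rightarrow> 'a \<Rightarrow> 'a set" where
  "collapse_class X A x = {(x, y) \<in> topspace X \<times> topspace X. x = y \<or> x \<in> A \<and> y \<in> A} `` {x}"

lemma quotient_map_collapse_class: "quotient_map X (fst (collapse X A)) (collapse_class X A)"
  unfolding collapse_class_def[abs_def] collapse_def fst_conv
  by (rule quotient_map_quotient_topology[OF equiv_collapse])

lemma collapse_class_eq_iff:
  "x \<in> topspace X \<Longrightarrow> y \<in> topspace X \<Longrightarrow>
    collapse_class X A x = collapse_class X A y \<longleftrightarrow> x = y \<or> x \<in> A \<and> y \<in> A"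
  unfolding collapse_class_def by (auto simp: set_eq_iff)

lemma collapse_class_base: "A \<subseteq> topspace X \<Longrightarrow> x \<in> A \<Longrightarrow> collapse_class X A x = snd (collapse X A)"
  by (auto simp: collapse_class_def collapse_def)

lemma topspace_collapse: "topspace (fst (collapse X A)) = collapse_class X A ` topspace X"
  using quotient_imp_surjective_map[OF quotient_map_collapse_class] by metis

context commuting_deformation
begin

subsection \<open>The suspension of \<open>Comm(G)\<close>\<close>

definition assoc_class :: "nat \<times> (nat \<Rightarrow> 'a) \<Rightarrow> (nat \<times> (nat \<Rightarrow> 'a)) set" where
  "assoc_class x = Assoc_rel G `` {x}"

lemma nf_drop_unit:
  assumes "drop_unit G x y"
  shows "nf (lst (fst x) (snd x)) = nf (lst (fst y) (snd y))"
  using assms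
proof cases
  case (1 g n i)
  have "[0..<i + (Suc n - i)] = [0..<i] @ [i..<i + (Suc n - i)]"
    by (rule upt_add_eq_append) simp
  then have "[0..<Suc n] = [0..<i] @ [i..<Suc n]" using 1(4) by (simp del: upt_Suc)
  moreover have "[i..<Suc n] = i # map Suc [i..<n]"
    using 1(4) by (simp add: upt_conv_Cons map_Suc_upt del: upt_Suc)
  moreover have "[0..<i + (n - i)] = [0..<i] @ [i..<i + (n - i)]"
    by (rule upt_add_eq_append) simp
  then have "[0..<n] = [0..<i] @ [i..<n]" using 1(4) by simp
  ultimately show ?thesis
    using 1 by (simp add: lst_def nf_def o_def del: upt_Suc) (auto intro!: arg_cong2[of _ _ _ _ append] filter_cong map_cong)
qed

lemma nf_Assoc_rel: "(x, y) \<in> Assoc_rel G \<Longrightarrow> nf (lst (fst x) (snd x)) = nf (lst (fst y) (snd y))"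
proof -
  assume "(x, y) \<in> Assoc_rel G"
  then have "equivclp (drop_unit G) x y" by (simp add: Assoc_rel_def)
  then show ?thesis
    by (induction rule: equivclp_induct) (auto dest: nf_drop_unit)
qed

lemma tup_in_tuple_space: "set xs \<subseteq> carrier G \<Longrightarrow> tup xs \<in> topspace (tuple_space G (length xs))"
  by (auto simp: topspace_tuple_space tup_def)

lemma tup_in_all_tuples:
  "set xs \<subseteq> carrier G \<Longrightarrow> (length xs, tup xs) \<in> topspace (all_tuples G)"
  by (simp add: all_tuples_def tup_in_tuple_space)

text \<open>Units are deleted one at a time. Together with \<open>nf_Assoc_rel\<close> this
  identifies the classes with the reduced lists.\<close>

lemma assoc_class_nf:
  assumes "set xs \<subseteq> carrier G"
  shows "((length xs, tup xs), (length (nf xs), tup (nf xs))) \<in> Assoc_rel G"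
  using assms
proof (induction "length xs" arbitrary: xs rule: less_induct)
  case less
  show ?case
  proof (cases "\<one> \<in> set xs")
    case False
    then show ?thesis
      using tup_in_all_tuples[OF less.prems] by (simp add: nf_eq_self Assoc_rel_def)
  next
    case True
    then obtain ys zs where xs: "xs = ys @ \<one> # zs" by (meson split_list)
    let ?n = "length (ys @ zs)" and ?i = "length ys"
    have len: "length xs = Suc ?n" by (simp add: xs)
    have "drop_unit G (Suc ?n, tup xs) (?n, \<lambda>j\<in>{..<?n}. if j < ?i then tup xs j else tup xs (Suc j))"
      using tup_in_tuple_space[OF less.prems] unfolding len
      by (rule drop_unit.intros) (auto simp: tup_def xs nth_append)
    moreover have "(\<lambda>j\<in>{..<?n}. if j < ?i then tup xs j else tup xs (Suc j)) = tup (ys @ zs)"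
      by (auto simp: tup_def xs nth_append fun_eq_iff restrict_def Suc_diff_le)
    ultimately have "equivclp (drop_unit G) (length xs, tup xs) (?n, tup (ys @ zs))"
      unfolding len by (auto intro: r_into_equivclp)
    then have "((length xs, tup xs), (?n, tup (ys @ zs))) \<in> Assoc_rel G"
      using tup_in_all_tuples[OF less.prems] tup_in_all_tuples[of "ys @ zs"] less.prems
      by (auto simp: Assoc_rel_def xs)
    moreover have "((?n, tup (ys @ zs)), (length (nf (ys @ zs)), tup (nf (ys @ zs)))) \<in> Assoc_rel G"
      using less.prems by (intro less.hyps) (auto simp: xs)
    moreover have "nf (ys @ zs) = nf xs" by (simp add: nf_def xs)
    ultimately show ?thesis
      using equiv_Assoc_rel[of G] by (metis equivE transE)
  qed
qed

lemma all_commuting_tuples_eq: "all_commuting_tuples G = topspace (sum_topology (Hom G) UNIV)"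
  by (auto simp: all_commuting_tuples_def)

lemma sum_Hom: "subtopology (all_tuples G) (all_commuting_tuples G) = sum_topology (Hom G) UNIV"
proof -
  have "subtopology (tuple_space G n) (topspace (Hom G n)) = Hom G n" for n
    unfolding Hom_def by (metis inf_commute subtopology_restrict topspace_subtopology)
  then show ?thesis
    unfolding all_tuples_def all_commuting_tuples_def subtopology_sum_topology by simp
qed

lemma all_commuting_tuples_subset: "all_commuting_tuples G \<subseteq> topspace (all_tuples G)"
  by (auto simp: all_commuting_tuples_def all_tuples_def Hom_def)

lemma Assoc_rel_saturated:
  assumes "(x, y) \<in> Assoc_rel G" "x \<in> all_commuting_tuples G"
  shows "y \<in> all_commuting_tuples G"
proof -
  have "equivclp (drop_unit G) x y" using assms(1) by (simp add: Assoc_rel_def)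
  then show ?thesis
    using assms(2) by (induction rule: equivclp_induct) (auto dest: drop_unit_commuting[OF monoid_axioms])
qed

text \<open>\<open>Comm\<close> carries the subspace topology of \<open>Assoc\<close>, whereas maps
  out of it are to be built from tuples. The commuting tuples form a closed saturated set, so their
  image is closed, and a quotient map restricts to a quotient map over a closed set.\<close>

lemma quotient_map_Comm: "quotient_map (sum_topology (Hom G) UNIV) (fst (Comm G)) assoc_class"
proof -
  let ?A = "all_tuples G" and ?C = "all_commuting_tuples G"
  let ?V = "?C // Assoc_rel G"
  have q: "quotient_map ?A (Assoc G) assoc_class"
    unfolding Assoc_def assoc_class_def[abs_def] by (rule quotient_map_quotient_topology[OF equiv_Assoc_rel])
  have pre: "{x \<in> topspace ?A. assoc_class x \<in> ?V} = ?C"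
  proof (intro equalityI subsetI)
    fix x assume x: "x \<in> {x \<in> topspace ?A. assoc_class x \<in> ?V}"
    then obtain y where y: "y \<in> ?C" "assoc_class x = Assoc_rel G `` {y}" by (auto elim: quotientE)
    have "x \<in> assoc_class x" using x equiv_class_self[OF equiv_Assoc_rel[of G]] by (auto simp: assoc_class_def)
    then show "x \<in> ?C" using y Assoc_rel_saturated by auto
  next
    fix x assume "x \<in> ?C"
    then show "x \<in> {x \<in> topspace ?A. assoc_class x \<in> ?V}"
      using all_commuting_tuples_subset by (auto simp: assoc_class_def intro: quotientI)
  qed
  have "closedin ?A ?C"
    unfolding all_tuples_def all_commuting_tuples_def
    using closedin_Hom by (simp add: closedin_disjoint_union)
  moreover have "?V \<subseteq> topspace (Assoc G)"
    unfolding Assoc_def topspace_quotient_topology[OF equiv_Assoc_rel]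
    using all_commuting_tuples_subset by (auto simp: quotient_def)
  moreover have "U \<subseteq> topspace (Assoc G) \<Longrightarrow>
      closedin ?A {x \<in> topspace ?A. assoc_class x \<in> U} \<longleftrightarrow> closedin (Assoc G) U" for U
    using q unfolding quotient_map_closedin by blast
  from this[of ?V] have "?V \<subseteq> topspace (Assoc G) \<Longrightarrow> closedin ?A ?C \<longleftrightarrow> closedin (Assoc G) ?V"
    unfolding pre .
  ultimately have "closedin (Assoc G) ?V" by blast
  then have "quotient_map (subtopology ?A ?C) (subtopology (Assoc G) ?V) assoc_class"
    by (intro quotient_map_restriction[OF q pre]) simp
  then show ?thesis by (simp add: sum_Hom Comm_def)
qed

definition suspension_base :: "(((nat \<times> (nat \<Rightarrow> 'a)) set) \<times> real) set" where
  "suspension_base = topspace (fst (Comm G)) \<times> {0, 1} \<union> {snd (Comm G)} \<times> {0..1}"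

definition comm_point :: "'a list \<Rightarrow> real \<Rightarrow> (((nat \<times> (nat \<Rightarrow> 'a)) set) \<times> real) set" where
  "comm_point xs t = collapse_class (prod_topology (fst (Comm G)) unit_interval) suspension_base
    (assoc_class (length xs, tup xs), t)"

lemma suspension_Comm: "suspension (Comm G) = collapse (prod_topology (fst (Comm G)) unit_interval) suspension_base"
  by (simp add: suspension_def suspension_base_def case_prod_unfold)

lemma tup_in_sum_Hom: "xs \<in> commuting_lists G \<Longrightarrow> (length xs, tup xs) \<in> topspace (sum_topology (Hom G) UNIV)"
  by (simp add: tup_topspace_Hom)

lemma assoc_class_eqI:
  assumes "xs \<in> commuting_lists G" "ys \<in> commuting_lists G" "nf xs = nf ys"
  shows "assoc_class (length xs, tup xs) = assoc_class (length ys, tup ys)"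
proof -
  have *: "assoc_class (length xs, tup xs) = assoc_class (length (nf xs), tup (nf xs))"
    if "xs \<in> commuting_lists G" for xs
    unfolding assoc_class_def using that
    by (intro equiv_class_eq[OF equiv_Assoc_rel] assoc_class_nf) (simp add: commuting_lists_def)
  show ?thesis using *[OF assms(1)] *[OF assms(2)] assms(3) by simp
qed

lemma nf_eq_if_assoc_class_eq:
  assumes "x \<in> all_commuting_tuples G" "y \<in> all_commuting_tuples G" "assoc_class x = assoc_class y"
  shows "nf (lst (fst x) (snd x)) = nf (lst (fst y) (snd y))"
proof -
  have "x \<in> topspace (all_tuples G)" "y \<in> topspace (all_tuples G)"
    using assms(1,2) all_commuting_tuples_subset by auto
  then have "(x, y) \<in> Assoc_rel G"
    using assms(3) eq_equiv_class_iff[OF equiv_Assoc_rel[of G]] by (simp add: assoc_class_def)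
  then show ?thesis by (rule nf_Assoc_rel)
qed

lemma Nil_commuting: "[] \<in> commuting_lists G" and one_commuting: "[\<one>] \<in> commuting_lists G"
  by (auto simp: commuting_lists_def)

lemma snd_Comm: "snd (Comm G) = assoc_class (length [\<one>], tup [\<one>])"
proof -
  have "(\<lambda>j\<in>{..<1}. \<one>) = tup [\<one>]" by (auto simp: tup_def fun_eq_iff restrict_def)
  then show ?thesis by (simp add: Comm_def assoc_class_def)
qed

lemma assoc_class_in_Comm: "xs \<in> commuting_lists G \<Longrightarrow> assoc_class (length xs, tup xs) \<in> topspace (fst (Comm G))"
  using quotient_imp_surjective_map[OF quotient_map_Comm] tup_in_sum_Hom by blast

lemma suspension_base_subset: "suspension_base \<subseteq> topspace (prod_topology (fst (Comm G)) unit_interval)"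
  using assoc_class_in_Comm[OF one_commuting] by (auto simp: suspension_base_def snd_Comm)

lemma nf_eq_Nil_iff: "nf xs = [] \<longleftrightarrow> set xs \<subseteq> {\<one>}"
  by (auto simp: nf_def filter_empty_conv)

lemma comm_point_nf: "xs \<in> commuting_lists G \<Longrightarrow> comm_point (nf xs) t = comm_point xs t"
  using assoc_class_eqI[of "nf xs" xs] by (simp add: comm_point_def nf_commuting)

lemma comm_point_base:
  assumes "xs \<in> commuting_lists G" "t \<in> {0..1}" "nf xs = [] \<or> t = 0 \<or> t = 1"
  shows "comm_point xs t = snd (suspension (Comm G))"
  unfolding comm_point_def suspension_Comm
proof (rule collapse_class_base[OF suspension_base_subset])
  have "assoc_class (length xs, tup xs) = snd (Comm G)" if "nf xs = []"
    unfolding snd_Comm using that by (intro assoc_class_eqI assms(1) one_commuting) (simp add: nf_def)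
  then show "(assoc_class (length xs, tup xs), t) \<in> suspension_base"
    using assms assoc_class_in_Comm by (auto simp: suspension_base_def)
qed

lemma quotient_map_comm_point:
  "quotient_map (prod_topology (sum_topology (Hom G) UNIV) unit_interval) (fst (suspension (Comm G)))
    (\<lambda>x. comm_point (lst (fst (fst x)) (snd (fst x))) (snd x))"
proof -
  let ?S = "sum_topology (Hom G) UNIV"
  have "quotient_map (prod_topology ?S unit_interval) (prod_topology (fst (Comm G)) unit_interval)
      (\<lambda>(x, t). (assoc_class x, t))"
    by (rule quotient_map_prod_left[OF locally_compact_unit_interval _ quotient_map_Comm])
      (simp add: Hausdorff_unit_interval)
  from quotient_map_compose[OF this quotient_map_collapse_class]
  have "quotient_map (prod_topology ?S unit_interval) (fst (suspension (Comm G)))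
      (collapse_class (prod_topology (fst (Comm G)) unit_interval) suspension_base \<circ> (\<lambda>(x, t). (assoc_class x, t)))"
    by (simp add: suspension_Comm)
  then show ?thesis
    by (rule quotient_map_eq) (auto simp: comm_point_def lst_imp_tup)
qed

lemma continuous_comm_point:
  "continuous_map (prod_topology (Hom G n) unit_interval) (fst (suspension (Comm G)))
    (\<lambda>x. comm_point (lst n (fst x)) (snd x))"
proof -
  let ?S = "sum_topology (Hom G) UNIV"
  have "continuous_map (prod_topology (Hom G n) unit_interval) (prod_topology ?S unit_interval)
      (\<lambda>x. ((n, fst x), snd x))"
    by (intro continuous_map_pairedI continuous_map_apply[OF continuous_map_component_injection] cm_intros) simp
  from continuous_map_apply[OF quotient_imp_continuous_map[OF quotient_map_comm_point] this]
  show ?thesis by simp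
qed

lemma topspace_suspension_Comm:
  assumes "y \<in> topspace (fst (suspension (Comm G)))"
  obtains xs t where "xs \<in> commuting_lists G" "t \<in> {0..1}" "y = comm_point xs t"
proof -
  obtain x where "x \<in> topspace (prod_topology (sum_topology (Hom G) UNIV) unit_interval)"
    "y = comm_point (lst (fst (fst x)) (snd (fst x))) (snd x)"
    using assms quotient_imp_surjective_map[OF quotient_map_comm_point] by blast
  then show thesis
    by (intro that[of "lst (fst (fst x)) (snd (fst x))" "snd x"]) (auto simp: topspace_Hom_lst)
qed

text \<open>Two presentations of a point of the suspension either have the same reduced list and
  height or both lie in the collapsed part; the two compatibility hypotheses cover exactly these
  cases.\<close>

lemma comm_point_lift:
  fixes F :: "'p \<Rightarrow> 'a list \<Rightarrow> real \<Rightarrow> 'y"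
  assumes P: "locally_compact_space P" "Hausdorff_space P"
    and F: "\<And>n. continuous_map (prod_topology (prod_topology P (Hom G n)) unit_interval) Y
      (\<lambda>w. F (fst (fst w)) (lst n (snd (fst w))) (snd w))"
    and nf: "\<And>p xs t. \<lbrakk>p \<in> topspace P; xs \<in> commuting_lists G; t \<in> {0..1}\<rbrakk> \<Longrightarrow> F p (nf xs) t = F p xs t"
    and base: "\<And>p xs t. \<lbrakk>p \<in> topspace P; xs \<in> commuting_lists G; t \<in> {0..1}; nf xs = [] \<or> t = 0 \<or> t = 1\<rbrakk> \<Longrightarrow>
      F p xs t = y0"
  obtains g where "continuous_map (prod_topology P (fst (suspension (Comm G)))) Y g"
    "\<And>p xs t. \<lbrakk>p \<in> topspace P; xs \<in> commuting_lists G; t \<in> {0..1}\<rbrakk> \<Longrightarrow> g (p, comm_point xs t) = F p xs t"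
proof -
  let ?S = "sum_topology (Hom G) UNIV" and ?I = unit_interval
  let ?f = "\<lambda>w. F (fst w) (lst (fst (fst (snd w))) (snd (fst (snd w)))) (snd (snd w))"
  \<comment> \<open>With the interval moved to the parameter side, the sum over all lengths can be
    treated summand by summand.\<close>
  have "continuous_map (prod_topology (prod_topology P ?I) ?S) Y
      (\<lambda>w. F (fst (fst w)) (lst (fst (snd w)) (snd (snd w))) (snd (fst w)))"
  proof (rule continuous_map_prod_sum_topology)
    fix n
    have "continuous_map (prod_topology (prod_topology P ?I) (Hom G n)) (prod_topology (prod_topology P (Hom G n)) ?I)
        (\<lambda>w. ((fst (fst w), snd w), snd (fst w)))"
      by (intro cm_intros)
    from continuous_map_apply[OF F[of n] this]
    show "continuous_map (prod_topology (prod_topology P ?I) (Hom G n)) Y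
        (\<lambda>w. F (fst (fst (fst w, n, snd w))) (lst (fst (snd (fst w, n, snd w))) (snd (snd (fst w, n, snd w))))
          (snd (fst (fst w, n, snd w))))" by simp
  qed
  moreover have "continuous_map (prod_topology P (prod_topology ?S ?I)) (prod_topology (prod_topology P ?I) ?S)
      (\<lambda>w. ((fst w, snd (snd w)), fst (snd w)))"
    by (intro continuous_map_pairedI cm_intros continuous_map_fstI[OF continuous_map_projections(2)]
        continuous_map_sndI[OF continuous_map_projections(2)])
  ultimately have cont: "continuous_map (prod_topology P (prod_topology ?S ?I)) Y ?f"
    by (rule continuous_map_apply[THEN continuous_map_eq]) simp
  have inj: "?f (p, x) = ?f (p, y)"
    if p: "p \<in> topspace P" and x: "x \<in> topspace (prod_topology ?S ?I)" and y: "y \<in> topspace (prod_topology ?S ?I)"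
      and eq: "comm_point (lst (fst (fst x)) (snd (fst x))) (snd x) = comm_point (lst (fst (fst y)) (snd (fst y))) (snd y)"
    for p x y
  proof -
    let ?x = "lst (fst (fst x)) (snd (fst x))" and ?y = "lst (fst (fst y)) (snd (fst y))"
    have xy: "?x \<in> commuting_lists G" "?y \<in> commuting_lists G" "snd x \<in> {0..1}" "snd y \<in> {0..1}"
      "fst x \<in> all_commuting_tuples G" "fst y \<in> all_commuting_tuples G"
      using x y by (auto simp: topspace_Hom_lst all_commuting_tuples_eq)
    have tup: "(length ?x, tup ?x) = fst x" "(length ?y, tup ?y) = fst y"
      using x y by (auto simp: lst_imp_tup)
    have "(assoc_class (fst x), snd x) = (assoc_class (fst y), snd y) \<or>
        (assoc_class (fst x), snd x) \<in> suspension_base \<and> (assoc_class (fst y), snd y) \<in> suspension_base"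
      using eq assoc_class_in_Comm[OF xy(1)] assoc_class_in_Comm[OF xy(2)] xy(3,4) unfolding comm_point_def tup
      by (subst (asm) collapse_class_eq_iff) auto
    moreover have "?f (p, z) = y0"
      if z: "z \<in> topspace (prod_topology ?S ?I)" "(assoc_class (fst z), snd z) \<in> suspension_base" for z
    proof -
      let ?z = "lst (fst (fst z)) (snd (fst z))"
      have z': "?z \<in> commuting_lists G" "snd z \<in> {0..1}" "fst z \<in> all_commuting_tuples G"
        using z(1) by (auto simp: topspace_Hom_lst all_commuting_tuples_eq)
      have "nf ?z = []" if "assoc_class (fst z) = snd (Comm G)"
      proof -
        have "(length [\<one>], tup [\<one>]) \<in> all_commuting_tuples G"
          unfolding all_commuting_tuples_eq by (rule tup_in_sum_Hom[OF one_commuting])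
        from nf_eq_if_assoc_class_eq[OF z'(3) this] that
        have "nf ?z = nf (lst (length [\<one>]) (tup [\<one>]))" by (simp add: snd_Comm)
        also have "\<dots> = []" unfolding lst_tup by (simp add: nf_def)
        finally show ?thesis .
      qed
      then show ?thesis
        using z(2) base[OF p z'(1,2)] by (auto simp: suspension_base_def)
    qed
    moreover have "?f (p, x) = ?f (p, y)" if "assoc_class (fst x) = assoc_class (fst y)" "snd x = snd y"
      using nf_eq_if_assoc_class_eq[OF xy(5,6) that(1)] nf[OF p xy(1,3)] nf[OF p xy(2,4)] that(2) by simp
    ultimately show ?thesis using x y by auto
  qed
  obtain g where g: "continuous_map (prod_topology P (fst (suspension (Comm G)))) Y g"
    "\<And>p x. \<lbrakk>p \<in> topspace P; x \<in> topspace (prod_topology ?S ?I)\<rbrakk> \<Longrightarrow>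
      g (p, comm_point (lst (fst (fst x)) (snd (fst x))) (snd x)) = ?f (p, x)"
    using quotient_map_param_lift[OF quotient_map_comm_point P cont inj] by blast
  show thesis
  proof (rule that[OF g(1)])
    fix p xs t assume *: "p \<in> topspace P" "xs \<in> commuting_lists G" "t \<in> {0..1::real}"
    then show "g (p, comm_point xs t) = F p xs t"
      using g(2)[of p "((length xs, tup xs), t)"] tup_topspace_Hom[of xs G] by simp
  qed
qed

subsection \<open>The wedge of the suspensions of \<open>Hom(Z\<^sup>n, G)\<close> modulo degenerate tuples\<close>

abbreviation hat_suspension :: "nat \<Rightarrow> ((nat \<Rightarrow> 'a) set \<times> real) set pointed_space" where
  "hat_suspension n \<equiv> suspension (hat_Hom G n)"

abbreviation hat_wedge :: "(nat \<times> ((nat \<Rightarrow> 'a) set \<times> real) set) set pointed_space" where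
  "hat_wedge \<equiv> wedge {1..} hat_suspension"

definition hat_base :: "nat \<Rightarrow> ((nat \<Rightarrow> 'a) set \<times> real) set" where
  "hat_base n = topspace (fst (hat_Hom G n)) \<times> {0, 1} \<union> {snd (hat_Hom G n)} \<times> {0..1}"

definition hat_point :: "'a list \<Rightarrow> real \<Rightarrow> ((nat \<Rightarrow> 'a) set \<times> real) set" where
  "hat_point xs t = collapse_class (prod_topology (fst (hat_Hom G (length xs))) unit_interval) (hat_base (length xs))
    (collapse_class (Hom G (length xs)) (Hom_degenerate G (length xs)) (tup xs), t)"

definition wedge_point :: "'a list \<Rightarrow> real \<Rightarrow> (nat \<times> ((nat \<Rightarrow> 'a) set \<times> real) set) set" where
  "wedge_point xs t = collapse_class (sum_topology (\<lambda>n. fst (hat_suspension n)) {1..})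
    ((\<lambda>n. (n, snd (hat_suspension n))) ` {1..}) (length xs, hat_point xs t)"

lemma hat_suspension_eq: "hat_suspension n = collapse (prod_topology (fst (hat_Hom G n)) unit_interval) (hat_base n)"
  by (simp add: suspension_def hat_base_def case_prod_unfold)

text \<open>For \<open>n = 0\<close> no tuple is degenerate and the collapsed set would be empty;
  from \<open>n = 1\<close> on the tuple of units is degenerate.\<close>

lemma hat_Hom_base:
  assumes "1 \<le> n"
  shows "snd (hat_Hom G n) \<in> topspace (fst (hat_Hom G n))"
  unfolding hat_Hom_def
proof (rule collapse_base_point)
  show "Hom_degenerate G n \<subseteq> topspace (Hom G n)" by (auto simp: Hom_degenerate_def)
  have "replicate n \<one> \<in> commuting_lists G" by (auto simp: commuting_lists_def)
  from tup_topspace_Hom[OF this] have "tup (replicate n \<one>) \<in> Hom_degenerate G n"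
    using assms by (auto simp: Hom_degenerate_def tup_def intro!: exI[of _ 0])
  then show "Hom_degenerate G n \<noteq> {}" by blast
qed

lemma hat_base_subset: "1 \<le> n \<Longrightarrow> hat_base n \<subseteq> topspace (prod_topology (fst (hat_Hom G n)) unit_interval)"
  using hat_Hom_base by (auto simp: hat_base_def)

lemma hat_base_nonempty: "hat_base n \<noteq> {}"
  by (auto simp: hat_base_def)

lemma quotient_map_hat_point:
  "quotient_map (prod_topology (Hom G n) unit_interval) (fst (hat_suspension n))
    (\<lambda>x. hat_point (lst n (fst x)) (snd x))"
proof -
  have q: "quotient_map (Hom G n) (fst (hat_Hom G n)) (collapse_class (Hom G n) (Hom_degenerate G n))"
    unfolding hat_Hom_def by (rule quotient_map_collapse_class)
  have "quotient_map (prod_topology (Hom G n) unit_interval) (prod_topology (fst (hat_Hom G n)) unit_interval)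
      (\<lambda>(x, t). (collapse_class (Hom G n) (Hom_degenerate G n) x, t))"
    by (rule quotient_map_prod_left[OF locally_compact_unit_interval _ q]) (simp add: Hausdorff_unit_interval)
  from quotient_map_compose[OF this quotient_map_collapse_class]
  have "quotient_map (prod_topology (Hom G n) unit_interval) (fst (hat_suspension n))
      (collapse_class (prod_topology (fst (hat_Hom G n)) unit_interval) (hat_base n) \<circ>
        (\<lambda>(x, t). (collapse_class (Hom G n) (Hom_degenerate G n) x, t)))"
    by (simp add: hat_suspension_eq)
  then show ?thesis
    by (rule quotient_map_eq) (auto simp: hat_point_def lst_imp_tup)
qed

lemma degenerate_iff:
  "g \<in> topspace (Hom G n) \<Longrightarrow> g \<in> Hom_degenerate G n \<longleftrightarrow> \<one> \<in> set (lst n g)"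
  by (force simp: Hom_degenerate_def set_lst)

lemma hat_Hom_class_in:
  "g \<in> topspace (Hom G n) \<Longrightarrow> collapse_class (Hom G n) (Hom_degenerate G n) g \<in> topspace (fst (hat_Hom G n))"
  unfolding hat_Hom_def topspace_collapse by blast

lemma in_hat_base_iff:
  assumes "g \<in> topspace (Hom G n)" "t \<in> {0..1}" "1 \<le> n"
  shows "(collapse_class (Hom G n) (Hom_degenerate G n) g, t) \<in> hat_base n \<longleftrightarrow>
    \<one> \<in> set (lst n g) \<or> t = 0 \<or> t = 1"
proof -
  have deg: "Hom_degenerate G n \<subseteq> topspace (Hom G n)" by (auto simp: Hom_degenerate_def)
  have "collapse_class (Hom G n) (Hom_degenerate G n) g = snd (hat_Hom G n) \<longleftrightarrow> \<one> \<in> set (lst n g)"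
  proof -
    have "replicate n \<one> \<in> commuting_lists G" by (auto simp: commuting_lists_def)
    from tup_topspace_Hom[OF this] have d: "tup (replicate n \<one>) \<in> Hom_degenerate G n"
      using assms(3) by (auto simp: Hom_degenerate_def tup_def intro!: exI[of _ 0])
    then have "snd (hat_Hom G n) = collapse_class (Hom G n) (Hom_degenerate G n) (tup (replicate n \<one>))"
      using collapse_class_base[OF deg d] by (simp add: hat_Hom_def)
    then show ?thesis
      using collapse_class_eq_iff[OF assms(1), of "tup (replicate n \<one>)" "Hom_degenerate G n"] d deg
        degenerate_iff[OF assms(1)] by auto
  qed
  then show ?thesis
    using assms(2) hat_Hom_class_in[OF assms(1)] by (auto simp: hat_base_def)
qed

lemma hat_point_base:
  assumes "xs \<in> commuting_lists G" "xs \<noteq> []" "t \<in> {0..1}" "\<one> \<in> set xs \<or> t = 0 \<or> t = 1"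
  shows "hat_point xs t = snd (hat_suspension (length xs))"
proof -
  have n: "1 \<le> length xs" using assms(2) by (cases xs) auto
  show ?thesis
    unfolding hat_point_def hat_suspension_eq
    using in_hat_base_iff[OF tup_topspace_Hom[OF assms(1)] assms(3) n] assms(4)
    by (intro collapse_class_base[OF hat_base_subset[OF n]]) simp
qed

lemma hat_suspension_base: "1 \<le> n \<Longrightarrow> snd (hat_suspension n) \<in> topspace (fst (hat_suspension n))"
  unfolding hat_suspension_eq by (intro collapse_base_point hat_base_subset hat_base_nonempty)

lemma wedge_point_base:
  assumes "xs \<in> commuting_lists G" "xs \<noteq> []" "t \<in> {0..1}" "\<one> \<in> set xs \<or> t = 0 \<or> t = 1"
  shows "wedge_point xs t = snd hat_wedge"
proof -
  have n: "1 \<le> length xs" using assms(2) by (cases xs) auto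
  show ?thesis
    unfolding wedge_point_def wedge_def hat_point_base[OF assms]
    using hat_suspension_base n by (intro collapse_class_base) auto
qed

lemma quotient_map_wedge:
  "quotient_map (sum_topology (\<lambda>n. fst (hat_suspension n)) {1..}) (fst hat_wedge)
    (collapse_class (sum_topology (\<lambda>n. fst (hat_suspension n)) {1..}) ((\<lambda>n. (n, snd (hat_suspension n))) ` {1..}))"
  unfolding wedge_def by (rule quotient_map_collapse_class)

lemma continuous_wedge_point:
  assumes "1 \<le> n"
  shows "continuous_map (prod_topology (Hom G n) unit_interval) (fst hat_wedge)
    (\<lambda>x. wedge_point (lst n (fst x)) (snd x))"
proof -
  have "continuous_map (prod_topology (Hom G n) unit_interval) (sum_topology (\<lambda>n. fst (hat_suspension n)) {1..})
      (\<lambda>x. (n, hat_point (lst n (fst x)) (snd x)))"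
    using assms
    by (intro continuous_map_apply[OF continuous_map_component_injection]
        quotient_imp_continuous_map[OF quotient_map_hat_point]) simp
  from continuous_map_apply[OF quotient_imp_continuous_map[OF quotient_map_wedge] this]
  show ?thesis by (simp add: wedge_point_def)
qed

lemma topspace_hat_wedge:
  assumes "y \<in> topspace (fst hat_wedge)"
  obtains xs t where "xs \<in> commuting_lists G" "xs \<noteq> []" "t \<in> {0..1}" "y = wedge_point xs t"
proof -
  let ?S = "sum_topology (\<lambda>n. fst (hat_suspension n)) {1..}"
  obtain w where w: "w \<in> topspace ?S"
    "y = collapse_class ?S ((\<lambda>n. (n, snd (hat_suspension n))) ` {1..}) w"
    using assms quotient_imp_surjective_map[OF quotient_map_wedge] by blast
  define n z where "n = fst w" and "z = snd w"
  have n: "1 \<le> n" and z: "z \<in> topspace (fst (hat_suspension n))"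
    and y: "y = collapse_class ?S ((\<lambda>n. (n, snd (hat_suspension n))) ` {1..}) (n, z)"
    using w by (auto simp: n_def z_def)
  obtain x where x: "x \<in> topspace (prod_topology (Hom G n) unit_interval)" "z = hat_point (lst n (fst x)) (snd x)"
    using z quotient_imp_surjective_map[OF quotient_map_hat_point] by blast
  show thesis
    using x y n by (intro that[of "lst n (fst x)" "snd x"]) (auto simp: topspace_Hom_lst wedge_point_def simp flip: length_0_conv)
qed

text \<open>The map descends first to each suspension and then to the wedge; the second stage is
  possible because every summand sends its base point to the same \<open>y0\<close>.\<close>

lemma wedge_point_lift:
  fixes F :: "'p \<Rightarrow> 'a list \<Rightarrow> real \<Rightarrow> 'y"
  assumes P: "locally_compact_space P" "Hausdorff_space P"
    and F: "\<And>n. 1 \<le> n \<Longrightarrow> continuous_map (prod_topology (prod_topology P (Hom G n)) unit_interval) Y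
      (\<lambda>w. F (fst (fst w)) (lst n (snd (fst w))) (snd w))"
    and base: "\<And>p xs t. \<lbrakk>p \<in> topspace P; xs \<in> commuting_lists G; xs \<noteq> []; t \<in> {0..1}; \<one> \<in> set xs \<or> t = 0 \<or> t = 1\<rbrakk> \<Longrightarrow>
      F p xs t = y0"
  obtains g where "continuous_map (prod_topology P (fst hat_wedge)) Y g"
    "\<And>p xs t. \<lbrakk>p \<in> topspace P; xs \<in> commuting_lists G; xs \<noteq> []; t \<in> {0..1}\<rbrakk> \<Longrightarrow> g (p, wedge_point xs t) = F p xs t"
proof -
  let ?S = "sum_topology (\<lambda>n. fst (hat_suspension n)) {1..}" and ?I = unit_interval
  have "\<exists>g. continuous_map (prod_topology P (fst (hat_suspension n))) Y g \<and>
      (\<forall>p\<in>topspace P. \<forall>x\<in>topspace (prod_topology (Hom G n) ?I).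
        g (p, hat_point (lst n (fst x)) (snd x)) = F p (lst n (fst x)) (snd x))" if n: "1 \<le> n" for n
  proof -
    let ?f = "\<lambda>w. F (fst w) (lst n (fst (snd w))) (snd (snd w))"
    have "continuous_map (prod_topology P (prod_topology (Hom G n) ?I)) (prod_topology (prod_topology P (Hom G n)) ?I)
        (\<lambda>w. ((fst w, fst (snd w)), snd (snd w)))"
      by (intro continuous_map_pairedI cm_intros continuous_map_fstI[OF continuous_map_projections(2)]
          continuous_map_sndI[OF continuous_map_projections(2)])
    from continuous_map_apply[OF F[OF n] this]
    have cont: "continuous_map (prod_topology P (prod_topology (Hom G n) ?I)) Y ?f" by simp
    have inj: "?f (p, x) = ?f (p, y)"
      if p: "p \<in> topspace P" and x: "x \<in> topspace (prod_topology (Hom G n) ?I)" and y: "y \<in> topspace (prod_topology (Hom G n) ?I)"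
        and eq: "hat_point (lst n (fst x)) (snd x) = hat_point (lst n (fst y)) (snd y)" for p x y
    proof -
      let ?c = "collapse_class (Hom G n) (Hom_degenerate G n)"
      have xy: "fst x \<in> topspace (Hom G n)" "fst y \<in> topspace (Hom G n)" "snd x \<in> {0..1}" "snd y \<in> {0..1}"
        using x y by auto
      have "(?c (fst x), snd x) = (?c (fst y), snd y) \<or>
          (?c (fst x), snd x) \<in> hat_base n \<and> (?c (fst y), snd y) \<in> hat_base n"
        using eq hat_Hom_class_in xy unfolding hat_point_def length_lst lst_imp_tup[OF xy(1)] lst_imp_tup[OF xy(2)]
        by (subst (asm) collapse_class_eq_iff) auto
      moreover have "fst x = fst y \<or> \<one> \<in> set (lst n (fst x)) \<and> \<one> \<in> set (lst n (fst y))"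
        if "?c (fst x) = ?c (fst y)"
        using that xy(1,2) degenerate_iff by (subst (asm) collapse_class_eq_iff) auto
      moreover have "?f (p, z) = y0" if z: "z \<in> topspace (prod_topology (Hom G n) ?I)"
          "\<one> \<in> set (lst n (fst z)) \<or> snd z = 0 \<or> snd z = 1" for z
      proof -
        have "lst n (fst z) \<noteq> []" using n by (auto simp flip: length_0_conv)
        then show ?thesis using z base[OF p, of "lst n (fst z)" "snd z"] by (auto simp: topspace_Hom_lst)
      qed
      ultimately show ?thesis
        using x y in_hat_base_iff[OF xy(1,3) n] in_hat_base_iff[OF xy(2,4) n] by auto
    qed
    obtain g where "continuous_map (prod_topology P (fst (hat_suspension n))) Y g"
      "\<And>p x. \<lbrakk>p \<in> topspace P; x \<in> topspace (prod_topology (Hom G n) ?I)\<rbrakk> \<Longrightarrow>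
        g (p, hat_point (lst n (fst x)) (snd x)) = ?f (p, x)"
      using quotient_map_param_lift[OF quotient_map_hat_point P cont inj] by blast
    then show ?thesis by auto
  qed
  then obtain G0 where G0: "\<And>n. 1 \<le> n \<Longrightarrow> continuous_map (prod_topology P (fst (hat_suspension n))) Y (G0 n)"
    and G0_eq: "\<And>n p x. \<lbrakk>1 \<le> n; p \<in> topspace P; x \<in> topspace (prod_topology (Hom G n) ?I)\<rbrakk> \<Longrightarrow>
        G0 n (p, hat_point (lst n (fst x)) (snd x)) = F p (lst n (fst x)) (snd x)"
    by metis
  have G0_point: "G0 (length xs) (p, hat_point xs t) = F p xs t"
    if "p \<in> topspace P" "xs \<in> commuting_lists G" "xs \<noteq> []" "t \<in> {0..1}" for p xs t
  proof -
    have "1 \<le> length xs" using that(3) by (cases xs) auto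
    then show ?thesis
      using G0_eq[of "length xs" p "(tup xs, t)"] that tup_topspace_Hom[of xs G] by simp
  qed
  \<comment> \<open>The base point of each summand is represented by a tuple of units.\<close>
  have G0_base: "G0 n (p, snd (hat_suspension n)) = y0" if "p \<in> topspace P" "1 \<le> n" for p n
  proof -
    let ?xs = "replicate n \<one>"
    have xs: "?xs \<in> commuting_lists G" "?xs \<noteq> []" using that(2) by (auto simp: commuting_lists_def)
    then show ?thesis
      using G0_point[OF that(1) xs, of 0] hat_point_base[OF xs, of 0] base[OF that(1) xs, of 0] by simp
  qed
  let ?f = "\<lambda>w. G0 (fst (snd w)) (fst w, snd (snd w))"
  have cont: "continuous_map (prod_topology P ?S) Y ?f"
    by (rule continuous_map_prod_sum_topology) (use G0 in auto)
  have inj: "?f (p, x) = ?f (p, y)"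
    if p: "p \<in> topspace P" and x: "x \<in> topspace ?S" and y: "y \<in> topspace ?S"
      and eq: "collapse_class ?S ((\<lambda>n. (n, snd (hat_suspension n))) ` {1..}) x
        = collapse_class ?S ((\<lambda>n. (n, snd (hat_suspension n))) ` {1..}) y" for p x y
    using eq x y G0_base[OF p] by (subst (asm) collapse_class_eq_iff) auto
  obtain g where g: "continuous_map (prod_topology P (fst hat_wedge)) Y g"
    "\<And>p x. \<lbrakk>p \<in> topspace P; x \<in> topspace ?S\<rbrakk> \<Longrightarrow>
      g (p, collapse_class ?S ((\<lambda>n. (n, snd (hat_suspension n))) ` {1..}) x) = ?f (p, x)"
    using quotient_map_param_lift[OF quotient_map_wedge P cont inj] by blast
  show thesis
  proof (rule that[OF g(1)])
    fix p xs t assume *: "p \<in> topspace P" "xs \<in> commuting_lists G" "xs \<noteq> []" "t \<in> {0..1::real}"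
    have n: "1 \<le> length xs" using *(3) by (cases xs) auto
    have "hat_point xs t \<in> topspace (fst (hat_suspension (length xs)))"
      using quotient_imp_surjective_map[OF quotient_map_hat_point[of "length xs"]] tup_topspace_Hom[OF *(2)] *(4)
      by (force simp: image_iff)
    then show "g (p, wedge_point xs t) = F p xs t"
      using g(2)[OF *(1), of "(length xs, hat_point xs t)"] n G0_point[OF *] by (simp add: wedge_point_def)
  qed
qed

end

section \<open>The homotopy equivalence\<close>

definition loop_of :: "'y \<Rightarrow> real \<Rightarrow> (real \<Rightarrow> 'y) \<Rightarrow> 'y moore_loop" where
  "loop_of y0 w q = (w, \<lambda>t. if 0 < t \<and> t < w then q (t / w) else y0)"

lemma loop_of_0: "loop_of y0 0 q = loop_unit y0"
  by (auto simp: loop_of_def loop_unit_def fun_eq_iff)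

text \<open>Rescaling a loop to unit time and stretching it back to its own length is no
  reparametrisation; later identities between loops are strict for this reason.\<close>

lemma loop_of_self:
  assumes c: "c \<in> loops_at y0" and q: "\<And>t. t \<in> {0..1} \<Longrightarrow> q t = snd c (t * fst c)"
  shows "loop_of y0 (fst c) q = c"
proof -
  have "snd (loop_of y0 (fst c) q) t = snd c t" for t
    using loops_atD(2,3)[OF c, of t] by (auto simp: loop_of_def q divide_le_eq)
  then show ?thesis by (auto simp: loop_of_def intro!: prod_eqI)
qed

lemma loop_family_of:
  assumes "continuous_map Z euclideanreal w" "\<And>z. z \<in> topspace Z \<Longrightarrow> 0 \<le> w z"
    and "continuous_map (prod_topology Z unit_interval) Y (\<lambda>x. q (fst x) (snd x))"
    and "\<And>z. z \<in> topspace Z \<Longrightarrow> q z 0 = y0" "\<And>z. z \<in> topspace Z \<Longrightarrow> q z 1 = y0"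
    and "\<And>z t. \<lbrakk>z \<in> topspace Z; w z = 0; t \<in> {0..1}\<rbrakk> \<Longrightarrow> q z t = y0"
  shows "loop_family Z Y y0 (\<lambda>z. loop_of y0 (w z) (q z))"
  unfolding loop_of_def by (rule loop_family_rescale[OF assms])

lemma singleton_in_subseqs: "x \<in> set xs \<Longrightarrow> [x] \<in> set (subseqs xs)"
proof (induction xs)
  case (Cons y ys)
  have "[] \<in> set (subseqs ys)" by (induction ys) (auto simp: Let_def)
  then show ?case using Cons by (auto simp: Let_def)
qed simp

text \<open>The left-hand side extends \<open>min N (s / (1 - s))\<close> continuously to \<open>s = 1\<close>.\<close>

lemma truncated_time:
  assumes "0 \<le> N" "0 \<le> s" "s < (1::real)"
  shows "min N (s / max (1 - s) (1 / (N + 1))) = min N (s / (1 - s))"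
proof (cases "1 / (N + 1) \<le> 1 - s")
  case False
  then have s: "N < s * (N + 1)" using assms by (simp add: field_simps)
  have "N * (1 - s) < s" using s by (simp add: algebra_simps)
  then have "N < s / (1 - s)" using assms by (simp add: pos_less_divide_eq)
  then show ?thesis using s False by simp
qed (simp add: max_def)

context commuting_deformation
begin

text \<open>Each loop is traversed at constant speed in the suspension coordinate. Invariance under
  \<open>nf\<close> lets this descend to \<open>Comm(G)\<close>, and the value at \<open>[]\<close>
  takes care of the base point.\<close>

lemma comm_map_of_loops:
  assumes P: "locally_compact_space P" "Hausdorff_space P"
    and C: "\<And>n. tuple_family G P Y y0 n C"
    and nf: "\<And>p xs. \<lbrakk>p \<in> topspace P; xs \<in> commuting_lists G\<rbrakk> \<Longrightarrow> C p (nf xs) = C p xs"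
    and Nil: "\<And>p. p \<in> topspace P \<Longrightarrow> C p [] = loop_unit y0"
  obtains g where "continuous_map (prod_topology P (fst (suspension (Comm G)))) Y g"
    "\<And>p xs t. \<lbrakk>p \<in> topspace P; xs \<in> commuting_lists G; t \<in> {0..1}\<rbrakk> \<Longrightarrow>
      g (p, comm_point xs t) = snd (C p xs) (t * fst (C p xs))"
proof (rule comm_point_lift[OF P, where F = "\<lambda>p xs t. snd (C p xs) (t * fst (C p xs))" and Y = Y and ?y0.0 = y0])
  fix n
  let ?W = "prod_topology (prod_topology P (Hom G n)) unit_interval"
  have "continuous_map ?W euclideanreal snd"
    using continuous_map_projections(2)[of "prod_topology P (Hom G n)" unit_interval]
    by (simp add: continuous_map_in_subtopology)
  then show "continuous_map ?W Y (\<lambda>w. snd (C (fst (fst w)) (lst n (snd (fst w))))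
      (snd w * fst (C (fst (fst w)) (lst n (snd (fst w))))))"
    by (intro loop_family_path[OF C[unfolded tuple_family_def]] loop_family_len[OF C[unfolded tuple_family_def]] cm_intros)
next
  fix p xs and t :: real
  assume *: "p \<in> topspace P" "xs \<in> commuting_lists G" "t \<in> {0..1}"
  show "snd (C p (nf xs)) (t * fst (C p (nf xs))) = snd (C p xs) (t * fst (C p xs))"
    using nf[OF *(1,2)] by simp
  assume "nf xs = [] \<or> t = 0 \<or> t = 1"
  moreover have "C p xs = loop_unit y0" if "nf xs = []" using nf[OF *(1,2)] Nil[OF *(1)] that by simp
  ultimately show "snd (C p xs) (t * fst (C p xs)) = y0"
    using loops_atD(2,3)[OF tuple_family_at[OF C *(1,2)]] by (auto simp: loop_unit_def)
qed (rule that)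

lemma wedge_map_of_loops:
  assumes P: "locally_compact_space P" "Hausdorff_space P"
    and C: "\<And>n. tuple_family G P Y y0 n C"
    and unit: "\<And>p xs. \<lbrakk>p \<in> topspace P; xs \<in> commuting_lists G; \<one> \<in> set xs\<rbrakk> \<Longrightarrow> C p xs = loop_unit y0"
  obtains g where "continuous_map (prod_topology P (fst hat_wedge)) Y g"
    "\<And>p xs t. \<lbrakk>p \<in> topspace P; xs \<in> commuting_lists G; xs \<noteq> []; t \<in> {0..1}\<rbrakk> \<Longrightarrow>
      g (p, wedge_point xs t) = snd (C p xs) (t * fst (C p xs))"
proof (rule wedge_point_lift[OF P, where F = "\<lambda>p xs t. snd (C p xs) (t * fst (C p xs))" and Y = Y and ?y0.0 = y0])
  fix n
  let ?W = "prod_topology (prod_topology P (Hom G n)) unit_interval"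
  have "continuous_map ?W euclideanreal snd"
    using continuous_map_projections(2)[of "prod_topology P (Hom G n)" unit_interval]
    by (simp add: continuous_map_in_subtopology)
  then show "continuous_map ?W Y (\<lambda>w. snd (C (fst (fst w)) (lst n (snd (fst w))))
      (snd w * fst (C (fst (fst w)) (lst n (snd (fst w))))))"
    by (intro loop_family_path[OF C[unfolded tuple_family_def]] loop_family_len[OF C[unfolded tuple_family_def]] cm_intros)
next
  fix p xs and t :: real
  assume *: "p \<in> topspace P" "xs \<in> commuting_lists G" "t \<in> {0..1}" and "\<one> \<in> set xs \<or> t = 0 \<or> t = 1"
  moreover have "C p xs = loop_unit y0" if "\<one> \<in> set xs" using unit[OF *(1,2) that] .
  ultimately show "snd (C p xs) (t * fst (C p xs)) = y0"
    using loops_atD(2,3)[OF tuple_family_at[OF C *(1,2)]]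
    by (auto simp: loop_unit_def)
qed (rule that)

text \<open>Length of the tautological loops. A sum ignores units because \<open>e\<close> vanishes
  there, so it is invariant under \<open>nf\<close>, and it vanishes only on lists of units.\<close>

definition total_height :: "'a list \<Rightarrow> real" where
  "total_height xs = (\<Sum>x\<leftarrow>xs. e x)"

text \<open>Made to vanish exactly where a normalised family has to be trivial. The list
  \<open>[]\<close> needs its own case because the arrival time of the empty tuple is 1.\<close>

definition least_height :: "'a list \<Rightarrow> real" where
  "least_height xs = (if xs = [] then 0 else arrival (length xs) (tup xs))"

lemma total_height_nf: "total_height (nf xs) = total_height xs"
  using e_eq_0[of \<one>] by (induction xs) (auto simp: total_height_def nf_def)

lemma total_height_nonneg: "xs \<in> commuting_lists G \<Longrightarrow> 0 \<le> total_height xs"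
  using e_range unfolding total_height_def by (intro sum_list_nonneg) (auto simp: commuting_lists_def)

lemma total_height_eq_0:
  assumes "xs \<in> commuting_lists G" "total_height xs = 0"
  shows "nf xs = []"
proof -
  have "set xs \<subseteq> carrier G" using assms(1) by (simp add: commuting_lists_def)
  moreover have "\<forall>x\<in>set xs. e x = 0"
    using assms(2) e_range calculation unfolding total_height_def
    by (subst (asm) sum_list_nonneg_eq_0_iff) auto
  ultimately show ?thesis using e_eq_0 by (auto simp: nf_eq_Nil_iff)
qed

lemma continuous_total_height: "continuous_map (Hom G n) euclideanreal (\<lambda>g. total_height (lst n g))"
proof -
  have "total_height (lst n g) = (\<Sum>j\<in>{0..<n}. e (g j))" for g
    by (simp add: total_height_def lst_def o_def interv_sum_list_conv_sum_set_nat)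
  then show ?thesis
    by (simp only:) (intro continuous_map_sum continuous_e_component; simp)
qed

lemma least_height_nonneg: "xs \<in> commuting_lists G \<Longrightarrow> 0 \<le> least_height xs"
  using arrival_range[OF tup_topspace_Hom] by (auto simp: least_height_def)

lemma least_height_eq_0_iff:
  assumes "xs \<in> commuting_lists G"
  shows "least_height xs = 0 \<longleftrightarrow> xs = [] \<or> \<one> \<in> set xs"
proof (cases "xs = []")
  case False
  note tup = tup_topspace_Hom[OF assms]
  have "least_height xs = 0 \<longleftrightarrow> (\<exists>j<length xs. tup xs j = \<one>)"
  proof
    assume "least_height xs = 0"
    then have "arrival (length xs) (tup xs) = 0" using False by (simp add: least_height_def)
    then obtain j where "j < length xs" "e (tup xs j) = 0"
      using min_upto_attained[of "\<lambda>j. e (tup xs j)" "length xs"] by (auto simp: arrival_def)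
    then show "\<exists>j<length xs. tup xs j = \<one>"
      using e_eq_0 commuting_lists_components(1)[OF tup] by blast
  next
    assume "\<exists>j<length xs. tup xs j = \<one>"
    then show "least_height xs = 0" using arrival_unit[OF tup] False by (auto simp: least_height_def)
  qed
  also have "\<dots> \<longleftrightarrow> \<one> \<in> set xs" by (auto simp: tup_def in_set_conv_nth)
  finally show ?thesis using False by simp
qed (simp add: least_height_def)

lemma continuous_least_height: "continuous_map (Hom G n) euclideanreal (\<lambda>g. least_height (lst n g))"
proof (cases "n = 0")
  case False
  have "continuous_map (Hom G n) euclideanreal (\<lambda>g. arrival n (tup (lst n g)))"
    using continuous_arrival by (rule continuous_map_eq) (simp add: lst_imp_tup)
  moreover have "lst n g \<noteq> []" for g :: "nat \<Rightarrow> 'a" using False by (auto simp flip: length_0_conv)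
  ultimately show ?thesis by (simp add: least_height_def)
next
  case True
  then have "least_height (lst n g) = 0" for g by (simp add: least_height_def lst_def)
  then show ?thesis by simp
qed

lemma subseq_prod_nf:
  assumes "\<And>ys. ys \<in> commuting_lists G \<Longrightarrow> F ys \<in> loops_at y0"
    and "\<And>ys. \<lbrakk>ys \<in> commuting_lists G; \<one> \<in> set ys\<rbrakk> \<Longrightarrow> F ys = loop_unit y0"
    and "xs \<in> commuting_lists G"
  shows "subseq_prod y0 F (nf xs) = subseq_prod y0 F xs"
  unfolding nf_def using assms commuting_lists_subseqs[OF assms(3)]
  by (intro subseq_prod_filter) auto

lemma suspension_base_in: "snd (suspension (Comm G)) \<in> topspace (fst (suspension (Comm G)))"
proof -
  have "snd (Comm G) \<in> topspace (fst (Comm G))"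
    using assoc_class_in_Comm[OF one_commuting] by (simp add: snd_Comm)
  then show ?thesis
    unfolding suspension_Comm
    by (intro collapse_base_point suspension_base_subset) (auto simp: suspension_base_def)
qed

lemma wedge_base_in: "snd hat_wedge \<in> topspace (fst hat_wedge)"
  unfolding wedge_def using hat_suspension_base by (intro collapse_base_point) auto

text \<open>
  Taking the lengths \<open>fst (f xs)\<close> as weights in the splitting map avoids reparametrising the loops \<open>f xs\<close>.
\<close>

lemma tautological_factorisation:
  fixes Y1 y1
  defines "Y1 \<equiv> fst (suspension (Comm G))" and "y1 \<equiv> snd (suspension (Comm G))"
  obtains f g where "\<And>n. tuple_family G unit_interval Y1 y1 n (\<lambda>_. f)"
    "\<And>xs. xs \<in> commuting_lists G \<Longrightarrow> fst (f xs) = 0 \<longleftrightarrow> xs = [] \<or> \<one> \<in> set xs"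
    "\<And>xs. \<lbrakk>xs \<in> commuting_lists G; xs = [] \<or> \<one> \<in> set xs\<rbrakk> \<Longrightarrow> f xs = loop_unit y1"
    "continuous_map Y1 Y1 g"
    "\<And>xs t. \<lbrakk>xs \<in> commuting_lists G; t \<in> {0..1}\<rbrakk> \<Longrightarrow>
      g (comm_point xs t) = snd (subseq_prod y1 f xs) (t * fst (subseq_prod y1 f xs))"
    "homotopic_with (\<lambda>k. k y1 = y1) Y1 Y1 id g"
proof -
  let ?I = unit_interval
  note P = locally_compact_unit_interval Hausdorff_unit_interval
  have y1: "y1 \<in> topspace Y1" unfolding Y1_def y1_def by (rule suspension_base_in)
  \<comment> \<open>The tautological family: up to the scaling of time, the loop at
    \<open>xs\<close> runs along the suspension coordinate over the class of
    \<open>xs\<close>.\<close>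
  define K where "K xs = loop_of y1 (total_height xs) (comm_point xs)" for xs
  have base: "comm_point xs t = y1" if "xs \<in> commuting_lists G" "t \<in> {0..1}" "nf xs = [] \<or> t = 0 \<or> t = 1" for xs t
    unfolding y1_def by (rule comm_point_base[OF that])
  have K_fam: "tuple_family G ?I Y1 y1 n (\<lambda>_. K)" for n
    unfolding tuple_family_def K_def
  proof (rule loop_family_of)
    let ?Z = "prod_topology ?I (Hom G n)"
    show "continuous_map ?Z euclideanreal (\<lambda>z. total_height (lst n (snd z)))"
      by (rule continuous_map_apply[OF continuous_total_height]) (intro cm_intros)
    have "continuous_map (prod_topology ?Z ?I) (prod_topology (Hom G n) ?I) (\<lambda>x. (snd (fst x), snd x))"
      by (intro cm_intros)
    from continuous_map_apply[OF continuous_comm_point this]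
    show "continuous_map (prod_topology ?Z ?I) Y1 (\<lambda>x. comm_point (lst n (snd (fst x))) (snd x))"
      by (simp add: Y1_def)
  qed (simp_all add: topspace_Hom_lst total_height_nonneg base total_height_eq_0 mem_Times_iff)
  \<comment> \<open>With \<open>P0\<close> empty nothing is prescribed, and the value 1 of
    \<open>eP\<close> makes the arrival condition vacuous. The solution is read off at parameter
    0.\<close>
  interpret FP: factor_problem G e h ?I "{}" "\<lambda>p _. p" "\<lambda>_. 1" Y1 y1 "\<lambda>_. K" "\<lambda>_ _. loop_unit y1"
  proof
    show "continuous_map (prod_topology ?I (top_of_set {0..1})) ?I (\<lambda>x. fst x)"
      by (rule continuous_map_fst)
    show "K (nf xs) = K xs" if "xs \<in> commuting_lists G" for xs
    proof -
      have "comm_point (nf xs) = comm_point xs" using comm_point_nf[OF that] by (rule ext)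
      then show ?thesis by (simp add: K_def total_height_nf)
    qed
    show "K [] = loop_unit y1" by (simp add: K_def total_height_def loop_of_0)
    show "tuple_family G (subtopology ?I {}) Y1 y1 n (\<lambda>_ _. loop_unit y1)" for n
      unfolding tuple_family_def by (rule loop_family_unit[OF y1])
  qed (use K_fam y1 in auto)
  obtain f0 H0 where f0: "\<And>n. tuple_family G ?I Y1 y1 n f0" and H0: "\<And>n. FP.homotopy_family n H0"
    and sol: "\<And>p xs. \<lbrakk>p \<in> topspace ?I; xs \<in> commuting_lists G\<rbrakk> \<Longrightarrow> FP.solves_at f0 H0 p xs"
    by (rule FP.solution_exists) (rule that)
  define f1 where "f1 = f0 0"
  define H where "H = H0 0"
  have f1_unit: "f1 xs = loop_unit y1" if "xs \<in> commuting_lists G" "xs = [] \<or> \<one> \<in> set xs" for xs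
    using sol[of 0 xs] that by (auto simp: FP.solves_at_def f1_def)
  have H_nf: "H (nf xs) s = H xs s" if "xs \<in> commuting_lists G" "0 \<le> s" for xs s
    using sol[of 0 xs] that by (auto simp: FP.solves_at_def H_def)
  have H_0: "H xs 0 = K xs" if "xs \<in> commuting_lists G" for xs
    using sol[of 0 xs] that by (auto simp: FP.solves_at_def H_def)
  have H_Nil: "H [] s = loop_unit y1" if "0 \<le> s" for s
    using sol[of 0 "[]"] that Nil_commuting by (auto simp: FP.solves_at_def H_def)
  have H_late: "H xs s = subseq_prod y1 f1 xs" if "xs \<in> commuting_lists G" "3 * real (length xs) + 1 \<le> s" for xs s
    using sol[of 0 xs] that by (auto simp: FP.solves_at_def H_def f1_def)
  have f1_fam: "tuple_family G ?I Y1 y1 n (\<lambda>_. f1)" for n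
  proof -
    have "continuous_map (prod_topology ?I (Hom G n)) (prod_topology ?I (Hom G n)) (\<lambda>w. (0, snd w))"
      by (intro continuous_map_pairedI cm_intros) auto
    from loop_family_compose[OF f0[unfolded tuple_family_def] this] show ?thesis
      by (simp add: tuple_family_def f1_def)
  qed
  have f1_at: "f1 xs \<in> loops_at y1" if "xs \<in> commuting_lists G" for xs
    using tuple_family_at[OF f1_fam _ that, of 0] by simp
  have prod_nf: "subseq_prod y1 f1 (nf xs) = subseq_prod y1 f1 xs" if "xs \<in> commuting_lists G" for xs
    by (rule subseq_prod_nf[OF f1_at f1_unit that]) auto
  have prod_Nil: "subseq_prod y1 F [] = loop_unit y1" if "F [] = loop_unit y1" for F :: "'a list \<Rightarrow> _"
    using that by (simp add: subseq_prod_def loop_prod_def loop_mult_unit_left)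

  \<comment> \<open>The time until the product is reached grows with the length, so no finite time
    serves all tuples; \<open>s / (1 - s)\<close> compresses the half-line, and the product itself
    is put at \<open>s = 1\<close>.\<close>
  define C where "C s xs = (if s = 1 then subseq_prod y1 f1 xs else H xs (s / (1 - s)))" for s xs
  have C_fam: "tuple_family G ?I Y1 y1 n C" for n
  proof -
    let ?N = "3 * real n + 1"
    \<comment> \<open>On tuples of length \<open>n\<close> the homotopy is stationary from time
      \<open>?N\<close> on, so time may be truncated there. This makes \<open>C\<close> continuous
      up to \<open>s = 1\<close>, one length at a time.\<close>
    define \<theta> where "\<theta> s = min ?N (s / max (1 - s) (1 / (?N + 1)))" for s :: real
    have \<theta>_eq: "\<theta> s = min ?N (s / (1 - s))" if "0 \<le> s" "s < 1" for s
      unfolding \<theta>_def using that by (intro truncated_time) auto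
    have \<theta>_1: "\<theta> 1 = ?N" by (simp add: \<theta>_def)
    have \<theta>_nonneg: "0 \<le> \<theta> s" if "0 \<le> s" for s using that by (simp add: \<theta>_def le_max_iff_disj)
    have "0 < max (1 - s) (1 / (?N + 1))" for s :: real by (simp add: less_max_iff_disj)
    then have "continuous_on {0..1} \<theta>"
      unfolding \<theta>_def by (intro continuous_intros) (metis less_irrefl)
    then have \<theta>: "continuous_map ?I (top_of_set {0..}) \<theta>"
      using \<theta>_nonneg by (auto simp: continuous_map_in_subtopology)
    have "continuous_map (prod_topology ?I (Hom G n))
        (prod_topology (prod_topology ?I (Hom G n)) (top_of_set {0..})) (\<lambda>w. ((0, snd w), \<theta> (fst w)))"
      by (intro continuous_map_pairedI continuous_map_apply[OF \<theta>] cm_intros) auto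
    from loop_family_compose[OF H0[unfolded FP.homotopy_family_def] this]
    have "loop_family (prod_topology ?I (Hom G n)) Y1 y1 (\<lambda>w. H (lst n (snd w)) (\<theta> (fst w)))"
      by (simp add: H_def)
    then show ?thesis
      unfolding tuple_family_def
    proof (rule loop_family_eq)
      fix w assume "w \<in> topspace (prod_topology ?I (Hom G n))"
      then have s: "0 \<le> fst w" "fst w \<le> 1" and xs: "lst n (snd w) \<in> commuting_lists G"
        by (auto simp: topspace_Hom_lst)
      show "H (lst n (snd w)) (\<theta> (fst w)) = C (fst w) (lst n (snd w))"
      proof (cases "fst w = 1")
        case True
        then show ?thesis using H_late[OF xs] \<theta>_1 by (simp add: C_def)
      next
        case False
        then have "\<theta> (fst w) = min ?N (fst w / (1 - fst w))" using s by (intro \<theta>_eq) auto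
        then show ?thesis
          using False H_late[OF xs, of ?N] H_late[OF xs, of "fst w / (1 - fst w)"] by (auto simp: C_def min_def)
      qed
    qed
  qed
  have C_nf: "C s (nf xs) = C s xs" if "s \<in> topspace ?I" "xs \<in> commuting_lists G" for s xs
    using that H_nf[OF that(2), of "s / (1 - s)"] prod_nf[OF that(2)] by (auto simp: C_def)
  have C_Nil: "C s [] = loop_unit y1" if "s \<in> topspace ?I" for s
    using that H_Nil[of "s / (1 - s)"] prod_Nil[of f1] f1_unit[OF Nil_commuting] by (auto simp: C_def)
  obtain g1 where g1: "continuous_map (prod_topology ?I Y1) Y1 g1"
    "\<And>p xs t. \<lbrakk>p \<in> topspace ?I; xs \<in> commuting_lists G; t \<in> {0..1}\<rbrakk> \<Longrightarrow>
      g1 (p, comm_point xs t) = snd (C p xs) (t * fst (C p xs))"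
    using comm_map_of_loops[OF P C_fam C_nf C_Nil] unfolding Y1_def by blast

  \<comment> \<open>\<open>f1\<close> may have length 0 at a nondegenerate tuple. Resting longer at
    the base point leaves the path unchanged and, at \<open>s = 1\<close>, makes the length vanish
    exactly on \<open>[]\<close> and on the lists with a unit.\<close>
  define f2 where "f2 s xs = (fst (f1 xs) + s * least_height xs, snd (f1 xs))" for s xs
  have f2_fam: "tuple_family G ?I Y1 y1 n f2" for n
    unfolding tuple_family_def loop_family_def
  proof (intro conjI ballI)
    let ?Z = "prod_topology ?I (Hom G n)"
    have "continuous_map ?Z euclideanreal fst"
      using continuous_map_projections(1)[of ?I "Hom G n"] by (simp add: continuous_map_in_subtopology)
    then show "continuous_map ?Z euclideanreal (\<lambda>z. fst (f2 (fst z) (lst n (snd z))))"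
      unfolding f2_def fst_conv
      by (intro cm_intros loop_familyD(1)[OF f1_fam[unfolded tuple_family_def]]
          continuous_map_apply[OF continuous_least_height])
    show "continuous_map (prod_topology ?Z euclideanreal) Y1
        (\<lambda>w. snd (f2 (fst (fst w)) (lst n (snd (fst w)))) (snd w))"
      unfolding f2_def snd_conv by (rule loop_familyD(2)[OF f1_fam[unfolded tuple_family_def]])
    fix z assume "z \<in> topspace ?Z"
    then have z: "0 \<le> fst z" "lst n (snd z) \<in> commuting_lists G" by (auto simp: topspace_Hom_lst)
    then have "0 \<le> fst z * least_height (lst n (snd z))" by (simp add: least_height_nonneg)
    then show "f2 (fst z) (lst n (snd z)) \<in> loops_at y1"
      using loops_atD[OF f1_at[OF z(2)]] unfolding f2_def loops_at_def by auto
  qed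
  have f2_at: "f2 s xs \<in> loops_at y1" if "s \<in> topspace ?I" "xs \<in> commuting_lists G" for s xs
    by (rule tuple_family_at[OF f2_fam that])
  have f2_unit: "f2 s xs = loop_unit y1" if "xs \<in> commuting_lists G" "xs = [] \<or> \<one> \<in> set xs" for s xs
    using f1_unit[OF that] that least_height_eq_0_iff[OF that(1)] by (simp add: f2_def loop_unit_def)
  have f2_0: "f2 0 = f1" by (rule ext) (simp add: f2_def)
  have prod2_nf: "subseq_prod y1 (f2 s) (nf xs) = subseq_prod y1 (f2 s) xs"
    if "s \<in> topspace ?I" "xs \<in> commuting_lists G" for s xs
    by (rule subseq_prod_nf[OF f2_at f2_unit that(2)]) (use that in auto)
  have prod2_Nil: "subseq_prod y1 (f2 s) [] = loop_unit y1" if "s \<in> topspace ?I" for s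
    by (rule prod_Nil) (simp add: f2_unit Nil_commuting)
  obtain g2 where g2: "continuous_map (prod_topology ?I Y1) Y1 g2"
    "\<And>p xs t. \<lbrakk>p \<in> topspace ?I; xs \<in> commuting_lists G; t \<in> {0..1}\<rbrakk> \<Longrightarrow>
      g2 (p, comm_point xs t) = snd (subseq_prod y1 (f2 p) xs) (t * fst (subseq_prod y1 (f2 p) xs))"
    using comm_map_of_loops[OF P tuple_family_subseq_prod[OF f2_fam y1] prod2_nf prod2_Nil]
    unfolding Y1_def by blast

  have point: "\<exists>xs t. xs \<in> commuting_lists G \<and> t \<in> {0..1} \<and> y = comm_point xs t" if "y \<in> topspace Y1" for y
    using topspace_suspension_Comm that unfolding Y1_def by metis
  have y1_point: "y1 = comm_point [] 0" using base[OF Nil_commuting, of 0] by simp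
  have g1_0: "g1 (0, y) = y" if y: "y \<in> topspace Y1" for y
  proof -
    obtain xs t where xs: "xs \<in> commuting_lists G" "t \<in> {0..1}" "y = comm_point xs t" using point[OF y] by blast
    have "g1 (0, y) = snd (K xs) (t * fst (K xs))"
      using g1(2)[of 0 xs t] xs by (simp add: C_def H_0)
    also have "\<dots> = comm_point xs t"
    proof (cases "total_height xs = 0 \<or> t = 0 \<or> t = 1")
      case True
      then show ?thesis
        using base[OF xs(1,2)] total_height_eq_0[OF xs(1)] by (auto simp: K_def loop_of_def)
    next
      case False
      then have "0 < total_height xs" "0 < t" "t < 1" using total_height_nonneg[OF xs(1)] xs(2) by auto
      then show ?thesis by (simp add: K_def loop_of_def)
    qed
    finally show ?thesis using xs by simp
  qed
  have g12: "g1 (1, y) = g2 (0, y)" if "y \<in> topspace Y1" for y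
    using point[OF that] g1(2)[of 1] g2(2)[of 0] by (auto simp: C_def f2_0)
  have g1_base: "g1 (s, y1) = y1" if "s \<in> {0..1}" for s
    using g1(2)[of s "[]" 0] that Nil_commuting C_Nil[of s] by (auto simp: y1_point[symmetric] loop_unit_def)
  have g2_base: "g2 (s, y1) = y1" if "s \<in> {0..1}" for s
    using g2(2)[of s "[]" 0] that Nil_commuting prod2_Nil[of s] by (auto simp: y1_point[symmetric] loop_unit_def)
  let ?B = "\<lambda>k. k y1 = y1"
  define g where "g y = g2 (1, y)" for y
  have cont: "continuous_map Y1 Y1 (\<lambda>y. g2 (s, y))" if "s \<in> {0..1}" for s
    using that by (intro continuous_map_apply[OF g2(1)] continuous_map_pairedI cm_intros) auto
  have "homotopic_with ?B Y1 Y1 id (\<lambda>y. g2 (0, y))"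
    using y1 g1(1) g1_0 g12 g1_base by (subst homotopic_with) (auto intro!: exI[of _ g1])
  moreover have "homotopic_with ?B Y1 Y1 (\<lambda>y. g2 (0, y)) g"
    using y1 g2(1) g2_base by (subst homotopic_with) (auto intro!: exI[of _ g2] simp: g_def)
  ultimately have hom: "homotopic_with ?B Y1 Y1 id g" by (rule homotopic_with_trans)
  show thesis
  proof (rule that[of "f2 1" g])
    show "tuple_family G ?I Y1 y1 n (\<lambda>_. f2 1)" for n
    proof -
      have "continuous_map (prod_topology ?I (Hom G n)) (prod_topology ?I (Hom G n)) (\<lambda>w. (1, snd w))"
        by (intro continuous_map_pairedI cm_intros) auto
      from loop_family_compose[OF f2_fam[unfolded tuple_family_def] this] show ?thesis
        by (simp add: tuple_family_def)
    qed
    show "fst (f2 1 xs) = 0 \<longleftrightarrow> xs = [] \<or> \<one> \<in> set xs" if xs: "xs \<in> commuting_lists G" for xs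
    proof
      assume "fst (f2 1 xs) = 0"
      then have "least_height xs = 0"
        using loops_atD(1)[OF f1_at[OF xs]] least_height_nonneg[OF xs] by (simp add: f2_def)
      then show "xs = [] \<or> \<one> \<in> set xs" using least_height_eq_0_iff[OF xs] by simp
    next
      assume "xs = [] \<or> \<one> \<in> set xs"
      then show "fst (f2 1 xs) = 0" using f2_unit[OF xs] by (simp add: loop_unit_def)
    qed
    show "continuous_map Y1 Y1 g" unfolding g_def by (rule cont) simp
    show "g (comm_point xs t) = snd (subseq_prod y1 (f2 1) xs) (t * fst (subseq_prod y1 (f2 1) xs))"
      if "xs \<in> commuting_lists G" "t \<in> {0..1}" for xs t
      unfolding g_def using that by (intro g2(2)) auto
  qed (use f2_unit hom in auto)
qed

text \<open>One composite is strictly the map \<open>g\<close>, which is homotopic to the identity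
  by some \<open>D\<close>. For the other, \<open>\<Phi>\<close> after \<open>D\<close> joins
  \<open>\<Phi>\<close> to \<open>\<Phi> \<circ> \<Psi> \<circ> \<Phi>\<close>. As a family of loops
  this factors at its ends through \<open>\<iota>\<close> and through the image of
  \<open>\<iota>\<close> under \<open>\<Phi> \<circ> \<Psi>\<close>. A factorisation relative to the
  ends joins these two normalised families, which is a homotopy from the identity to
  \<open>\<Phi> \<circ> \<Psi>\<close>.\<close>

theorem suspension_Comm_homotopy_equivalent:
  "fst (suspension (Comm G)) homotopy_equivalent_space fst hat_wedge"
proof -
  let ?I = unit_interval
  define Y1 y1 Y2 y2 where "Y1 = fst (suspension (Comm G))" and "y1 = snd (suspension (Comm G))"
    and "Y2 = fst hat_wedge" and "y2 = snd hat_wedge"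
  note P = locally_compact_unit_interval Hausdorff_unit_interval
  have y1: "y1 \<in> topspace Y1" unfolding Y1_def y1_def by (rule suspension_base_in)
  have y2: "y2 \<in> topspace Y2" unfolding Y2_def y2_def by (rule wedge_base_in)
  obtain f g where f_fam: "\<And>n. tuple_family G ?I Y1 y1 n (\<lambda>_. f)"
    and f_0: "\<And>xs. xs \<in> commuting_lists G \<Longrightarrow> fst (f xs) = 0 \<longleftrightarrow> xs = [] \<or> \<one> \<in> set xs"
    and f_unit: "\<And>xs. \<lbrakk>xs \<in> commuting_lists G; xs = [] \<or> \<one> \<in> set xs\<rbrakk> \<Longrightarrow> f xs = loop_unit y1"
    and g_cont: "continuous_map Y1 Y1 g"
    and g_eq: "\<And>xs t. \<lbrakk>xs \<in> commuting_lists G; t \<in> {0..1}\<rbrakk> \<Longrightarrow>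
      g (comm_point xs t) = snd (subseq_prod y1 f xs) (t * fst (subseq_prod y1 f xs))"
    and g_hom: "homotopic_with (\<lambda>k. k y1 = y1) Y1 Y1 id g"
    by (rule tautological_factorisation[folded Y1_def y1_def]) (rule that)
  have f_at: "f xs \<in> loops_at y1" if "xs \<in> commuting_lists G" for xs
    using tuple_family_at[OF f_fam _ that, of 0] by simp
  have f_nonneg: "0 \<le> fst (f xs)" if "xs \<in> commuting_lists G" for xs
    using loops_atD(1)[OF f_at[OF that]] .
  have cbase: "comm_point xs t = y1" if "xs \<in> commuting_lists G" "t \<in> {0..1}" "nf xs = [] \<or> t = 0 \<or> t = 1" for xs t
    unfolding y1_def by (rule comm_point_base[OF that])
  have wbase: "wedge_point xs t = y2"
    if "xs \<in> commuting_lists G" "xs \<noteq> []" "t \<in> {0..1}" "\<one> \<in> set xs \<or> t = 0 \<or> t = 1" for xs t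
    unfolding y2_def by (rule wedge_point_base[OF that])
  have y1_point: "y1 = comm_point [] 0" using cbase[OF Nil_commuting, of 0] by simp
  have y2_point: "y2 = wedge_point [\<one>] 0" using wbase[OF one_commuting, of 0] by simp

  \<comment> \<open>The universal normalised family. For \<open>xs = []\<close> there is no summand
    of the wedge, but the length 0 makes the value the unit loop.\<close>
  define \<iota> where "\<iota> xs = loop_of y2 (fst (f xs)) (wedge_point xs)" for xs
  have \<iota>_unit: "\<iota> xs = loop_unit y2" if "xs \<in> commuting_lists G" "xs = [] \<or> \<one> \<in> set xs" for xs
    using f_0[OF that(1)] that(2) by (simp add: \<iota>_def loop_of_0)
  have \<iota>_fam: "tuple_family G ?I Y2 y2 n (\<lambda>_. \<iota>)" for n
  proof (cases "n = 0")
    case True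
    then show ?thesis
      using \<iota>_unit[OF Nil_commuting] loop_family_unit[OF y2] by (simp add: tuple_family_def lst_def)
  next
    case False
    then have nonempty: "lst n x \<noteq> []" for x :: "nat \<Rightarrow> 'a" by (auto simp flip: length_0_conv)
    show ?thesis
      unfolding tuple_family_def \<iota>_def
    proof (rule loop_family_of)
      let ?Z = "prod_topology ?I (Hom G n)"
      show "continuous_map ?Z euclideanreal (\<lambda>z. fst (f (lst n (snd z))))"
        by (rule loop_familyD(1)[OF f_fam[unfolded tuple_family_def]])
      have "continuous_map (prod_topology ?Z ?I) (prod_topology (Hom G n) ?I) (\<lambda>x. (snd (fst x), snd x))"
        by (intro cm_intros)
      from continuous_map_apply[OF continuous_wedge_point this] False
      show "continuous_map (prod_topology ?Z ?I) Y2 (\<lambda>x. wedge_point (lst n (snd (fst x))) (snd x))"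
        by (simp add: Y2_def)
      show "wedge_point (lst n (snd z)) t = y2"
        if "z \<in> topspace ?Z" "fst (f (lst n (snd z))) = 0" "t \<in> {0..1}" for z t
        using that f_0[of "lst n (snd z)"] nonempty
        by (intro wbase) (simp_all add: topspace_Hom_lst mem_Times_iff)
    qed (simp_all add: topspace_Hom_lst f_nonneg nonempty wbase mem_Times_iff)
  qed
  have \<iota>_at: "\<iota> xs \<in> loops_at y2" if "xs \<in> commuting_lists G" for xs
    using tuple_family_at[OF \<iota>_fam _ that, of 0] by simp
  define \<xi> where "\<xi> xs = subseq_prod y2 \<iota> xs" for xs
  have \<xi>_fam: "tuple_family G ?I Y2 y2 n (\<lambda>_. \<xi>)" for n
    using tuple_family_subseq_prod[OF \<iota>_fam y2, of n] by (simp add: \<xi>_def[abs_def])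
  have \<xi>_at: "\<xi> xs \<in> loops_at y2" if "xs \<in> commuting_lists G" for xs
    using tuple_family_at[OF \<xi>_fam _ that, of 0] by simp
  have \<xi>_nf: "\<xi> (nf xs) = \<xi> xs" if "xs \<in> commuting_lists G" for xs
    unfolding \<xi>_def by (rule subseq_prod_nf[OF \<iota>_at \<iota>_unit that]) auto
  have \<xi>_Nil: "\<xi> [] = loop_unit y2"
    using \<iota>_unit[OF Nil_commuting] by (simp add: \<xi>_def subseq_prod_def loop_prod_def loop_mult_unit_left)

  \<comment> \<open>The maps \<open>\<Phi>\<close> and \<open>\<Psi>\<close> between the suspension
    and the wedge\<close>
  obtain \<Phi>' where \<Phi>': "continuous_map (prod_topology ?I Y1) Y2 \<Phi>'"
    "\<And>p xs t. \<lbrakk>p \<in> topspace ?I; xs \<in> commuting_lists G; t \<in> {0..1}\<rbrakk> \<Longrightarrow>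
      \<Phi>' (p, comm_point xs t) = snd (\<xi> xs) (t * fst (\<xi> xs))"
    using comm_map_of_loops[OF P \<xi>_fam \<xi>_nf \<xi>_Nil] unfolding Y1_def by blast
  obtain \<Psi>' where \<Psi>': "continuous_map (prod_topology ?I Y2) Y1 \<Psi>'"
    "\<And>p xs t. \<lbrakk>p \<in> topspace ?I; xs \<in> commuting_lists G; xs \<noteq> []; t \<in> {0..1}\<rbrakk> \<Longrightarrow>
      \<Psi>' (p, wedge_point xs t) = snd (f xs) (t * fst (f xs))"
    using wedge_map_of_loops[OF P f_fam f_unit] unfolding Y2_def by blast
  define \<Phi> where "\<Phi> y = \<Phi>' (0, y)" for y
  define \<Psi> where "\<Psi> y = \<Psi>' (0, y)" for y
  have slice: "continuous_map X (prod_topology ?I X) (\<lambda>y. (0, y))" for X :: "'x topology"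
    by (intro continuous_map_pairedI cm_intros) auto
  have \<Phi>_cont: "continuous_map Y1 Y2 \<Phi>"
    unfolding \<Phi>_def by (rule continuous_map_apply[OF \<Phi>'(1) slice])
  have \<Psi>_cont: "continuous_map Y2 Y1 \<Psi>"
    unfolding \<Psi>_def by (rule continuous_map_apply[OF \<Psi>'(1) slice])
  have \<Phi>: "\<Phi> (comm_point xs t) = snd (\<xi> xs) (t * fst (\<xi> xs))" if "xs \<in> commuting_lists G" "t \<in> {0..1}" for xs t
    unfolding \<Phi>_def using that by (intro \<Phi>'(2)) auto
  have \<Psi>: "\<Psi> (wedge_point xs t) = snd (f xs) (t * fst (f xs))"
    if "xs \<in> commuting_lists G" "xs \<noteq> []" "t \<in> {0..1}" for xs t
    unfolding \<Psi>_def using that by (intro \<Psi>'(2)) auto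
  have \<Phi>_base: "\<Phi> y1 = y2"
    unfolding y1_point using \<Phi>[OF Nil_commuting, of 0] loops_atD(2)[OF \<xi>_at[OF Nil_commuting]] by simp
  have \<Psi>_base: "\<Psi> y2 = y1"
    unfolding y2_point using \<Psi>[OF one_commuting, of 0] loops_atD(2)[OF f_at[OF one_commuting]] by simp
  have \<Psi>\<iota>: "loop_map \<Psi> (\<iota> xs) = f xs" if xs: "xs \<in> commuting_lists G" for xs
  proof (cases "xs = []")
    case True
    then show ?thesis
      using \<iota>_unit[OF xs] f_unit[OF xs] \<Psi>_base by (simp add: loop_map_unit)
  next
    case False
    have "loop_map \<Psi> (\<iota> xs) = loop_of y1 (fst (f xs)) (\<lambda>t. \<Psi> (wedge_point xs t))"
      by (auto simp: loop_map_def \<iota>_def loop_of_def \<Psi>_base fun_eq_iff)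
    also have "\<dots> = f xs"
      by (rule loop_of_self[OF f_at[OF xs]]) (rule \<Psi>[OF xs False])
    finally show ?thesis .
  qed
  have \<Psi>\<xi>: "loop_map \<Psi> (\<xi> xs) = subseq_prod y1 f xs" if "xs \<in> commuting_lists G" for xs
    unfolding \<xi>_def loop_map_subseq_prod[of \<Psi> y2 y1, OF \<Psi>_base]
    using commuting_lists_subseqs[OF that] by (intro subseq_prod_cong \<Psi>\<iota>)
  have cpoint: "\<exists>xs t. xs \<in> commuting_lists G \<and> t \<in> {0..1} \<and> y = comm_point xs t" if "y \<in> topspace Y1" for y
    using topspace_suspension_Comm that unfolding Y1_def by metis
  have wpoint: "\<exists>xs t. xs \<in> commuting_lists G \<and> xs \<noteq> [] \<and> t \<in> {0..1} \<and> y = wedge_point xs t" if "y \<in> topspace Y2" for y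
    using topspace_hat_wedge that unfolding Y2_def by metis
  have \<Psi>\<Phi>: "\<Psi> (\<Phi> y) = g y" if y: "y \<in> topspace Y1" for y
  proof -
    obtain xs t where xs: "xs \<in> commuting_lists G" "t \<in> {0..1}" "y = comm_point xs t" using cpoint[OF y] by blast
    have "\<Psi> (\<Phi> y) = snd (loop_map \<Psi> (\<xi> xs)) (t * fst (loop_map \<Psi> (\<xi> xs)))"
      using \<Phi>[OF xs(1,2)] xs(3) by (simp add: loop_map_def)
    then show ?thesis using g_eq[OF xs(1,2)] xs(3) \<Psi>\<xi>[OF xs(1)] by simp
  qed
  obtain D where D: "continuous_map (prod_topology ?I Y1) Y1 D"
    and D0: "\<And>y. y \<in> topspace Y1 \<Longrightarrow> D (0, y) = y"
    and D1: "\<And>y. y \<in> topspace Y1 \<Longrightarrow> D (1, y) = \<Psi> (\<Phi> y)"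
    and Db: "\<And>s. s \<in> {0..1} \<Longrightarrow> D (s, y1) = y1"
    using g_hom y1 \<Psi>\<Phi> by (subst (asm) homotopic_with) auto

  \<comment> \<open>Factorising \<open>\<Phi>\<close> after \<open>D\<close> relative to its
    ends\<close>
  define W where "W xs = fst (\<xi> xs)" for xs
  \<comment> \<open>With the length of \<open>\<xi> xs\<close>, the family is equal to
    \<open>\<xi>\<close> at \<open>p = 0\<close> and to its image under
    \<open>\<Phi> \<circ> \<Psi>\<close> at \<open>p = 1\<close>, not just up to
    reparametrisation.\<close>
  define K where "K p xs = loop_of y2 (W xs) (\<lambda>t. \<Phi> (D (p, comm_point xs t)))" for p xs
  define \<phi> where "\<phi> p xs = (if p = 0 then \<iota> xs else loop_map (\<Phi> \<circ> \<Psi>) (\<iota> xs))" for p :: real and xs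
  \<comment> \<open>Dilation about \<open>1/2\<close> by the factor \<open>1 + s\<close>, clamped to
    the interval, pushes points near the ends into the ends. With
    \<open>m = \<bar>2 * p - 1\<bar>\<close>, arrival means \<open>(1 + s) * m \<ge> 1\<close>. The
    time \<open>s = 2 * (1 - m)\<close> suffices for \<open>m \<ge> 1/2\<close>, since then
    \<open>(1 + s) * m - 1 = (2 * m - 1) * (1 - m)\<close>.\<close>
  define q where "q p s = max 0 (min 1 (1 / 2 + (1 + s) * (p - 1 / 2)))" for p s :: real
  define eP where "eP p = min 1 (2 * (1 - \<bar>2 * p - 1\<bar>))" for p :: real
  have W_nonneg: "0 \<le> W xs" if "xs \<in> commuting_lists G" for xs
    unfolding W_def by (rule loops_atD(1)[OF \<xi>_at[OF that]])
  \<comment> \<open>The length of \<open>\<xi> xs\<close> is the sum over all sublists, singletons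
    included, and \<open>\<iota> [x]\<close> has length 0 only if \<open>x\<close> is the
    unit.\<close>
  have W_0: "nf xs = []" if xs: "xs \<in> commuting_lists G" and W: "W xs = 0" for xs
  proof -
    have "x = \<one>" if x: "x \<in> set xs" for x
    proof -
      have "sum_list (map (\<lambda>ys. fst (\<iota> ys)) (subseqs xs)) = 0"
        using W by (simp add: W_def \<xi>_def subseq_prod_def fst_loop_prod o_def)
      then have "fst (\<iota> [x]) = 0"
        using singleton_in_subseqs[OF x] commuting_lists_subseqs[OF xs] f_nonneg
        by (subst (asm) sum_list_nonneg_eq_0_iff) (auto simp: \<iota>_def loop_of_def)
      then show ?thesis
        using f_0[OF commuting_lists_subseqs[OF xs singleton_in_subseqs[OF x]]] by (simp add: \<iota>_def loop_of_def)
    qed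
    then show ?thesis by (auto simp: nf_eq_Nil_iff)
  qed
  have K_fam: "tuple_family G ?I Y2 y2 n K" for n
    unfolding tuple_family_def K_def
  proof (rule loop_family_of)
    let ?Z = "prod_topology ?I (Hom G n)"
    show "continuous_map ?Z euclideanreal (\<lambda>z. W (lst n (snd z)))"
      unfolding W_def by (rule loop_familyD(1)[OF \<xi>_fam[unfolded tuple_family_def]])
    have "continuous_map (prod_topology ?Z ?I) (prod_topology (Hom G n) ?I) (\<lambda>x. (snd (fst x), snd x))"
      by (intro cm_intros)
    from continuous_map_apply[OF continuous_comm_point this]
    have *: "continuous_map (prod_topology ?Z ?I) Y1 (\<lambda>x. comm_point (lst n (snd (fst x))) (snd x))"
      by (simp add: Y1_def)
    show "continuous_map (prod_topology ?Z ?I) Y2 (\<lambda>x. \<Phi> (D (fst (fst x), comm_point (lst n (snd (fst x))) (snd x))))"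
      by (intro continuous_map_apply[OF \<Phi>_cont] continuous_map_apply[OF D] continuous_map_pairedI *
          continuous_map_projections)
  qed (simp_all add: topspace_Hom_lst W_nonneg cbase W_0 Db \<Phi>_base mem_Times_iff)
  have \<Phi>\<Psi>_base: "(\<Phi> \<circ> \<Psi>) y2 = y2" by (simp add: \<Phi>_base \<Psi>_base)
  interpret FP: factor_problem G e h ?I "{0, 1}" q eP Y2 y2 K \<phi>
  proof
    show "closedin ?I {0, 1}" by (auto simp: closedin_subtopology intro!: exI[of _ "{0, 1}"])
    show "continuous_map ?I euclideanreal eP"
      unfolding eP_def by (auto intro!: continuous_intros)
    show "eP p \<in> {0..1}" if "p \<in> topspace ?I" for p using that by (auto simp: eP_def abs_if)
    show "eP p = 0" if "p \<in> {0, 1}" for p using that by (auto simp: eP_def)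
    show "continuous_map (prod_topology ?I (top_of_set {0..1})) ?I (\<lambda>x. q (fst x) (snd x))"
      unfolding q_def by (auto intro!: continuous_intros)
    show "q p 0 = p" if "p \<in> topspace ?I" for p using that by (auto simp: q_def)
    show "q p s \<in> {0, 1}" if "p \<in> topspace ?I" "eP p < 1" "s \<in> {eP p..1}" for p s
    proof -
      have p: "0 \<le> p" "p \<le> 1" using that(1) by auto
      have s: "2 * (1 - \<bar>2 * p - 1\<bar>) \<le> s" "0 \<le> s" "1 / 2 < \<bar>2 * p - 1\<bar>"
        using that p by (auto simp: eP_def min_def abs_if split: if_splits)
      define m where "m = \<bar>2 * p - 1\<bar>"
      have m: "1 / 2 < m" "m \<le> 1" using s p by (auto simp: m_def)
      have "(1 + 2 * (1 - m)) * m \<le> (1 + s) * m"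
        using s(1) m by (intro mult_right_mono) (auto simp: m_def)
      moreover have "1 \<le> (1 + 2 * (1 - m)) * m"
      proof -
        have "0 \<le> (2 * m - 1) * (1 - m)" using m by (intro mult_nonneg_nonneg) auto
        then show ?thesis by (simp add: algebra_simps)
      qed
      ultimately have big: "1 \<le> (1 + s) * m" by linarith
      show ?thesis
      proof (cases "1 / 2 \<le> p")
        case True
        then have "m = 2 * (p - 1 / 2)" using p by (simp add: m_def)
        then have "(1 + s) * m = 2 * ((1 + s) * (p - 1 / 2))" by (simp only: mult.left_commute)
        with big have "1 \<le> 2 * ((1 + s) * (p - 1 / 2))" by simp
        then have "1 \<le> 1 / 2 + (1 + s) * (p - 1 / 2)" by linarith
        then show ?thesis by (simp add: q_def)
      next
        case False
        then have "m = - (2 * (p - 1 / 2))" using p by (simp add: m_def)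
        then have "(1 + s) * m = - (2 * ((1 + s) * (p - 1 / 2)))"
          by (simp only: mult_minus_right mult.left_commute)
        with big have "1 \<le> - (2 * ((1 + s) * (p - 1 / 2)))" by simp
        then have "1 / 2 + (1 + s) * (p - 1 / 2) \<le> 0" by linarith
        then show ?thesis by (simp add: q_def)
      qed
    qed
    show "y2 \<in> topspace Y2" by (rule y2)
    show "tuple_family G ?I Y2 y2 n K" for n by (rule K_fam)
    show "K p (nf xs) = K p xs" if "xs \<in> commuting_lists G" for p xs
      using comm_point_nf[OF that] \<xi>_nf[OF that] by (simp add: K_def W_def)
    show "K p [] = loop_unit y2" for p
    proof -
      have "W [] = 0" by (simp add: W_def \<xi>_Nil loop_unit_def)
      then show ?thesis by (simp add: K_def loop_of_0)
    qed
    show "tuple_family G (subtopology ?I {0, 1}) Y2 y2 n \<phi>" for n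
      unfolding tuple_family_def
    proof (rule loop_family_pasting[where I = "{0, 1}" and S = "\<lambda>p. {p} \<times> topspace (Hom G n)"])
      let ?Z = "prod_topology (subtopology ?I {0, 1}) (Hom G n)"
      fix p :: real assume p: "p \<in> {0, 1}"
      show "closedin ?Z ({p} \<times> topspace (Hom G n))"
        using p by (auto simp: closedin_prod_Times_iff closedin_subtopology intro!: exI[of _ "{p}"])
      have "continuous_map (subtopology ?Z ({p} \<times> topspace (Hom G n))) (prod_topology ?I (Hom G n))
          (\<lambda>w. (fst w, snd w))"
        by (intro continuous_map_pairedI cm_intros
            continuous_map_from_subtopology[OF continuous_map_apply[OF continuous_map_subtopology_ident
              continuous_map_projections(1)]])
      from loop_family_compose[OF \<iota>_fam[unfolded tuple_family_def] this]
      have \<iota>: "loop_family (subtopology ?Z ({p} \<times> topspace (Hom G n))) Y2 y2 (\<lambda>w. \<iota> (lst n (snd w)))" by simp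
      have "continuous_map Y2 Y2 (\<Phi> \<circ> \<Psi>)" by (rule continuous_map_compose[OF \<Psi>_cont \<Phi>_cont])
      from loop_family_map[OF \<iota> this \<Phi>\<Psi>_base]
      have \<phi>1: "loop_family (subtopology ?Z ({p} \<times> topspace (Hom G n))) Y2 y2
          (\<lambda>w. loop_map (\<Phi> \<circ> \<Psi>) (\<iota> (lst n (snd w))))" .
      show "loop_family (subtopology ?Z ({p} \<times> topspace (Hom G n))) Y2 y2 (\<lambda>w. \<phi> (fst w) (lst n (snd w)))"
      proof (cases "p = 0")
        case True
        show ?thesis by (rule loop_family_eq[OF \<iota>]) (auto simp: \<phi>_def True)
      next
        case False
        show ?thesis by (rule loop_family_eq[OF \<phi>1]) (use False in \<open>auto simp: \<phi>_def\<close>)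
      qed
    qed auto
    show "\<phi> p xs = loop_unit y2" if "xs \<in> commuting_lists G" "xs = [] \<or> \<one> \<in> set xs" for p xs
      using \<iota>_unit[OF that] loop_map_unit[of "\<Phi> \<circ> \<Psi>" y2 y2, OF \<Phi>\<Psi>_base] by (simp add: \<phi>_def)
    show "K p xs = subseq_prod y2 (\<phi> p) xs" if p: "p \<in> {0, 1}" and xs: "xs \<in> commuting_lists G" for p xs
    proof -
      have Y1_point: "comm_point xs t \<in> topspace Y1" if "t \<in> {0..1}" for t
        using continuous_map_funspace[OF continuous_comm_point[of "length xs"]] tup_topspace_Hom[OF xs] that
        by (fastforce simp: Pi_iff Y1_def)
      show ?thesis
      proof (cases "p = 0")
        case True
        have "K p xs = \<xi> xs"
          unfolding K_def W_def True by (rule loop_of_self[OF \<xi>_at[OF xs]]) (simp add: D0 Y1_point \<Phi> xs)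
        then show ?thesis by (simp add: True \<phi>_def[abs_def] \<xi>_def)
      next
        case False
        then have p1: "p = 1" using p by simp
        let ?c = "loop_map (\<Phi> \<circ> \<Psi>) (\<xi> xs)"
        have c: "?c \<in> loops_at y2" by (rule loop_map_at[of _ y2, OF \<xi>_at[OF xs]]) (rule \<Phi>\<Psi>_base)
        have "K p xs = loop_of y2 (fst ?c) (\<lambda>t. \<Phi> (D (p, comm_point xs t)))"
          by (simp add: K_def W_def loop_map_def)
        also have "\<dots> = ?c"
          by (rule loop_of_self[OF c]) (simp add: p1 D1 Y1_point \<Phi> xs loop_map_def)
        also have "\<dots> = subseq_prod y2 (\<phi> p) xs"
          unfolding \<xi>_def loop_map_subseq_prod[of "\<Phi> \<circ> \<Psi>" y2 y2, OF \<Phi>\<Psi>_base] by (simp add: p1 \<phi>_def[abs_def])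
        finally show ?thesis .
      qed
    qed
  qed
  obtain f2 H2 where f2: "\<And>n. tuple_family G ?I Y2 y2 n f2"
    and sol: "\<And>p xs. \<lbrakk>p \<in> topspace ?I; xs \<in> commuting_lists G\<rbrakk> \<Longrightarrow> FP.solves_at f2 H2 p xs"
    by (rule FP.solution_exists) (rule that)
  have f2_unit: "f2 p xs = loop_unit y2" if "p \<in> topspace ?I" "xs \<in> commuting_lists G" "\<one> \<in> set xs" for p xs
    using sol[OF that(1,2)] that(3) by (simp add: FP.solves_at_def)
  have f2_end: "f2 p xs = \<phi> p xs" if "p \<in> {0, 1}" "xs \<in> commuting_lists G" for p xs
    using sol[of p xs] that by (auto simp: FP.solves_at_def)
  obtain g2 where g2: "continuous_map (prod_topology ?I Y2) Y2 g2"
    "\<And>p xs t. \<lbrakk>p \<in> topspace ?I; xs \<in> commuting_lists G; xs \<noteq> []; t \<in> {0..1}\<rbrakk> \<Longrightarrow>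
      g2 (p, wedge_point xs t) = snd (f2 p xs) (t * fst (f2 p xs))"
    using wedge_map_of_loops[OF P f2 f2_unit] unfolding Y2_def by blast
  \<comment> \<open>Traversed at constant speed, the universal loop at \<open>xs\<close> is the
    suspension coordinate itself; hence the homotopy \<open>g2\<close> starts at the
    identity.\<close>
  have \<iota>_point: "snd (\<iota> xs) (t * fst (\<iota> xs)) = wedge_point xs t"
    if xs: "xs \<in> commuting_lists G" "xs \<noteq> []" "t \<in> {0..1}" for xs t
  proof (cases "fst (f xs) = 0 \<or> t = 0 \<or> t = 1")
    case True
    then show ?thesis using wbase[OF xs] f_0[OF xs(1)] xs(2) by (auto simp: \<iota>_def loop_of_def)
  next
    case False
    then have "0 < fst (f xs)" "0 < t" "t < 1" using f_nonneg[OF xs(1)] xs(3) by auto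
    then show ?thesis by (simp add: \<iota>_def loop_of_def)
  qed
  have g2_0: "g2 (0, y) = y" and g2_1: "g2 (1, y) = \<Phi> (\<Psi> y)" if y: "y \<in> topspace Y2" for y
  proof -
    obtain xs t where xs: "xs \<in> commuting_lists G" "xs \<noteq> []" "t \<in> {0..1}" and y: "y = wedge_point xs t"
      using wpoint[OF y] by blast
    have "g2 (0, y) = snd (\<iota> xs) (t * fst (\<iota> xs))"
      using g2(2)[of 0 xs t] xs f2_end[of 0 xs] by (simp add: y \<phi>_def)
    then show "g2 (0, y) = y" by (simp only: \<iota>_point[OF xs] y)
    have "g2 (1, y) = (\<Phi> \<circ> \<Psi>) (snd (\<iota> xs) (t * fst (\<iota> xs)))"
      using g2(2)[of 1 xs t] xs f2_end[of 1 xs] by (simp add: y \<phi>_def loop_map_def)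
    then show "g2 (1, y) = \<Phi> (\<Psi> y)" by (simp only: \<iota>_point[OF xs] y o_apply)
  qed
  have "homotopic_with (\<lambda>k. True) Y1 Y1 (\<Psi> \<circ> \<Phi>) id"
    by (subst homotopic_with_sym, subst homotopic_with) (use D D0 D1 in \<open>auto intro!: exI[of _ D]\<close>)
  moreover have "homotopic_with (\<lambda>k. True) Y2 Y2 (\<Phi> \<circ> \<Psi>) id"
    by (subst homotopic_with_sym, subst homotopic_with) (use g2(1) g2_0 g2_1 in \<open>auto intro!: exI[of _ g2]\<close>)
  ultimately show ?thesis
    using \<Phi>_cont \<Psi>_cont unfolding homotopy_equivalent_space_def Y1_def[symmetric] Y2_def[symmetric]
    by (intro exI[of _ \<Phi>] exI[of _ \<Psi>] conjI)
qed

end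

section \<open>Exponential and logarithm in a Banach algebra\<close>

text \<open>Telescoping that respects the order of the factors: split off \<open>X\<close> on the
  left and \<open>Y\<close> on the right.\<close>

lemma norm_power_diff_le:
  fixes X Y :: "'a::real_normed_algebra_1"
  assumes "norm X \<le> r" "norm Y \<le> r"
  shows "norm (X ^ Suc n - Y ^ Suc n) \<le> real (Suc n) * r ^ n * norm (X - Y)"
proof (induction n)
  case (Suc n)
  have r: "0 \<le> r" using assms(1) norm_ge_zero order_trans by blast
  have "X ^ Suc (Suc n) - Y ^ Suc (Suc n) = X * (X ^ Suc n - Y ^ Suc n) + (X - Y) * Y ^ Suc n"
    by (simp add: algebra_simps)
  then have "norm (X ^ Suc (Suc n) - Y ^ Suc (Suc n))
      \<le> norm X * norm (X ^ Suc n - Y ^ Suc n) + norm (X - Y) * norm (Y ^ Suc n)"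
    by (simp only:) (intro order_trans[OF norm_triangle_ineq] add_mono norm_mult_ineq)
  also have "\<dots> \<le> r * (real (Suc n) * r ^ n * norm (X - Y)) + norm (X - Y) * r ^ Suc n"
  proof (intro add_mono mult_mono Suc.IH assms(1) order_refl)
    show "norm (Y ^ Suc n) \<le> r ^ Suc n"
      by (rule order_trans[OF norm_power_ineq power_mono[OF assms(2) norm_ge_zero]])
  qed (use r in auto)
  also have "\<dots> = real (Suc (Suc n)) * r ^ Suc n * norm (X - Y)"
    by (simp add: algebra_simps)
  finally show ?case .
qed simp

text \<open>Termwise comparison: \<open>(n + 1) r^n / (n + 1)!\<close> is the \<open>n\<close>-th
  term of \<open>exp r\<close>. Removing the linear term from the difference removes the leading 1
  of this majorant.\<close>

lemma norm_exp_diff_le: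
  fixes X Y :: "'a::{real_normed_algebra_1, banach}"
  assumes "norm X \<le> r" "norm Y \<le> r"
  shows "norm (exp X - exp Y - (X - Y)) \<le> (exp r - 1) * norm (X - Y)"
    and "norm (exp X - exp Y) \<le> exp r * norm (X - Y)"
proof -
  define a where "a n = (X ^ n - Y ^ n) /\<^sub>R fact n" for n
  define b where "b n = r ^ n /\<^sub>R fact n * norm (X - Y)" for n
  have "a = (\<lambda>n. X ^ n /\<^sub>R fact n - Y ^ n /\<^sub>R fact n)"
    by (rule ext) (simp add: a_def scaleR_diff_right)
  then have a: "a sums (exp X - exp Y)"
    using sums_diff[OF exp_converges[of X] exp_converges[of Y]] by simp
  have b: "b sums (exp r * norm (X - Y))"
    unfolding b_def by (intro sums_mult2 exp_converges)
  have ab: "norm (a (Suc n)) \<le> b n" for n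
  proof -
    have "norm (a (Suc n)) \<le> (real (Suc n) * r ^ n * norm (X - Y)) / fact (Suc n)"
      using divide_right_mono[OF norm_power_diff_le[OF assms, of n], of "fact (Suc n)"]
      by (simp add: a_def divide_inverse mult.commute)
    also have "\<dots> = b n" by (simp add: b_def divide_simps)
    finally show ?thesis .
  qed
  have a1: "(\<lambda>n. a (Suc n)) sums (exp X - exp Y)"
    using a by (subst sums_Suc_iff) (simp add: a_def)
  have "norm (\<Sum>n. a (Suc n)) \<le> (\<Sum>n. b n)"
    by (intro norm_suminf_le ab) (use b in \<open>auto simp: sums_iff\<close>)
  then show "norm (exp X - exp Y) \<le> exp r * norm (X - Y)"
    using a1 b by (simp add: sums_iff)
  have a2: "(\<lambda>n. a (Suc (Suc n))) sums (exp X - exp Y - (X - Y))"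
    using a1 by (subst sums_Suc_iff) (simp add: a_def)
  have b1: "(\<lambda>n. b (Suc n)) sums ((exp r - 1) * norm (X - Y))"
    using b by (subst sums_Suc_iff) (simp add: b_def algebra_simps)
  have "norm (\<Sum>n. a (Suc (Suc n))) \<le> (\<Sum>n. b (Suc n))"
    by (intro norm_suminf_le ab) (use b1 in \<open>auto simp: sums_iff\<close>)
  then show "norm (exp X - exp Y - (X - Y)) \<le> (exp r - 1) * norm (X - Y)"
    using a2 b1 by (simp add: sums_iff)
qed

lemma exp_commute:
  fixes X x :: "'a::{real_normed_algebra_1, banach}"
  assumes "x * X = X * x"
  shows "x * exp X = exp X * x"
proof -
  have "(\<lambda>n. x * (X ^ n /\<^sub>R fact n)) sums (x * exp X)"
    by (intro bounded_linear.sums[OF bounded_linear_mult_right] exp_converges)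
  moreover have "(\<lambda>n. (X ^ n /\<^sub>R fact n) * x) sums (exp X * x)"
    by (intro bounded_linear.sums[OF bounded_linear_mult_left] exp_converges)
  moreover have "x * (X ^ n /\<^sub>R fact n) = (X ^ n /\<^sub>R fact n) * x" for n
    using power_commuting_commutes[OF assms[symmetric], of n] by simp
  ultimately show ?thesis by (simp add: sums_iff)
qed

text \<open>
  Solving \<open>exp X = g\<close> by the iteration \<open>X \<mapsto> X - exp X + g\<close> keeps \<open>X\<close> in the double commutant of \<open>g\<close>.
\<close>

lemma logarithm_exists:
  fixes g :: "'a::{real_normed_algebra_1, banach}"
  assumes r: "0 < r" "exp r \<le> 3 / 2" and g: "norm (g - 1) \<le> r / 2"
  obtains X where "norm X \<le> r" "exp X = g" "\<And>x. x * g = g * x \<Longrightarrow> x * X = X * x"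
proof -
  define S where "S = cball 0 r \<inter> (\<Inter>x\<in>{x. x * g = g * x}. {X. x * X = X * x})"
  define T where "T X = X - exp X + g" for X :: 'a
  have "closed S"
    unfolding S_def
    by (intro closed_Int closed_cball closed_INT ballI closed_Collect_eq continuous_intros)
  then have S: "complete S" by (simp add: complete_eq_closed)
  have "0 \<in> S" using r by (simp add: S_def)
  \<comment> \<open>\<open>exp r - 1 \<le> 1 / 2\<close> gives the contraction factor
    \<open>1 / 2\<close>; the bound \<open>r / 2\<close> on \<open>g - 1\<close> is then what keeps
    the ball of radius \<open>r\<close> invariant.\<close>
  have dist: "dist (T X) (T Y) \<le> 1 / 2 * dist X Y" if "X \<in> S" "Y \<in> S" for X Y
  proof -
    have "norm (exp X - exp Y - (X - Y)) \<le> (exp r - 1) * norm (X - Y)"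
      using that by (intro norm_exp_diff_le) (auto simp: S_def)
    also have "\<dots> \<le> 1 / 2 * norm (X - Y)"
      using r(2) by (intro mult_right_mono) auto
    finally show ?thesis
      by (simp add: T_def dist_norm norm_minus_commute algebra_simps)
  qed
  have "T ` S \<subseteq> S"
  proof
    fix Z assume "Z \<in> T ` S"
    then obtain X where X: "X \<in> S" "Z = T X" by blast
    have "norm Z \<le> norm (T X - T 0) + norm (T 0)"
      using norm_triangle_ineq[of "T X - T 0" "T 0"] X(2) by simp
    also have "\<dots> \<le> 1 / 2 * norm X + r / 2"
      using dist[OF X(1) \<open>0 \<in> S\<close>] g by (simp add: dist_norm T_def)
    also have "\<dots> \<le> r" using X(1) by (simp add: S_def)
    finally have "norm Z \<le> r" .
    moreover have "x * Z = Z * x" if "x * g = g * x" for x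
    proof -
      have "x * X = X * x" using X(1) that by (simp add: S_def)
      then show ?thesis
        using exp_commute[of x X] that unfolding X(2) T_def by (simp add: algebra_simps)
    qed
    ultimately show "Z \<in> S" by (simp add: S_def)
  qed
  then have "\<exists>!X\<in>S. T X = X"
    using \<open>0 \<in> S\<close> dist by (intro Banach_fix[OF S, of "1 / 2"]) auto
  then obtain X where X: "X \<in> S" "T X = X" by blast
  then have "exp X = g" by (simp add: T_def algebra_simps)
  then show thesis using that X(1) by (auto simp: S_def)
qed

section \<open>Complex matrices as a Banach algebra\<close>

text \<open>
  On \<open>complex^'n^'n\<close> itself \<open>*\<close> is the componentwise product and the norm is the Frobenius norm.
\<close>

typedef (overloaded) 'n cmatrix = "UNIV :: (complex^'n^'n::finite) set"
  by simp

setup_lifting type_definition_cmatrix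

lemma bounded_linear_matrix_vector: "bounded_linear ((*v) (A :: complex^'n^'n))"
proof -
  have "linear ((*v) A)"
  proof (rule linearI)
    show "A *v (x + y) = A *v x + A *v y" for x y by (simp add: matrix_vector_right_distrib)
    show "A *v (r *\<^sub>R x) = r *\<^sub>R (A *v x)" for r x
      by (simp add: vec_eq_iff matrix_vector_mult_def scaleR_right.sum)
  qed
  then show ?thesis by (simp add: linear_linear)
qed

text \<open>The operator norm is submultiplicative and gives the unit matrix norm 1, as the class
  demands.\<close>

instantiation cmatrix :: (finite) real_normed_algebra_1
begin

lift_definition zero_cmatrix :: "'a cmatrix" is 0 .
lift_definition one_cmatrix :: "'a cmatrix" is "mat 1" .
lift_definition plus_cmatrix :: "'a cmatrix \<Rightarrow> 'a cmatrix \<Rightarrow> 'a cmatrix" is "(+)" .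
lift_definition minus_cmatrix :: "'a cmatrix \<Rightarrow> 'a cmatrix \<Rightarrow> 'a cmatrix" is "(-)" .
lift_definition uminus_cmatrix :: "'a cmatrix \<Rightarrow> 'a cmatrix" is "uminus" .
lift_definition times_cmatrix :: "'a cmatrix \<Rightarrow> 'a cmatrix \<Rightarrow> 'a cmatrix" is "(**)" .
lift_definition scaleR_cmatrix :: "real \<Rightarrow> 'a cmatrix \<Rightarrow> 'a cmatrix" is "(*\<^sub>R)" .
lift_definition norm_cmatrix :: "'a cmatrix \<Rightarrow> real" is "\<lambda>A. onorm ((*v) A)" .

definition dist_cmatrix :: "'a cmatrix \<Rightarrow> 'a cmatrix \<Rightarrow> real" where
  "dist_cmatrix A B = norm (A - B)"
definition sgn_cmatrix :: "'a cmatrix \<Rightarrow> 'a cmatrix" where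
  "sgn_cmatrix A = inverse (norm A) *\<^sub>R A"
definition uniformity_cmatrix :: "('a cmatrix \<times> 'a cmatrix) filter" where
  "uniformity_cmatrix = (INF e\<in>{0 <..}. principal {(x, y). dist x y < e})"
definition open_cmatrix :: "'a cmatrix set \<Rightarrow> bool" where
  "open_cmatrix U = (\<forall>x\<in>U. \<forall>\<^sub>F (x', y) in uniformity. x' = x \<longrightarrow> y \<in> U)"

instance
proof
  fix A B C :: "'a cmatrix" and r s :: real
  show "A + B + C = A + (B + C)" "A + B = B + A" "0 + A = A" "- A + A = 0" "A - B = A + - B"
    by (transfer, simp)+
  show "r *\<^sub>R (A + B) = r *\<^sub>R A + r *\<^sub>R B" "(r + s) *\<^sub>R A = r *\<^sub>R A + s *\<^sub>R A"
    "r *\<^sub>R s *\<^sub>R A = (r * s) *\<^sub>R A" "1 *\<^sub>R A = A"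
    by (transfer, simp add: scaleR_right_distrib scaleR_left_distrib)+
  show "A * B * C = A * (B * C)" by transfer (simp add: matrix_mul_assoc)
  show "(A + B) * C = A * C + B * C" "A * (B + C) = A * B + A * C"
    by (transfer, simp add: matrix_matrix_mult_def vec_eq_iff sum.distrib algebra_simps)+
  show "r *\<^sub>R A * B = r *\<^sub>R (A * B)" "A * r *\<^sub>R B = r *\<^sub>R (A * B)"
    by (transfer, simp add: matrix_matrix_mult_def vec_eq_iff scaleR_right.sum)+
  show "1 * A = A" "A * 1 = A" by (transfer, simp)+
  show "(0 :: 'a cmatrix) \<noteq> 1"
    by transfer (auto simp: vec_eq_iff mat_def)
  show "dist A B = norm (A - B)" by (simp add: dist_cmatrix_def)
  show "sgn A = inverse (norm A) *\<^sub>R A" by (simp add: sgn_cmatrix_def)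
  show "uniformity = (INF e\<in>{0 <..}. principal {(x :: 'a cmatrix, y). dist x y < e})"
    by (simp add: uniformity_cmatrix_def)
  show "open U = (\<forall>x\<in>U. \<forall>\<^sub>F (x', y) in uniformity. x' = x \<longrightarrow> y \<in> U)" for U :: "'a cmatrix set"
    by (simp add: open_cmatrix_def)
  show "norm A = 0 \<longleftrightarrow> A = 0"
    by transfer (auto simp: onorm_eq_0 bounded_linear_matrix_vector matrix_eq)
  show "norm (A + B) \<le> norm A + norm B"
  proof transfer
    fix A B :: "complex^'a^'a"
    have "(*v) (A + B) = (\<lambda>x. A *v x + B *v x)"
      by (simp add: matrix_vector_mult_add_rdistrib fun_eq_iff)
    then show "onorm ((*v) (A + B)) \<le> onorm ((*v) A) + onorm ((*v) B)"
      by (simp add: onorm_triangle bounded_linear_matrix_vector)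
  qed
  show "norm (r *\<^sub>R A) = \<bar>r\<bar> * norm A"
  proof transfer
    fix r and A :: "complex^'a^'a"
    have "(*v) (r *\<^sub>R A) = (\<lambda>x. r *\<^sub>R (A *v x))"
      by (auto simp: fun_eq_iff matrix_vector_mult_def vec_eq_iff scaleR_right.sum)
    then show "onorm ((*v) (r *\<^sub>R A)) = \<bar>r\<bar> * onorm ((*v) A)"
      by (simp add: onorm_scaleR bounded_linear_matrix_vector)
  qed
  show "norm (A * B) \<le> norm A * norm B"
  proof transfer
    fix A B :: "complex^'a^'a"
    have "(*v) (A ** B) = (*v) A \<circ> (*v) B"
      by (simp add: fun_eq_iff matrix_vector_mul_assoc)
    then show "onorm ((*v) (A ** B)) \<le> onorm ((*v) A) * onorm ((*v) B)"
      by (simp add: onorm_compose bounded_linear_matrix_vector)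
  qed
  show "norm (1 :: 'a cmatrix) = 1"
  proof transfer
    have "(*v) (mat 1 :: complex^'a^'a) = (\<lambda>x. x)" by (simp add: fun_eq_iff)
    then show "onorm ((*v) (mat 1 :: complex^'a^'a)) = 1" by (simp add: onorm_id)
  qed
qed

end

lemma linear_Rep_cmatrix: "linear Rep_cmatrix" and linear_Abs_cmatrix: "linear Abs_cmatrix"
  by (auto intro!: linearI simp: plus_cmatrix.rep_eq scaleR_cmatrix.rep_eq plus_cmatrix.abs_eq scaleR_cmatrix.abs_eq)

text \<open>An entry is a coordinate of the image of a basis vector and hence bounded by the
  operator norm.\<close>

lemma bounded_linear_Rep_cmatrix: "bounded_linear (Rep_cmatrix :: 'n::finite cmatrix \<Rightarrow> _)"
proof (intro bounded_linear.intro bounded_linear_axioms.intro linear_Rep_cmatrix exI allI)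
  fix A :: "'n cmatrix"
  let ?A = "Rep_cmatrix A"
  have entry: "norm (?A $ i $ j) \<le> norm A" for i j
  proof -
    have "norm (?A $ i $ j) = norm ((?A *v axis j 1) $ i)"
      by (simp add: matrix_vector_mult_def axis_def if_distrib cong: if_cong)
    also have "\<dots> \<le> norm (?A *v axis j 1)" by (rule Finite_Cartesian_Product.norm_nth_le)
    also have "\<dots> \<le> onorm ((*v) ?A) * norm (axis j 1 :: complex^'n)"
      by (rule onorm[OF bounded_linear_matrix_vector])
    also have "\<dots> = norm A" by (simp add: norm_cmatrix.rep_eq)
    finally show ?thesis .
  qed
  have "norm ?A \<le> (\<Sum>i\<in>UNIV. norm (?A $ i))"
    unfolding norm_vec_def by (rule L2_set_le_sum) simp
  also have "\<dots> \<le> (\<Sum>i\<in>UNIV. \<Sum>j\<in>UNIV. norm (?A $ i $ j))"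
    by (intro sum_mono) (unfold norm_vec_def, rule L2_set_le_sum, simp)
  also have "\<dots> \<le> (\<Sum>i\<in>(UNIV :: 'n set). \<Sum>j\<in>(UNIV :: 'n set). norm A)"
    by (intro sum_mono entry)
  finally show "norm ?A \<le> norm A * (real CARD('n) * real CARD('n))" by (simp add: mult_ac)
qed

lemma bounded_linear_Abs_cmatrix: "bounded_linear (Abs_cmatrix :: _ \<Rightarrow> 'n::finite cmatrix)"
  using linear_bounded[OF linear_Abs_cmatrix] linear_Abs_cmatrix
  by (auto simp: bounded_linear_def bounded_linear_axioms_def mult.commute)

instance cmatrix :: (finite) banach
proof
  fix X :: "nat \<Rightarrow> 'a cmatrix" assume "Cauchy X"
  then have "Cauchy (\<lambda>n. Rep_cmatrix (X n))"
    by (rule bounded_linear.Cauchy[OF bounded_linear_Rep_cmatrix])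
  then have "convergent (\<lambda>n. Rep_cmatrix (X n))" by (simp add: Cauchy_convergent_iff)
  then obtain L where "(\<lambda>n. Rep_cmatrix (X n)) \<longlonglongrightarrow> L" unfolding convergent_def ..
  then have "(\<lambda>n. Abs_cmatrix (Rep_cmatrix (X n))) \<longlonglongrightarrow> Abs_cmatrix L"
    by (rule bounded_linear.tendsto[OF bounded_linear_Abs_cmatrix])
  then show "convergent X" by (auto simp: Rep_cmatrix_inverse convergent_def)
qed

section \<open>The matrix exponential\<close>

definition mexp :: "complex^'n^'n \<Rightarrow> complex^'n^'n" where
  "mexp A = Rep_cmatrix (exp (Abs_cmatrix A))"

lemma Rep_Abs_cmatrix [simp]: "Rep_cmatrix (Abs_cmatrix A) = A"
  by (simp add: Abs_cmatrix_inverse)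

lemma mexp_0 [simp]: "mexp 0 = mat 1"
  by (simp add: mexp_def one_cmatrix.rep_eq flip: zero_cmatrix.abs_eq)

lemma mexp_add_scaled: "mexp ((s + t) *\<^sub>R X) = mexp (s *\<^sub>R X) ** mexp (t *\<^sub>R X)"
proof -
  have scale: "Abs_cmatrix (r *\<^sub>R X) = r *\<^sub>R Abs_cmatrix X" for r
    by (simp add: scaleR_cmatrix.abs_eq)
  have "exp (s *\<^sub>R Abs_cmatrix X + t *\<^sub>R Abs_cmatrix X) = exp (s *\<^sub>R Abs_cmatrix X) * exp (t *\<^sub>R Abs_cmatrix X)"
    by (rule exp_add_commuting) simp
  moreover have "Abs_cmatrix ((s + t) *\<^sub>R X) = s *\<^sub>R Abs_cmatrix X + t *\<^sub>R Abs_cmatrix X"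
    by (subst scale) (rule scaleR_left_distrib)
  ultimately show ?thesis by (simp only: mexp_def scale times_cmatrix.rep_eq)
qed

lemma mexp_minus: "mexp X ** mexp (- X) = mat 1" "mexp (- X) ** mexp X = mat 1"
  using mexp_add_scaled[of 1 "-1" X] mexp_add_scaled[of "-1" 1 X] by simp_all

lemma invertible_mexp: "invertible (mexp X)"
  unfolding invertible_def using mexp_minus by blast

lemma mexp_commute:
  assumes "x ** X = X ** x"
  shows "x ** mexp X = mexp X ** x"
proof -
  have "Abs_cmatrix x * Abs_cmatrix X = Abs_cmatrix X * Abs_cmatrix x"
    using assms by (simp add: times_cmatrix.abs_eq)
  from exp_commute[OF this] have "Rep_cmatrix (Abs_cmatrix x * exp (Abs_cmatrix X)) = Rep_cmatrix (exp (Abs_cmatrix X) * Abs_cmatrix x)"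
    by simp
  then show ?thesis by (simp add: times_cmatrix.rep_eq mexp_def)
qed

text \<open>Differentiability at 0 in the strict form, for pairs of points, is what yields a
  Lipschitz local inverse. The constants \<open>a\<close> and \<open>b\<close> compare the Frobenius
  norm with the operator norm.\<close>

lemma mexp_strict_derivative:
  assumes "0 < \<epsilon>"
  obtains \<delta> where "0 < \<delta>"
    "\<And>X Y :: complex^'n^'n. \<lbrakk>norm X < \<delta>; norm Y < \<delta>\<rbrakk> \<Longrightarrow> norm (mexp X - mexp Y - (X - Y)) \<le> \<epsilon> * norm (X - Y)"
proof -
  obtain a where a: "0 < a" "\<And>A :: complex^'n^'n. norm (Abs_cmatrix A) \<le> norm A * a"
    using bounded_linear.pos_bounded[OF bounded_linear_Abs_cmatrix] by metis
  obtain b where b: "0 < b" "\<And>A :: 'n cmatrix. norm (Rep_cmatrix A) \<le> norm A * b"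
    using bounded_linear.pos_bounded[OF bounded_linear_Rep_cmatrix] by metis
  define r where "r = ln (1 + \<epsilon> / (a * b))"
  have r: "0 < r" "exp r - 1 = \<epsilon> / (a * b)"
    using a b assms by (auto simp: r_def add_pos_pos)
  show thesis
  proof (rule that[of "r / a"])
    show "0 < r / a" using r a by simp
    fix X Y :: "complex^'n^'n" assume XY: "norm X < r / a" "norm Y < r / a"
    let ?X = "Abs_cmatrix X" and ?Y = "Abs_cmatrix Y"
    have XY': "norm ?X \<le> r" "norm ?Y \<le> r"
      using a(2)[of X] a(2)[of Y] XY a(1) by (auto simp: pos_less_divide_eq)
    have "mexp X - mexp Y - (X - Y) = Rep_cmatrix (exp ?X - exp ?Y - (?X - ?Y))"
      by (simp add: mexp_def minus_cmatrix.rep_eq)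
    then have "norm (mexp X - mexp Y - (X - Y)) \<le> norm (exp ?X - exp ?Y - (?X - ?Y)) * b"
      using b(2) by simp
    also have "\<dots> \<le> (\<epsilon> / (a * b) * norm (?X - ?Y)) * b"
      using norm_exp_diff_le(1)[OF XY'] b(1) by (intro mult_right_mono) (auto simp: r(2))
    also have "\<dots> \<le> (\<epsilon> / (a * b) * (norm (X - Y) * a)) * b"
      using a(2)[of "X - Y"] a(1) b(1) assms
      by (intro mult_right_mono mult_left_mono) (auto simp: minus_cmatrix.abs_eq)
    also have "\<dots> = \<epsilon> * norm (X - Y)" using a(1) b(1) by simp
    finally show "norm (mexp X - mexp Y - (X - Y)) \<le> \<epsilon> * norm (X - Y)" .
  qed
qed

lemma continuous_on_mexp: "continuous_on UNIV (mexp :: complex^'n^'n \<Rightarrow> _)"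
proof -
  have "isCont exp X" for X :: "'n cmatrix"
  proof -
    have "(\<lambda>Y. exp Y - exp X) \<midarrow>X\<rightarrow> 0"
    proof (rule Lim_null_comparison)
      have "\<forall>\<^sub>F Y in at X. dist Y X < 1" by (auto simp: eventually_at intro: exI[of _ 1])
      then show "\<forall>\<^sub>F Y in at X. norm (exp Y - exp X) \<le> exp (norm X + 1) * norm (Y - X)"
      proof eventually_elim
        case (elim Y)
        have "norm Y \<le> norm X + norm (Y - X)" using norm_triangle_ineq[of X "Y - X"] by simp
        then show ?case using elim by (intro norm_exp_diff_le(2)) (auto simp: dist_norm)
      qed
      show "(\<lambda>Y. exp (norm X + 1) * norm (Y - X)) \<midarrow>X\<rightarrow> 0"
        by (auto intro!: tendsto_eq_intros)
    qed
    then show ?thesis by (simp add: isCont_def LIM_zero_iff)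
  qed
  then have "continuous_on UNIV (exp :: 'n cmatrix \<Rightarrow> _)" by (simp add: continuous_at_imp_continuous_on)
  then have "continuous_on UNIV (Rep_cmatrix \<circ> exp \<circ> (Abs_cmatrix :: _ \<Rightarrow> 'n cmatrix))"
    by (intro continuous_on_compose bounded_linear.continuous_on[OF bounded_linear_Abs_cmatrix]
        bounded_linear.continuous_on[OF bounded_linear_Rep_cmatrix] continuous_on_id)
      (auto intro: continuous_on_subset)
  then show ?thesis by (simp add: mexp_def[abs_def] o_def)
qed

lemma mexp_has_derivative_0: "(mexp has_derivative (\<lambda>h. h)) (at (0 :: complex^'n^'n))"
  unfolding has_derivative_at_alt
proof (intro conjI allI impI bounded_linear_ident)
  fix \<epsilon> :: real assume "0 < \<epsilon>"
  then obtain \<delta> where \<delta>: "0 < \<delta>"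
    "\<And>X Y :: complex^'n^'n. \<lbrakk>norm X < \<delta>; norm Y < \<delta>\<rbrakk> \<Longrightarrow> norm (mexp X - mexp Y - (X - Y)) \<le> \<epsilon> * norm (X - Y)"
    by (rule mexp_strict_derivative) (rule that)
  then show "\<exists>d>0. \<forall>y :: complex^'n^'n. norm (y - 0) < d \<longrightarrow> norm (mexp y - mexp 0 - (y - 0)) \<le> \<epsilon> * norm (y - 0)"
    using \<delta>(1) \<delta>(2)[of _ 0] by (intro exI[of _ \<delta>]) simp
qed

lemma mexp_locally_surjective:
  assumes "0 < \<epsilon>"
  obtains \<delta> where "0 < \<delta>"
    "\<And>g :: complex^'n^'n. norm (g - mat 1) < \<delta> \<Longrightarrow>
      \<exists>X. norm X < \<epsilon> \<and> mexp X = g \<and> (\<forall>x. x ** g = g ** x \<longrightarrow> x ** X = X ** x)"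
proof -
  obtain a where a: "0 < a" "\<And>A :: complex^'n^'n. norm (Abs_cmatrix A) \<le> norm A * a"
    using bounded_linear.pos_bounded[OF bounded_linear_Abs_cmatrix] by metis
  obtain b where b: "0 < b" "\<And>A :: 'n cmatrix. norm (Rep_cmatrix A) \<le> norm A * b"
    using bounded_linear.pos_bounded[OF bounded_linear_Rep_cmatrix] by metis
  \<comment> \<open>The first bound is what \<open>logarithm_exists\<close> needs; the second makes
    the logarithm smaller than \<open>\<epsilon>\<close> in the Frobenius norm.\<close>
  define r where "r = min (ln (3 / 2)) (\<epsilon> / (2 * b))"
  have r: "0 < r" "r * b < \<epsilon>" using b(1) assms by (auto simp: r_def min_def field_simps)
  have "r \<le> ln (3 / 2)" by (simp add: r_def)
  then have "exp r \<le> exp (ln (3 / 2))" by (simp only: exp_le_cancel_iff)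
  then have er: "exp r \<le> 3 / 2" by (simp only: exp_ln)
  show thesis
  proof (rule that[of "r / (2 * a)"])
    show "0 < r / (2 * a)" using r a by simp
    fix g :: "complex^'n^'n" assume g: "norm (g - mat 1) < r / (2 * a)"
    have "norm (Abs_cmatrix g - 1) \<le> r / 2"
      using a(2)[of "g - mat 1"] g a(1)
      by (simp add: one_cmatrix.abs_eq minus_cmatrix.abs_eq field_simps)
    from logarithm_exists[OF r(1) er this]
    obtain X where X: "norm X \<le> r" "exp X = Abs_cmatrix g"
      "\<And>x. x * Abs_cmatrix g = Abs_cmatrix g * x \<Longrightarrow> x * X = X * x" by blast
    have "norm (Rep_cmatrix X) < \<epsilon>"
      using b(2)[of X] mult_right_mono[OF X(1), of b] b(1) r(2) by linarith
    moreover have "mexp (Rep_cmatrix X) = g" by (simp add: mexp_def Rep_cmatrix_inverse X(2))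
    moreover have "x ** Rep_cmatrix X = Rep_cmatrix X ** x" if "x ** g = g ** x" for x
      using arg_cong[OF X(3)[of "Abs_cmatrix x"], of Rep_cmatrix] that
      by (simp add: times_cmatrix.rep_eq times_cmatrix.abs_eq)
    ultimately show "\<exists>X. norm X < \<epsilon> \<and> mexp X = g \<and> (\<forall>x. x ** g = g ** x \<longrightarrow> x ** X = X ** x)" by blast
  qed
qed

lemma bounded_bilinear_matrix_mult: "bounded_bilinear ((**) :: complex^'n^'n \<Rightarrow> complex^'n^'n \<Rightarrow> complex^'n^'n)"
proof -
  have "bilinear ((**) :: complex^'n^'n \<Rightarrow> complex^'n^'n \<Rightarrow> complex^'n^'n)"
    unfolding bilinear_def
    by (auto intro!: linearI simp: matrix_matrix_mult_def vec_eq_iff sum.distrib algebra_simps scaleR_right.sum)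
  then show ?thesis by (simp add: bilinear_conv_bounded_bilinear)
qed

section \<open>Logarithms in closed linear groups\<close>

text \<open>Only invertible limits are required to lie in \<open>G\<close>: the group is closed in
  the general linear group, not necessarily among all matrices.\<close>

locale closed_linear_group =
  fixes G :: "(complex^'n^'n) set"
  assumes one: "mat 1 \<in> G"
    and mult: "\<lbrakk>A \<in> G; B \<in> G\<rbrakk> \<Longrightarrow> A ** B \<in> G"
    and inv: "\<lbrakk>A \<in> G; A ** B = mat 1; B ** A = mat 1\<rbrakk> \<Longrightarrow> B \<in> G"
    and lim: "\<lbrakk>\<And>n::nat. X n \<in> G; X \<longlonglongrightarrow> A; invertible A\<rbrakk> \<Longrightarrow> A \<in> G"
begin

definition lie_algebra :: "(complex^'n^'n) set" where
  "lie_algebra = {X. \<forall>t. mexp (t *\<^sub>R X) \<in> G}"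

lemma mexp_of_int: "mexp X \<in> G \<Longrightarrow> mexp (of_int k *\<^sub>R X) \<in> G"
proof -
  assume X: "mexp X \<in> G"
  have nat: "mexp (real n *\<^sub>R X) \<in> G" for n
  proof (induction n)
    case (Suc n)
    have "mexp (real (Suc n) *\<^sub>R X) = mexp (real n *\<^sub>R X) ** mexp (1 *\<^sub>R X)"
      unfolding mexp_add_scaled[symmetric] by (simp add: add.commute)
    then show ?case using mult[OF Suc.IH X] by simp
  qed (simp add: one)
  show ?thesis
  proof (cases "0 \<le> k")
    case True
    then show ?thesis using nat[of "nat k"] by simp
  next
    case False
    then have "mexp (- (of_int k *\<^sub>R X)) \<in> G" using nat[of "nat (- k)"] by simp
    from inv[OF this mexp_minus(2,1)] show ?thesis .
  qed
qed

text \<open>Powers of elements of \<open>G\<close> close to the unit approximate a one-parameter group.\<close>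

lemma mexp_limit:
  assumes G: "\<forall>\<^sub>F n in sequentially. mexp (X n) \<in> G" and X: "X \<longlonglongrightarrow> 0" and Z: "(\<lambda>n. c n *\<^sub>R X n) \<longlonglongrightarrow> Z"
  shows "mexp Z \<in> G"
proof -
  \<comment> \<open>Rounding \<open>c n\<close> down changes \<open>c n *\<^sub>R X n\<close> by at
    most \<open>norm (X n)\<close>, so integer multiples, which are powers in \<open>G\<close>, have
    the same limit.\<close>
  have "(\<lambda>n. frac (c n) *\<^sub>R X n) \<longlonglongrightarrow> 0"
  proof (rule Lim_null_comparison)
    show "\<forall>\<^sub>F n in sequentially. norm (frac (c n) *\<^sub>R X n) \<le> norm (X n)"
      by (intro always_eventually allI) (simp add: frac_ge_0 frac_lt_1 less_imp_le mult_left_le_one_le)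
    show "(\<lambda>n. norm (X n)) \<longlonglongrightarrow> 0" using X by (simp add: tendsto_norm_zero)
  qed
  from tendsto_diff[OF Z this] have "(\<lambda>n. of_int \<lfloor>c n\<rfloor> *\<^sub>R X n) \<longlonglongrightarrow> Z"
    by (simp add: frac_def algebra_simps)
  then have lim_mexp: "(\<lambda>n. mexp (of_int \<lfloor>c n\<rfloor> *\<^sub>R X n)) \<longlonglongrightarrow> mexp Z"
    by (rule continuous_on_tendsto_compose[OF continuous_on_mexp]) simp_all
  obtain m where m: "\<And>n. m \<le> n \<Longrightarrow> mexp (X n) \<in> G"
    using G by (auto simp: eventually_sequentially)
  show ?thesis
  proof (rule lim[OF _ LIMSEQ_ignore_initial_segment[OF lim_mexp, of m] invertible_mexp])
    show "mexp (of_int \<lfloor>c (n + m)\<rfloor> *\<^sub>R X (n + m)) \<in> G" for n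
      by (rule mexp_of_int[OF m]) simp
  qed
qed

lemma lie_algebra_limit:
  assumes "\<forall>\<^sub>F n in sequentially. mexp (X n) \<in> G" "X \<longlonglongrightarrow> 0" "(\<lambda>n. c n *\<^sub>R X n) \<longlonglongrightarrow> Z"
  shows "Z \<in> lie_algebra"
  unfolding lie_algebra_def
proof (intro CollectI allI)
  fix t
  have "(\<lambda>n. (t * c n) *\<^sub>R X n) \<longlonglongrightarrow> t *\<^sub>R Z"
    using tendsto_scaleR[OF tendsto_const assms(3), of t] by simp
  then show "mexp (t *\<^sub>R Z) \<in> G" by (rule mexp_limit[OF assms(1,2)])
qed

lemma lie_algebra_scaleR: "X \<in> lie_algebra \<Longrightarrow> t *\<^sub>R X \<in> lie_algebra"
  by (simp add: lie_algebra_def)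

lemma lie_algebra_mexp: "X \<in> lie_algebra \<Longrightarrow> mexp X \<in> G"
  unfolding lie_algebra_def mem_Collect_eq by (drule spec[of _ 1]) simp

text \<open>The chosen logarithms lie in a ball on which the exponential is injective with
  2-Lipschitz inverse. A logarithm obtained by choice is therefore continuous and inverts the
  exponential near 0.\<close>

lemma local_logarithm:
  obtains \<delta> \<eta> :: real and L :: "complex^'n^'n \<Rightarrow> complex^'n^'n" where "0 < \<delta>" "0 < \<eta>" "L (mat 1) = 0"
    "\<And>g. norm (g - mat 1) < \<delta> \<Longrightarrow> mexp (L g) = g"
    "\<And>g x. \<lbrakk>norm (g - mat 1) < \<delta>; x ** g = g ** x\<rbrakk> \<Longrightarrow> x ** L g = L g ** x"
    "continuous_on {g. norm (g - mat 1) < \<delta>} L"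
    "(L has_derivative (\<lambda>h. h)) (at (mat 1))"
    "\<And>X. \<lbrakk>norm X < \<eta>; norm (mexp X - mat 1) < \<delta>\<rbrakk> \<Longrightarrow> L (mexp X) = X"
proof -
  obtain \<eta> where \<eta>: "0 < \<eta>"
    "\<And>X Y :: complex^'n^'n. \<lbrakk>norm X < \<eta>; norm Y < \<eta>\<rbrakk> \<Longrightarrow> norm (mexp X - mexp Y - (X - Y)) \<le> 1 / 2 * norm (X - Y)"
    by (rule mexp_strict_derivative[of "1 / 2"]) (simp, rule that)
  have lip: "norm (X - Y) \<le> 2 * norm (mexp X - mexp Y)" if "norm X < \<eta>" "norm Y < \<eta>" for X Y :: "complex^'n^'n"
    using \<eta>(2)[OF that] norm_triangle_ineq2[of "X - Y" "mexp X - mexp Y"]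
    by (simp add: norm_minus_commute)
  obtain \<delta> where \<delta>: "0 < \<delta>" "\<And>g :: complex^'n^'n. norm (g - mat 1) < \<delta> \<Longrightarrow>
      \<exists>X. norm X < \<eta> \<and> mexp X = g \<and> (\<forall>x. x ** g = g ** x \<longrightarrow> x ** X = X ** x)"
    by (rule mexp_locally_surjective[OF \<eta>(1)]) (rule that)
  define L where "L g = (SOME X. norm X < \<eta> \<and> mexp X = g \<and> (\<forall>x. x ** g = g ** x \<longrightarrow> x ** X = X ** x))"
    for g :: "complex^'n^'n"
  have L: "\<And>g :: complex^'n^'n. norm (g - mat 1) < \<delta> \<Longrightarrow> norm (L g) < \<eta>"
    "\<And>g. norm (g - mat 1) < \<delta> \<Longrightarrow> mexp (L g) = g"
    "\<And>g x. \<lbrakk>norm (g - mat 1) < \<delta>; x ** g = g ** x\<rbrakk> \<Longrightarrow> x ** L g = L g ** x"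
    using someI_ex[OF \<delta>(2), folded L_def] by auto
  have inverse: "L (mexp X) = X" if "norm X < \<eta>" "norm (mexp X - mat 1) < \<delta>" for X
    using lip[OF L(1)[OF that(2)] that(1)] L(2)[OF that(2)] by simp
  have L1: "L (mat 1) = 0" using inverse[of 0] \<eta>(1) \<delta>(1) by simp
  have Llip: "norm (L g - L g') \<le> 2 * norm (g - g')" if "norm (g - mat 1) < \<delta>" "norm (g' - mat 1) < \<delta>" for g g'
    using lip[OF L(1)[OF that(1)] L(1)[OF that(2)]] L(2)[OF that(1)] L(2)[OF that(2)] by simp
  have cont: "continuous_on {g. norm (g - mat 1) < \<delta>} L"
  proof (rule continuous_on_subset[OF lipschitz_on_continuous_on])
    show "2-lipschitz_on {g. norm (g - mat 1) < \<delta>} L"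
      by (rule lipschitz_onI) (auto simp: dist_norm intro: Llip)
  qed simp
  have deriv: "(L has_derivative (\<lambda>h. h)) (at (mat 1))"
    unfolding has_derivative_at_alt
  proof (intro conjI allI impI bounded_linear_ident)
    fix \<epsilon> :: real assume \<epsilon>: "0 < \<epsilon>"
    obtain \<gamma> where \<gamma>: "0 < \<gamma>"
      "\<And>X Y :: complex^'n^'n. \<lbrakk>norm X < \<gamma>; norm Y < \<gamma>\<rbrakk> \<Longrightarrow> norm (mexp X - mexp Y - (X - Y)) \<le> \<epsilon> / 2 * norm (X - Y)"
      by (rule mexp_strict_derivative[of "\<epsilon> / 2"]) (use \<epsilon> in simp, rule that)
    show "\<exists>d>0. \<forall>g. norm (g - mat 1) < d \<longrightarrow> norm (L g - L (mat 1) - (g - mat 1)) \<le> \<epsilon> * norm (g - mat 1)"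
    \<comment> \<open>\<open>L\<close> is 2-Lipschitz and vanishes at the unit, so
      \<open>\<gamma> / 2\<close> keeps \<open>L g\<close> within distance \<open>\<gamma>\<close>
      of 0.\<close>
    proof (intro exI[of _ "min \<delta> (\<gamma> / 2)"] conjI allI impI)
      show "0 < min \<delta> (\<gamma> / 2)" using \<delta>(1) \<gamma>(1) by simp
      fix g :: "complex^'n^'n" assume "norm (g - mat 1) < min \<delta> (\<gamma> / 2)"
      then have g: "norm (g - mat 1) < \<delta>" "norm (g - mat 1) < \<gamma> / 2" by auto
      have Lg: "norm (L g) \<le> 2 * norm (g - mat 1)"
        using Llip[OF g(1), of "mat 1"] L1 \<delta>(1) by simp
      have "norm (g - mat 1 - L g) \<le> \<epsilon> / 2 * norm (L g)"
        using \<gamma>(2)[of "L g" 0] Lg g \<gamma>(1) L(2)[OF g(1)] by simp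
      also have "\<dots> \<le> \<epsilon> / 2 * (2 * norm (g - mat 1))" using Lg \<epsilon> by (intro mult_left_mono) auto
      finally show "norm (L g - L (mat 1) - (g - mat 1)) \<le> \<epsilon> * norm (g - mat 1)"
        by (simp add: L1 norm_minus_commute)
    qed
  qed
  show thesis by (rule that[OF \<delta>(1) \<eta>(1) L1 L(2,3) cont deriv inverse])
qed

text \<open>The logarithm of \<open>exp (s X) exp (s Y)\<close> has derivative \<open>X + Y\<close>
  at \<open>s = 0\<close>. At \<open>s = 1 / (n + 1)\<close> its multiples by \<open>n + 1\<close>
  tend to \<open>X + Y\<close>, so \<open>lie_algebra_limit\<close> applies.\<close>

lemma lie_algebra_add:
  assumes X: "X \<in> lie_algebra" and Y: "Y \<in> lie_algebra"
  shows "X + Y \<in> lie_algebra"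
proof -
  obtain \<delta> \<eta> L where \<delta>: "0 < \<delta>" and L1: "L (mat 1) = 0" and mexp_L: "\<And>g :: complex^'n^'n. norm (g - mat 1) < \<delta> \<Longrightarrow> mexp (L g) = g"
    and L_deriv: "(L has_derivative (\<lambda>h. h)) (at (mat 1 :: complex^'n^'n))"
    by (rule local_logarithm) (rule that)
  define \<phi> where "\<phi> s = mexp (s *\<^sub>R X) ** mexp (s *\<^sub>R Y)" for s :: real
  have scaled: "((\<lambda>s. mexp (s *\<^sub>R A)) has_derivative (\<lambda>s. s *\<^sub>R A)) (at 0)" for A :: "complex^'n^'n"
  proof -
    have "((\<lambda>s. s *\<^sub>R A) has_derivative (\<lambda>s. s *\<^sub>R A)) (at 0)"
      by (rule bounded_linear_imp_has_derivative[OF bounded_linear_scaleR_left])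
    from diff_chain_at[OF this, of mexp "\<lambda>h. h"] mexp_has_derivative_0
    show ?thesis by (simp add: o_def)
  qed
  have "(\<phi> has_derivative (\<lambda>h. mexp (0 *\<^sub>R X) ** (h *\<^sub>R Y) + (h *\<^sub>R X) ** mexp (0 *\<^sub>R Y))) (at 0)"
    unfolding \<phi>_def by (rule bounded_bilinear.FDERIV[OF bounded_bilinear_matrix_mult scaled scaled])
  then have \<phi>_deriv: "(\<phi> has_derivative (\<lambda>h. h *\<^sub>R (X + Y))) (at 0)"
    by (simp add: scaleR_right_distrib add.commute)
  have \<phi>0: "\<phi> 0 = mat 1" by (simp add: \<phi>_def)
  define \<psi> where "\<psi> s = L (\<phi> s)" for s
  have \<psi>0: "\<psi> 0 = 0" by (simp add: \<psi>_def \<phi>0 L1)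
  have \<psi>_deriv: "(\<psi> has_derivative (\<lambda>h. h *\<^sub>R (X + Y))) (at 0)"
    using diff_chain_at[OF \<phi>_deriv, of L "\<lambda>h. h"] L_deriv by (simp add: \<phi>0 o_def \<psi>_def[abs_def])
  define t where "t n = inverse (real (Suc n))" for n
  have t0: "t \<longlonglongrightarrow> 0" unfolding t_def by (rule LIMSEQ_inverse_real_of_nat)
  then have t: "filterlim t (at 0) sequentially"
    by (simp add: filterlim_at t_def)
  have "(\<lambda>h. norm (\<psi> h - h *\<^sub>R (X + Y)) / norm h) \<midarrow>0\<rightarrow> 0"
    using \<psi>_deriv by (simp add: has_derivative_at \<psi>0)
  from filterlim_compose[OF this t] have "(\<lambda>n. norm (\<psi> (t n) - t n *\<^sub>R (X + Y)) / norm (t n)) \<longlonglongrightarrow> 0" .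
  moreover have "norm (\<psi> (t n) - t n *\<^sub>R (X + Y)) / norm (t n) = norm (real (Suc n) *\<^sub>R \<psi> (t n) - (X + Y))" for n
  proof -
    have "real (Suc n) *\<^sub>R \<psi> (t n) - (X + Y) = real (Suc n) *\<^sub>R (\<psi> (t n) - t n *\<^sub>R (X + Y))"
      unfolding t_def scaleR_diff_right by simp
    then show ?thesis by (simp add: t_def divide_inverse mult.commute)
  qed
  ultimately have "(\<lambda>n. norm (real (Suc n) *\<^sub>R \<psi> (t n) - (X + Y))) \<longlonglongrightarrow> 0" by simp
  then have 1: "(\<lambda>n. real (Suc n) *\<^sub>R \<psi> (t n)) \<longlonglongrightarrow> X + Y"
    by (simp only: tendsto_norm_zero_iff LIM_zero_iff)
  have 2: "(\<lambda>n. \<psi> (t n)) \<longlonglongrightarrow> 0"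
    using isCont_tendsto_compose[OF has_derivative_continuous[OF \<psi>_deriv] t0] by (simp add: \<psi>0)
  have "(\<lambda>n. \<phi> (t n)) \<longlonglongrightarrow> mat 1"
    using isCont_tendsto_compose[OF has_derivative_continuous[OF \<phi>_deriv] t0] by (simp add: \<phi>0)
  then have "\<forall>\<^sub>F n in sequentially. dist (\<phi> (t n)) (mat 1) < \<delta>" using \<delta> by (rule tendstoD)
  then have 3: "\<forall>\<^sub>F n in sequentially. mexp (\<psi> (t n)) \<in> G"
  proof eventually_elim
    case (elim n)
    then have "mexp (\<psi> (t n)) = \<phi> (t n)" unfolding \<psi>_def by (intro mexp_L) (simp add: dist_norm)
    then show ?case
      using mult[of "mexp (t n *\<^sub>R X)" "mexp (t n *\<^sub>R Y)"] X Y by (simp add: \<phi>_def lie_algebra_def)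
  qed
  show ?thesis by (rule lie_algebra_limit[OF 3 2 1])
qed

lemma subspace_lie_algebra: "subspace lie_algebra"
  by (auto simp: subspace_def lie_algebra_add lie_algebra_scaleR) (simp add: lie_algebra_def one)

lemma orthogonal_projection:
  obtains P where "bounded_linear P" "\<And>X. P X \<in> lie_algebra" "\<And>X Y. Y \<in> lie_algebra \<Longrightarrow> (X - P X) \<bullet> Y = 0"
proof -
  obtain B where B: "B \<subseteq> lie_algebra" "pairwise orthogonal B" "\<And>x. x \<in> B \<Longrightarrow> norm x = 1"
    and "independent B" "span B = lie_algebra"
    using orthonormal_basis_subspace[OF subspace_lie_algebra] by metis
  have fin: "finite B" using \<open>independent B\<close> by (simp add: independent_imp_finite)
  define P where "P X = (\<Sum>b\<in>B. (X \<bullet> b) *\<^sub>R b)" for X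
  have orth: "(X - P X) \<bullet> b = 0" if "b \<in> B" for X b
  proof -
    have "P X \<bullet> b = (\<Sum>c\<in>B. (X \<bullet> c) * (c \<bullet> b))" by (simp add: P_def inner_sum_left)
    also have "\<dots> = (\<Sum>c\<in>B. if c = b then X \<bullet> b else 0)"
    proof (rule sum.cong)
      fix c assume "c \<in> B"
      then show "(X \<bullet> c) * (c \<bullet> b) = (if c = b then X \<bullet> b else 0)"
        using B(2,3) that by (auto simp: pairwise_def orthogonal_def norm_eq_1)
    qed simp
    also have "\<dots> = X \<bullet> b" using fin that by simp
    finally show ?thesis by (simp add: inner_diff_left)
  qed
  show thesis
  proof (rule that[of P])
    show "bounded_linear P"
      unfolding P_def
      by (intro bounded_linear_sum bounded_linear_scaleR_const bounded_linear_inner_left)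
    show "P X \<in> lie_algebra" for X
      unfolding P_def using B(1) by (intro subspace_sum subspace_lie_algebra lie_algebra_scaleR) auto
    show "(X - P X) \<bullet> Y = 0" if "Y \<in> lie_algebra" for X Y
      using orthogonal_to_span[of Y B "X - P X"] orth that \<open>span B = lie_algebra\<close> by (simp add: orthogonal_def)
  qed
qed

text \<open>
  Cartan's closed subgroup theorem. Otherwise there are elements \<open>exp A \<cdot> exp B\<close> of \<open>G\<close> close to the unit
  with \<open>A\<close> in the Lie algebra and \<open>B \<noteq> 0\<close> orthogonal to it; a limit direction of these \<open>B\<close> lies in the
  Lie algebra and is orthogonal to it.
\<close>

lemma logarithm_in_lie_algebra:
  assumes \<delta>: "0 < \<delta>" "0 < \<eta>"
    and L: "\<And>X :: complex^'n^'n. \<lbrakk>norm X < \<eta>; norm (mexp X - mat 1) < \<delta>\<rbrakk> \<Longrightarrow> L (mexp X) = X"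
  shows "\<exists>\<rho>>0. \<forall>g\<in>G. norm (g - mat 1) < \<rho> \<longrightarrow> L g \<in> lie_algebra"
proof (rule ccontr)
  assume neg: "\<not> ?thesis"
  obtain P where P: "bounded_linear P" "\<And>X. P X \<in> lie_algebra"
    and orth: "\<And>X Y. Y \<in> lie_algebra \<Longrightarrow> (X - P X) \<bullet> Y = 0"
    by (rule orthogonal_projection) (rule that)
  have P0: "P 0 = 0" using P(1) by (simp add: bounded_linear.linear linear_0)
  have Q: "bounded_linear (\<lambda>X. X - P X)" by (intro bounded_linear_sub bounded_linear_ident P(1))
  define F where "F X = mexp (P X) ** mexp (X - P X)" for X
  have F_cont: "continuous_on UNIV F"
    unfolding F_def
    by (intro bounded_bilinear.continuous_on[OF bounded_bilinear_matrix_mult]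
        continuous_on_compose2[OF continuous_on_mexp] bounded_linear.continuous_on[OF P(1)]
        bounded_linear.continuous_on[OF Q] continuous_on_id) auto
  have deriv: "((\<lambda>X. mexp (f X)) has_derivative f) (at 0)"
    if "bounded_linear f" for f :: "complex^'n^'n \<Rightarrow> complex^'n^'n"
    using diff_chain_at[OF bounded_linear_imp_has_derivative[OF that, of "at 0"], of mexp "\<lambda>h. h"]
      mexp_has_derivative_0 linear_0[OF bounded_linear.linear[OF that]] by (simp add: o_def)
  have "(F has_derivative (\<lambda>h. mexp (P 0) ** (h - P h) + P h ** mexp (0 - P 0))) (at 0)"
    unfolding F_def by (rule bounded_bilinear.FDERIV[OF bounded_bilinear_matrix_mult deriv[OF P(1)] deriv[OF Q]])
  then have F_deriv: "(F has_derivative (\<lambda>h. h)) (at 0)" by (simp add: P0)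
  have "\<exists>g X. g \<in> G \<and> L g \<notin> lie_algebra \<and> norm (g - mat 1) < \<delta> \<and> F X = g \<and> norm X < inverse (real (Suc n))" for n
  proof -
    let ?B = "ball (0 :: complex^'n^'n) (inverse (real (Suc n)))"
    \<comment> \<open>\<open>F\<close> is continuous with identity derivative at 0, hence open at 0:
      elements near the unit are products of the exponentials of a small element of the Lie algebra
      and a small element orthogonal to it.\<close>
    have "F 0 \<in> interior (F ` ?B)"
      using F_cont F_deriv
      by (intro sussmann_open_mapping[of UNIV F 0 "\<lambda>h. h" "\<lambda>h. h"]) (auto simp: o_def id_def interior_open)
    then have "mat 1 \<in> interior (F ` ?B)" by (simp add: F_def P0)
    then obtain \<epsilon> where \<epsilon>: "0 < \<epsilon>" "ball (mat 1) \<epsilon> \<subseteq> F ` ?B" by (auto simp: mem_interior)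
    have "\<exists>g\<in>G. norm (g - mat 1) < min \<epsilon> \<delta> \<and> L g \<notin> lie_algebra"
    proof -
      have "0 < min \<epsilon> \<delta>" using \<epsilon>(1) \<delta>(1) by simp
      with neg show ?thesis by blast
    qed
    then obtain g where g: "g \<in> G" "norm (g - mat 1) < min \<epsilon> \<delta>" "L g \<notin> lie_algebra" by blast
    then have "g \<in> F ` ?B" using \<epsilon>(2) by (auto simp: dist_norm norm_minus_commute subset_iff)
    then obtain X where "norm X < inverse (real (Suc n))" "g = F X" by auto
    then show ?thesis using g by (intro exI[of _ g] exI[of _ X]) simp
  qed
  then obtain g X where gX: "\<And>n. g n \<in> G" "\<And>n. L (g n) \<notin> lie_algebra" "\<And>n. norm (g n - mat 1) < \<delta>"
    "\<And>n. F (X n) = g n" "\<And>n. norm (X n) < inverse (real (Suc n))"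
    by metis
  have X: "X \<longlonglongrightarrow> 0"
    by (rule Lim_null_comparison[OF always_eventually LIMSEQ_inverse_real_of_nat]) (use gX(5) in \<open>auto intro: less_imp_le\<close>)
  define B where "B n = X n - P (X n)" for n
  have B: "B \<longlonglongrightarrow> 0" and A: "(\<lambda>n. P (X n)) \<longlonglongrightarrow> 0"
    using bounded_linear.tendsto[OF Q X] bounded_linear.tendsto[OF P(1) X] by (simp_all add: B_def[abs_def] P0)
  have BG: "mexp (B n) \<in> G" for n
  proof -
    have "mexp (B n) = mexp (- P (X n)) ** g n"
      using gX(4)[of n] mexp_minus[of "P (X n)"] by (simp add: F_def B_def matrix_mul_assoc flip: gX(4))
    moreover have "mexp (- P (X n)) \<in> G"
      using lie_algebra_mexp[OF lie_algebra_scaleR[OF P(2), of "-1"]] by simp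
    ultimately show ?thesis using mult gX(1) by simp
  qed
  have "\<forall>\<^sub>F n in sequentially. dist (P (X n)) 0 < \<eta>" using A \<delta>(2) by (rule tendstoD)
  then obtain m where m: "\<And>n. m \<le> n \<Longrightarrow> norm (P (X n)) < \<eta>" by (auto simp: eventually_sequentially)
  \<comment> \<open>Without an orthogonal part, \<open>g n\<close> would be the exponential of a
    small element of the Lie algebra, and \<open>L\<close> would return that element.\<close>
  have nz: "B n \<noteq> 0" if "m \<le> n" for n
  proof
    assume "B n = 0"
    then have "g n = mexp (P (X n))" using gX(4)[of n] by (simp add: F_def B_def)
    then have "L (g n) = P (X n)" using L[OF m[OF that]] gX(3)[of n] by simp
    then show False using gX(2)[of n] P(2)[of "X n"] by simp
  qed
  define S where "S n = B (n + m) /\<^sub>R norm (B (n + m))" for n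
  have "S n \<in> sphere 0 1" for n using nz[of "n + m"] by (simp add: S_def)
  then obtain Z r where r: "strict_mono r" and Z: "Z \<in> sphere 0 1" "(S \<circ> r) \<longlonglongrightarrow> Z"
    using seq_compactE[OF compact_imp_seq_compact[OF compact_sphere], of S "0 :: complex^'n^'n" 1] by metis
  have "filterlim (\<lambda>n. r n + m) sequentially sequentially"
    using filterlim_subseq[OF r] by (intro filterlim_at_top_mono[OF filterlim_subseq[OF r]]) auto
  then have Br: "(\<lambda>n. B (r n + m)) \<longlonglongrightarrow> 0" by (rule filterlim_compose[OF B])
  have "Z \<in> lie_algebra"
  proof (rule lie_algebra_limit[OF _ Br])
    show "\<forall>\<^sub>F n in sequentially. mexp (B (r n + m)) \<in> G" by (simp add: BG)
    show "(\<lambda>n. inverse (norm (B (r n + m))) *\<^sub>R B (r n + m)) \<longlonglongrightarrow> Z"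
      using Z(2) by (simp add: S_def o_def)
  qed
  then have "S n \<bullet> Z = 0" for n using orth by (simp add: S_def B_def)
  moreover have "(\<lambda>n. (S \<circ> r) n \<bullet> Z) \<longlonglongrightarrow> Z \<bullet> Z" by (intro tendsto_inner Z(2) tendsto_const)
  ultimately have "Z \<bullet> Z = 0" by (simp add: LIMSEQ_const_iff)
  then show False using Z(1) by simp
qed

definition unit_contraction :: "(complex^'n^'n \<Rightarrow> real) \<Rightarrow> (complex^'n^'n \<Rightarrow> real \<Rightarrow> complex^'n^'n) \<Rightarrow> bool" where
  "unit_contraction e h \<longleftrightarrow> continuous_on G e \<and> (\<forall>g. e g \<in> {0..1}) \<and> (\<forall>g. e g = 0 \<longleftrightarrow> g = mat 1) \<and>
    continuous_on (G \<times> {0..1}) (\<lambda>x. h (fst x) (snd x)) \<and> (\<forall>g s. g \<in> G \<longrightarrow> s \<in> {0..1} \<longrightarrow> h g s \<in> G) \<and>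
    (\<forall>g. g \<in> G \<longrightarrow> h g 0 = g) \<and> (\<forall>g s. g \<in> G \<longrightarrow> e g < 1 \<longrightarrow> s \<in> {e g..1} \<longrightarrow> h g s = mat 1) \<and>
    (\<forall>g x s. g \<in> G \<longrightarrow> x ** g = g ** x \<longrightarrow> x ** h g s = h g s ** x)"

lemma unit_contraction_exists: "\<exists>e h. unit_contraction e h"
proof -
  obtain \<delta> \<eta> L where \<delta>: "0 < \<delta>" "0 < \<eta>" and L1: "L (mat 1 :: complex^'n^'n) = 0"
    and mexp_L: "\<And>g. norm (g - mat 1) < \<delta> \<Longrightarrow> mexp (L g) = g"
    and L_comm: "\<And>g x. \<lbrakk>norm (g - mat 1) < \<delta>; x ** g = g ** x\<rbrakk> \<Longrightarrow> x ** L g = L g ** x"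
    and L_cont: "continuous_on {g. norm (g - mat 1) < \<delta>} L"
    and L_inv: "\<And>X. \<lbrakk>norm X < \<eta>; norm (mexp X - mat 1) < \<delta>\<rbrakk> \<Longrightarrow> L (mexp X) = X"
    by (rule local_logarithm) (rule that)
  obtain \<rho> where \<rho>: "0 < \<rho>" "\<And>g. \<lbrakk>g \<in> G; norm (g - mat 1) < \<rho>\<rbrakk> \<Longrightarrow> L g \<in> lie_algebra"
    using logarithm_in_lie_algebra[OF \<delta> L_inv] by auto
  \<comment> \<open>Dividing by 3 keeps the region of motion, up to distance
    \<open>2 * \<sigma>\<close>, strictly inside both neighbourhoods.\<close>
  define \<sigma> where "\<sigma> = min \<delta> \<rho> / 3"
  have \<sigma>: "0 < \<sigma>" "2 * \<sigma> < \<delta>" "2 * \<sigma> < \<rho>" using \<delta>(1) \<rho>(1) by (auto simp: \<sigma>_def min_def)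
  define d where "d g = norm (g - mat 1)" for g :: "complex^'n^'n"
  \<comment> \<open>The speed is \<open>\<sigma>\<close> up to distance \<open>\<sigma>\<close> and
    fades to 0 at \<open>2 * \<sigma>\<close>. Close to the unit, \<open>\<mu>\<close> thus reaches
    0 at time \<open>d g / \<sigma>\<close>, the arrival time \<open>e g\<close>, and at distance
    \<open>2 * \<sigma>\<close> the motion joins the identity.\<close>
  define \<theta> where "\<theta> t = min \<sigma> (max 0 (2 * \<sigma> - t))" for t
  define \<mu> where "\<mu> g s = max 0 (1 - s * \<theta> (d g) / d g)" for g and s :: real
  define e where "e g = min 1 (d g / \<sigma>)" for g
  define h where "h g s = (if d g \<le> 2 * \<sigma> then mexp (\<mu> g s *\<^sub>R L g) else g)" for g s
  have d_cont: "continuous_on A d" for A unfolding d_def by (intro continuous_intros)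
  have d_nonneg: "0 \<le> d g" for g by (simp add: d_def)
  have d_0: "d g = 0 \<longleftrightarrow> g = mat 1" for g by (simp add: d_def)
  have \<theta>: "0 \<le> \<theta> t" for t using \<sigma>(1) by (simp add: \<theta>_def)
  have \<mu>01: "\<mu> g s \<in> {0..1}" if "0 \<le> s" for g s
    using that \<theta>[of "d g"] d_nonneg[of g] by (auto simp: \<mu>_def)
  have "unit_contraction e h"
    unfolding unit_contraction_def
  proof (intro conjI allI impI)
    show "continuous_on G e" unfolding e_def using \<sigma>(1) by (intro continuous_intros d_cont) auto
    show "e g \<in> {0..1}" for g using d_nonneg[of g] \<sigma>(1) by (simp add: e_def)
    show "e g = 0 \<longleftrightarrow> g = mat 1" for g using d_0[of g] \<sigma>(1) by (auto simp: e_def min_def)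
    show "h g 0 = g" if "g \<in> G" for g
      using mexp_L[of g] \<sigma>(2) by (auto simp: h_def \<mu>_def d_def)
    show "h g s = mat 1" if "g \<in> G" "e g < 1" "s \<in> {e g..1}" for g s
    proof -
      have d: "d g < \<sigma>" "d g / \<sigma> \<le> s" using that(2,3) \<sigma>(1) by (auto simp: e_def min_def split: if_splits)
      then have "\<theta> (d g) = \<sigma>" using \<sigma>(1) by (simp add: \<theta>_def)
      moreover have "d g \<le> s * \<sigma>" using d(2) \<sigma>(1) by (simp add: pos_divide_le_eq)
      ultimately have "\<mu> g s = 0 \<or> d g = 0" using d_nonneg[of g] by (auto simp: \<mu>_def)
      then show ?thesis using d \<sigma>(1) L1 d_0[of g] by (auto simp: h_def)
    qed
    show "h g s \<in> G" if "g \<in> G" "s \<in> {0..1}" for g s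
    proof (cases "d g \<le> 2 * \<sigma>")
      case True
      then have "L g \<in> lie_algebra" using \<rho>(2)[OF that(1)] \<sigma>(3) by (simp add: d_def)
      then show ?thesis using True by (simp add: h_def lie_algebra_def)
    qed (use that in \<open>simp add: h_def\<close>)
    show "x ** h g s = h g s ** x" if "g \<in> G" "x ** g = g ** x" for g x s
    proof (cases "d g \<le> 2 * \<sigma>")
      case True
      then have "x ** L g = L g ** x" using L_comm[OF _ that(2)] \<sigma>(2) by (simp add: d_def)
      then have "x ** (\<mu> g s *\<^sub>R L g) = (\<mu> g s *\<^sub>R L g) ** x"
        by (simp add: bounded_bilinear.scaleR_left[OF bounded_bilinear_matrix_mult]
            bounded_bilinear.scaleR_right[OF bounded_bilinear_matrix_mult])
      then show ?thesis using True by (simp add: h_def mexp_commute)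
    qed (use that in \<open>simp add: h_def\<close>)
    let ?S = "{x \<in> G \<times> {0..1::real}. d (fst x) \<le> 2 * \<sigma>}"
    have Lc: "continuous_on ?S (\<lambda>x. L (fst x))"
      using \<sigma>(2) by (intro continuous_on_compose2[OF L_cont] continuous_intros) (auto simp: d_def)
    have "continuous_on ?S (\<lambda>x. \<mu> (fst x) (snd x) *\<^sub>R L (fst x))"
      unfolding continuous_on_eq_continuous_within
    proof
      fix x assume x: "x \<in> ?S"
      have Lx: "continuous (at x within ?S) (\<lambda>x. L (fst x))"
        by (rule Lc[unfolded continuous_on_eq_continuous_within, rule_format, OF x])
      have dx: "continuous (at x within ?S) (\<lambda>x. d (fst x))"
        unfolding d_def by (intro continuous_intros)
      show "continuous (at x within ?S) (\<lambda>x. \<mu> (fst x) (snd x) *\<^sub>R L (fst x))"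
      proof (cases "d (fst x) = 0")
        case False
        then show ?thesis
          unfolding \<mu>_def \<theta>_def by (intro continuous_intros Lx dx)
      next
        \<comment> \<open>At the unit \<open>\<mu>\<close> may jump because of the division by
          \<open>d g\<close>, but it is bounded by 1 and \<open>L\<close> tends to 0.\<close>
        case True
        then have x1: "L (fst x) = 0" using d_0[of "fst x"] L1 by simp
        have "((\<lambda>x. \<mu> (fst x) (snd x) *\<^sub>R L (fst x)) \<longlongrightarrow> 0) (at x within ?S)"
        proof (rule Lim_null_comparison)
          show "((\<lambda>x. norm (L (fst x))) \<longlongrightarrow> 0) (at x within ?S)"
            using Lx x1 by (simp add: continuous_within tendsto_norm_zero)
          show "\<forall>\<^sub>F y in at x within ?S. norm (\<mu> (fst y) (snd y) *\<^sub>R L (fst y)) \<le> norm (L (fst y))"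
            unfolding eventually_at_filter
            by (intro always_eventually allI impI) (use \<mu>01 in \<open>auto intro!: mult_left_le_one_le\<close>)
        qed
        then show ?thesis by (simp add: continuous_within x1)
      qed
    qed
    then have "continuous_on ?S (\<lambda>x. mexp (\<mu> (fst x) (snd x) *\<^sub>R L (fst x)))"
      by (rule continuous_on_compose2[OF continuous_on_mexp]) auto
    moreover have "mexp (\<mu> (fst x) (snd x) *\<^sub>R L (fst x)) = fst x" if "d (fst x) = 2 * \<sigma>" for x :: "(complex^'n^'n) \<times> real"
      using mexp_L[of "fst x"] \<sigma>(1,2) that by (simp add: \<mu>_def \<theta>_def d_def)
    ultimately show "continuous_on (G \<times> {0..1}) (\<lambda>x. h (fst x) (snd x))"
      unfolding h_def by (intro continuous_on_cases_le continuous_intros continuous_on_compose2[OF d_cont[of UNIV]]) auto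
  qed
  then show ?thesis by blast
qed

end

section \<open>The splitting for closed linear groups\<close>

theorem theorem2p11:
  fixes G :: "(complex^'n^'n) set"
  assumes "subgroup G GL"
    and "closedin (top_of_set (carrier GL)) G"
  shows "fst (suspension (Comm (GL\<lparr>carrier := G\<rparr>))) homotopy_equivalent_space
    fst (wedge {1..} (\<lambda>n. suspension (hat_Hom (GL\<lparr>carrier := G\<rparr>) n)))"
proof -
  let ?G = "GL\<lparr>carrier := G\<rparr> :: (complex^'n^'n) monoid"
  interpret GL: group "GL :: (complex^'n^'n) monoid" by (rule group_GL)
  interpret sub: subgroup G GL by (rule assms(1))
  have ops: "\<one>\<^bsub>GL\<^esub> = mat 1" "x \<otimes>\<^bsub>GL\<^esub> y = x ** y" for x y :: "complex^'n^'n"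
    by (simp_all add: GL_def)
  have invertible: "A \<in> carrier GL \<longleftrightarrow> invertible A" for A :: "complex^'n^'n"
    by (simp add: GL_def)
  obtain C where C: "closed C" "G = carrier GL \<inter> C"
    using assms(2) by (auto simp: closedin_subtopology)
  interpret lin: closed_linear_group G
  proof
    show "mat 1 \<in> G" using sub.one_closed by (simp add: ops)
    show "A ** B \<in> G" if "A \<in> G" "B \<in> G" for A B
      using sub.m_closed[OF that] by (simp add: ops)
    show "B \<in> G" if "A \<in> G" "A ** B = mat 1" "B ** A = mat 1" for A B
    proof -
      have "B \<in> carrier GL" unfolding invertible invertible_def using that(2,3) by blast
      then have "inv\<^bsub>GL\<^esub> A = B"
        using that sub.mem_carrier[OF that(1)] by (intro GL.inv_equality) (simp_all add: ops)
      then show ?thesis using sub.m_inv_closed[OF that(1)] by simp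
    qed
    show "A \<in> G" if "\<And>n::nat. X n \<in> G" "X \<longlonglongrightarrow> A" "invertible A" for X A
    proof -
      have "A \<in> C" by (rule closed_sequentially[OF C(1) _ that(2)]) (use that(1) C(2) in blast)
      then show ?thesis using that(3) C(2) by (simp add: invertible)
    qed
  qed
  obtain e h where "lin.unit_contraction e h" using lin.unit_contraction_exists by blast
  note eh = this[unfolded lin.unit_contraction_def]
  have monoid: "monoid ?G"
    using sub.subgroup_is_group[OF group_GL] by (rule group.is_monoid)
  have closed_Hom: "closedin (tuple_space ?G n) (topspace (Hom ?G n))" for n
  proof -
    let ?T = "tuple_space ?G n"
    have comp: "continuous_map ?T euclidean (\<lambda>g. g i)" if "i < n" for i
      using continuous_map_product_projection[of i "{..<n}" "\<lambda>_. top_of_set (carrier ?G)"] that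
      unfolding tuple_space_def by (simp add: continuous_map_in_subtopology)
    have prod: "continuous_map ?T euclidean (\<lambda>g. g i ** g j)" if "i < n" "j < n" for i j
    proof -
      have "continuous_on UNIV (\<lambda>x :: (complex^'n^'n) \<times> (complex^'n^'n). fst x ** snd x)"
        by (intro bounded_bilinear.continuous_on[OF bounded_bilinear_matrix_mult] continuous_intros)
      then have "continuous_map (prod_topology euclidean euclidean) euclidean 
          (\<lambda>x :: (complex^'n^'n) \<times> (complex^'n^'n). fst x ** snd x)"
        by simp
      from continuous_map_apply[OF this continuous_map_pairedI[OF comp[OF that(1)] comp[OF that(2)]]]
      show ?thesis by simp
    qed
    define E where "E = (\<lambda>(i, j). {g \<in> topspace ?T. g i ** g j = g j ** g i})"
    have "closedin ?T (E (i, j))" if "i < n" "j < n" for i j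
      unfolding E_def prod.case using that
      by (intro closedin_continuous_maps_eq[OF Hausdorff_space_euclidean] prod)
    \<comment> \<open>Inserting the whole space keeps the intersection inside it and covers
      \<open>n = 0\<close>, where there are no equations.\<close>
    then have "closedin ?T (\<Inter> (insert (topspace ?T) (E ` ({..<n} \<times> {..<n}))))"
      by (intro closedin_Inter) auto
    moreover have "topspace (Hom ?G n) = \<Inter> (insert (topspace ?T) (E ` ({..<n} \<times> {..<n})))"
      by (auto simp: Hom_def ops E_def)
    ultimately show ?thesis by simp
  qed
  interpret commuting_deformation ?G e h
  proof (intro commuting_deformation.intro commuting_deformation_axioms.intro monoid closed_Hom)
    show "continuous_map (prod_topology (top_of_set (carrier ?G)) (top_of_set {0..1})) (top_of_set (carrier ?G))
        (\<lambda>x. h (fst x) (snd x))"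
      using eh by (auto simp: continuous_map_in_subtopology)
  qed (use eh in \<open>auto simp: ops\<close>)
  show ?thesis by (rule suspension_Comm_homotopy_equivalent)
qed

end
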